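(* Let $E$ be a complex Banach space and let $\mathcal{C}\subset E$ be a $p$-reproducing $p$-cone of aperture bounded by $K>0$. Let $T\in\mathcal{L}(E)$ be such that $T\mathcal{C}^*\subset\mathcal{C}^*$ and $\operatorname{diam}_{\mathcal{C}}(T\mathcal{C})=\Delta<\infty$. Let $\eta<1$ be the contraction coefficient of $T$. Then $T$ has a spectral gap: there exist a $p$-dimensional subspace $V$ of $E$ and a closed complement $W$ of $V$ in $E$, both stable under $T$, such that $$\sup\{|\mu|:\mu\in \operatorname{Sp}(T_{|W})\}\le \eta\cdot\inf\{|\mu|:\mu\in\operatorname{Sp}(T_{|V})\}.$$
   Context: Let $p\ge 1$ be an integer; $X^*=X\setminus\{0\}$; $\mathcal{L}(E)$ is the space of bounded linear operators on $E$; $|\cdot|$ on $\mathbb{C}^p$ is the standard hermitian norm; $\operatorname{Sp}$ is the spectrum. (If $W=\{0\}$ the supremum over the empty set is $0$.) **$p$-cones.** A closed $p$-dimensional cone is a nonempty closed subset $\mathcal{C}\subset E$ which is a union of $p$-dimensional subspaces of $E$. A $p$-cone is a closed $p$-dimensional cone containing no $(p+1)$-dimensional subspace. **Gauge on one-dimensional cones.** A $\mathbb{C}$-cone is a closed, $\mathbb{C}$-invariant subset $\mathcal{D}\ne\{0\}$ of a complex Banach space containing no complex $2$-dimensional subspace. Throughout, $\delta_{\mathcal{D}}:\mathcal{D}^*\times\mathcal{D}^*\to[0,\infty]$ denotes one of the following two gauges (the same choice everywhere; the result holds for each choice). In both cases $\delta_{\mathcal{D}}(x,y)=0$ if $x,y$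 are colinear. If $x,y$ are linearly independent: (1) let $D(x,y)=\{\lambda\in\mathbb{C}\cup\{\infty\} : (1+\lambda)x+(1-\lambda)y\in\mathcal{D}\}$, with $\infty\in D(x,y)$ iff $x-y\in\mathcal{D}$; if $-1$ and $1$ lie in the same connected component $U$ of the interior of $D(x,y)$ in the Riemann sphere, then $\delta_{\mathcal{D}}(x,y)=d_U(-1,1)$, where $d_U$ is the hyperbolic (Poincaré) metric of curvature $-1$ on $U$; otherwise $\delta_{\mathcal{D}}(x,y)=\infty$; (2) let $E_{\mathcal{D}}(x,y)=\{z\in\mathbb{C}: zx-y\notin\mathcal{D}\}$ and $\delta_{\mathcal{D}}(x,y)=\log(b/a)$ with $b=\sup|E_{\mathcal{D}}(x,y)|$, $a=\inf|E_{\mathcal{D}}(x,y)|$ (value $\infty$ if $a=0$ or $b=\infty$). **Cone distance.** For a $p$-cone $\mathcal{C}$ and $x,y\in\mathcal{C}^*$, $d_{1,\mathcal{C}}(x,y)=0$ if $\operatorname{Span}(x,y)\subset\mathcal{C}$, and $d_{1,\mathcal{C}}(x,y)=\delta_{\mathcal{C}\cap\operatorname{Span}(x,y)}(x,y)$ otherwise. For $p$-dimensional subspaces $V,W\subset\mathcal{C}$, $d_{\mathcal{C}}(V,W)=\sup\{d_{1,\mathcal{C}}(x,y): x\in V^*,y\in W^*\}$. For $\mathcal{C}'\subset\mathcal{C}$ a union of $p$-dimensional subspaces, $\operatorname{diam}_{\mathcal{C}}(\mathcal{C}')=\sup\{d_{\mathcal{C}}(V,W): V,W\subset\mathcal{C}'\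 p\text{-dimensional subspaces}\}$. **Contraction coefficient.** If $T\mathcal{C}^*\subset\mathcal{C}^*$ and $\operatorname{diam}_{\mathcal{C}}(T\mathcal{C})=\Delta<\infty$, there is $\eta\in[0,1)$, depending only on $\Delta$, such that $d_{\mathcal{C}}(TV,TW)\le\eta\,d_{\mathcal{C}}(V,W)$ for all $p$-dimensional subspaces $V,W\subset\mathcal{C}$ (convention $\eta\cdot\infty=\infty$); such an $\eta$ is fixed and called the contraction coefficient. **Aperture.** $\mathcal{C}$ is of aperture bounded by $K>0$ if there is a nonzero continuous linear map $m:E\to\mathbb{C}^p$ with $\|m\|\,\|u\|\le K|m(u)|$ for all $u\in\mathcal{C}$. **Norm on $\bigwedge^pE$.** $\|\cdot\|$ on $\bigwedge^pE$ denotes either of the norms $\|x\|_{\wedge1,p}=\sup\{|\langle l_1\wedge\dots\wedge l_p,x\rangle|: l_i\in E',\|l_i\|=1\}$, where $\langle l_1\wedge\dots\wedge l_p,x_1\wedge\dots\wedge x_p\rangle=\det(\langle l_i,x_j\rangle)_{i,j}$, or $\|x\|_{\wedge2,p}=\inf\sum_i\|x^i_1\|\cdots\|x^i_p\|$ over all finite decompositions $x=\sum_ix_1^i\wedge\dots\wedge x_p^i$. **$p$-reproducing.** $\mathcal{C}$ is $p$-reproducing if there exist $k\in\mathbb{N}^*$ and $A>0$ such that for all $(x_1,\dots,x_p)\in E^p$ there are $(x_1^i,\dots,x_p^i)\in E^p$, $1\le i\le k$, with $\operatorname{Span}(x_1^i,\dots,x_p^i)\subset\mathcal{C}$ for every $i$,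 $x_1\wedge\dots\wedge x_p=\sum_{i=1}^kx_1^i\wedge\dots\wedge x_p^i$, and $\sum_{i=1}^k\|x_1^i\wedge\dots\wedge x_p^i\|\le A\|x_1\wedge\dots\wedge x_p\|$. *)

theory Defs
  imports "HOL-Analysis.Analysis" "HOL-Library.Poly_Mapping"
begin

section \<open>Complex Banach spaces\<close>

class complex_banach = banach +
  fixes scaleC :: "complex \<Rightarrow> 'a \<Rightarrow> 'a"  (infixr \<open>*\<^sub>C\<close> 75)
  assumes scaleC_add_right: "c *\<^sub>C (x + y) = c *\<^sub>C x + c *\<^sub>C y"
    and scaleC_add_left: "(c + d) *\<^sub>C x = c *\<^sub>C x + d *\<^sub>C x"
    and scaleC_scaleC: "c *\<^sub>C d *\<^sub>C x = (c * d) *\<^sub>C x"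
    and scaleC_of_real: "complex_of_real r *\<^sub>C x = r *\<^sub>R x"
    and norm_scaleC: "norm (c *\<^sub>C x) = cmod c * norm x"

instantiation complex :: complex_banach
begin

definition scaleC_complex :: "complex \<Rightarrow> complex \<Rightarrow> complex"
  where "scaleC_complex = (*)"

instance
  by standard (auto simp: scaleC_complex_def algebra_simps norm_mult scaleR_conv_of_real)

end

global_interpretation complex_vector: vector_space "scaleC :: complex \<Rightarrow> 'a \<Rightarrow> 'a :: complex_banach"
  defines cdependent = complex_vector.dependent
    and csubspace = complex_vector.subspace
    and cspan = complex_vector.span
proof
  fix x :: 'a
  show "1 *\<^sub>C x = x" using scaleC_of_real[of 1 x] by simp
qed (rule scaleC_add_right scaleC_add_left scaleC_scaleC)+

text \<open>The argument \<open>s\<close> is the complex scalar multiplication of the codomain: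
  \<open>scaleC\<close> for operators on \<open>E\<close>, \<open>(*)\<close> for functionals, \<open>(*s)\<close> for maps into \<open>complex ^ 'p\<close>.\<close>
definition bounded_clinear ::
    "(complex \<Rightarrow> 'b \<Rightarrow> 'b) \<Rightarrow> ('a::complex_banach \<Rightarrow> 'b::real_normed_vector) \<Rightarrow> bool"
  where "bounded_clinear s f \<longleftrightarrow> bounded_linear f \<and> Vector_Spaces.linear scaleC s f"

definition subspace_of_dim :: "nat \<Rightarrow> 'a::complex_banach set \<Rightarrow> bool"
  where "subspace_of_dim n V \<longleftrightarrow>
    (\<exists>B. finite B \<and> card B = n \<and> \<not> cdependent B \<and> cspan B = V)"

definition ccolinear :: "'a::complex_banach \<Rightarrow> 'a \<Rightarrow> bool"
  where "ccolinear x y \<longleftrightarrow> (\<exists>c. x = c *\<^sub>C y) \<or> (\<exists>c. y = c *\<^sub>C x)"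


section \<open>Spectrum of the restriction of an operator to an invariant subspace\<close>

definition bounded_operator_on :: "'a::complex_banach set \<Rightarrow> ('a \<Rightarrow> 'a) \<Rightarrow> bool"
  where "bounded_operator_on W S \<longleftrightarrow>
    (\<forall>x\<in>W. S x \<in> W) \<and>
    (\<forall>x\<in>W. \<forall>y\<in>W. S (x + y) = S x + S y) \<and>
    (\<forall>c. \<forall>x\<in>W. S (c *\<^sub>C x) = c *\<^sub>C S x) \<and>
    (\<exists>B. \<forall>x\<in>W. norm (S x) \<le> B * norm x)"

definition spectrum_on :: "'a::complex_banach set \<Rightarrow> ('a \<Rightarrow> 'a) \<Rightarrow> complex set"
  where "spectrum_on W T =
    {\<mu>. \<not> (\<exists>S. bounded_operator_on W S \<and>
          (\<forall>x\<in>W. S (T x - \<mu> *\<^sub>C x) = x \<and> T (S x) - \<mu> *\<^sub>C S x = x))}"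


section \<open>The Riemann sphere and the hyperbolic distance\<close>

datatype riemann_sphere = Finite complex | Infinity

text \<open>Topology of the one-point compactification of the plane.\<close>
instantiation riemann_sphere :: topological_space
begin

definition open_riemann_sphere :: "riemann_sphere set \<Rightarrow> bool"
  where "open_riemann_sphere U \<longleftrightarrow>
    open (Finite -` U) \<and> (Infinity \<in> U \<longrightarrow> compact (- (Finite -` U)))"

instance
proof
  show "open (UNIV :: riemann_sphere set)"
    by (simp add: open_riemann_sphere_def)
next
  fix S T :: "riemann_sphere set"
  assume "open S" "open T"
  then show "open (S \<inter> T)"
    by (auto simp: open_riemann_sphere_def compact_Un vimage_Int Compl_Int)
next
  fix K :: "riemann_sphere set set"
  assume K: "\<forall>S\<in>K. open S"
  have 1: "open (Finite -` \<Union>K)"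
    using K by (auto simp: open_riemann_sphere_def vimage_Union)
  moreover have "compact (- (Finite -` \<Union>K))" if "Infinity \<in> \<Union>K"
  proof -
    from that obtain S where S: "S \<in> K" "Infinity \<in> S" by blast
    then have "compact (- (Finite -` S))"
      using K by (auto simp: open_riemann_sphere_def)
    moreover have "- (Finite -` \<Union>K) = - (Finite -` S) \<inter> - (Finite -` \<Union>K)"
      using S by auto
    moreover have "closed (- (Finite -` \<Union>K))"
      using 1 by (simp add: closed_Compl)
    ultimately show ?thesis
      by (metis compact_Int_closed)
  qed
  ultimately show "open (\<Union>K)"
    by (simp add: open_riemann_sphere_def)
qed

end

text \<open>The two standard charts, defined away from \<open>Infinity\<close> and away from \<open>Finite 0\<close> respectively.\<close>
fun chart_zero :: "riemann_sphere \<Rightarrow> complex"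
  where "chart_zero (Finite z) = z" | "chart_zero Infinity = 0"

fun chart_infinity :: "riemann_sphere \<Rightarrow> complex"
  where "chart_infinity (Finite z) = inverse z" | "chart_infinity Infinity = 0"

definition holomorphic_to_sphere :: "(complex \<Rightarrow> riemann_sphere) \<Rightarrow> complex set \<Rightarrow> bool"
  where "holomorphic_to_sphere f S \<longleftrightarrow>
    (\<forall>z\<in>S. \<exists>N. open N \<and> z \<in> N \<and>
      (Infinity \<notin> f ` N \<and> (chart_zero \<circ> f) holomorphic_on N \<or>
       Finite 0 \<notin> f ` N \<and> (chart_infinity \<circ> f) holomorphic_on N))"

text \<open>Poincare distance of the unit disc, from the metric \<open>2 |dz| / (1 - |z|^2)\<close> of curvature \<open>-1\<close>.\<close>
definition disc_dist :: "complex \<Rightarrow> complex \<Rightarrow> real"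
  where "disc_dist z w = 2 * artanh (cmod (z - w) / cmod (1 - cnj z * w))"

text \<open>The hyperbolic metric of a domain of the sphere is the one for which a holomorphic universal
  covering by the disc is a local isometry, so its distance is the least distance between
  preimages. Two such coverings differ by an isometry of the disc.\<close>
definition hyperbolic_dist :: "riemann_sphere set \<Rightarrow> riemann_sphere \<Rightarrow> riemann_sphere \<Rightarrow> ennreal"
  where "hyperbolic_dist U a b =
    Inf {ennreal (disc_dist z w) | z w \<pi>.
      holomorphic_to_sphere \<pi> (ball 0 1) \<and> covering_space (ball 0 1) \<pi> U \<and>
      z \<in> ball 0 1 \<and> w \<in> ball 0 1 \<and> \<pi> z = a \<and> \<pi> w = b}"


section \<open>The two gauges\<close>

definition gauge_domain :: "'a::complex_banach set \<Rightarrow> 'a \<Rightarrow> 'a \<Rightarrow> riemann_sphere set"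
  where "gauge_domain D x y =
    {Finite z | z. (1 + z) *\<^sub>C x + (1 - z) *\<^sub>C y \<in> D} \<union> {p. p = Infinity \<and> x - y \<in> D}"

definition hyperbolic_gauge :: "'a::complex_banach set \<Rightarrow> 'a \<Rightarrow> 'a \<Rightarrow> ennreal"
  where "hyperbolic_gauge D x y =
    (let I = interior (gauge_domain D x y) in
     if ccolinear x y then 0
     else if connected_component I (Finite (-1)) (Finite 1)
     then hyperbolic_dist (connected_component_set I (Finite (-1))) (Finite (-1)) (Finite 1)
     else \<infinity>)"

definition log_gauge :: "'a::complex_banach set \<Rightarrow> 'a \<Rightarrow> 'a \<Rightarrow> ennreal"
  where "log_gauge D x y =
    (let E = {z. z *\<^sub>C x - y \<notin> D};
         b = (SUP z\<in>E. ennreal (cmod z));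
         a = (INF z\<in>E. ennreal (cmod z))
     in if ccolinear x y then 0
        else if a = 0 \<or> b = \<infinity> then \<infinity>
        else ennreal (ln (enn2real b / enn2real a)))"


section \<open>Cones\<close>

definition p_cone :: "nat \<Rightarrow> 'a::complex_banach set \<Rightarrow> bool"
  where "p_cone p C \<longleftrightarrow>
    closed C \<and> C \<noteq> {} \<and>
    (\<exists>\<V>. (\<forall>V\<in>\<V>. subspace_of_dim p V) \<and> C = \<Union>\<V>) \<and>
    \<not> (\<exists>V. subspace_of_dim (p + 1) V \<and> V \<subseteq> C)"

definition vec_dist ::
    "('a set \<Rightarrow> 'a \<Rightarrow> 'a \<Rightarrow> ennreal) \<Rightarrow> 'a::complex_banach set \<Rightarrow> 'a \<Rightarrow> 'a \<Rightarrow> ennreal"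
  where "vec_dist \<delta> C x y =
    (if cspan {x, y} \<subseteq> C then 0 else \<delta> (C \<inter> cspan {x, y}) x y)"

definition cone_dist ::
    "('a set \<Rightarrow> 'a \<Rightarrow> 'a \<Rightarrow> ennreal) \<Rightarrow> 'a::complex_banach set \<Rightarrow> 'a set \<Rightarrow> 'a set \<Rightarrow> ennreal"
  where "cone_dist \<delta> C V W = Sup {vec_dist \<delta> C x y | x y. x \<in> V - {0} \<and> y \<in> W - {0}}"

definition cone_diam ::
    "('a set \<Rightarrow> 'a \<Rightarrow> 'a \<Rightarrow> ennreal) \<Rightarrow> nat \<Rightarrow> 'a::complex_banach set \<Rightarrow> 'a set \<Rightarrow> ennreal"
  where "cone_diam \<delta> p C C' =
    Sup {cone_dist \<delta> C V W | V W.
      subspace_of_dim p V \<and> V \<subseteq> C' \<and> subspace_of_dim p W \<and> W \<subseteq> C'}"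

text \<open>The guard implements the convention \<open>\<eta> \<cdot> \<infinity> = \<infinity>\<close>; in \<^typ>\<open>ennreal\<close>, \<open>0 * \<infinity> = 0\<close>.\<close>
definition contraction_coefficient ::
    "('a set \<Rightarrow> 'a \<Rightarrow> 'a \<Rightarrow> ennreal) \<Rightarrow> nat \<Rightarrow> 'a::complex_banach set \<Rightarrow> ('a \<Rightarrow> 'a) \<Rightarrow> real \<Rightarrow> bool"
  where "contraction_coefficient \<delta> p C T \<eta> \<longleftrightarrow>
    0 \<le> \<eta> \<and> \<eta> < 1 \<and>
    (\<forall>V W. subspace_of_dim p V \<and> V \<subseteq> C \<and> subspace_of_dim p W \<and> W \<subseteq> C \<and>
       cone_dist \<delta> C V W \<noteq> \<infinity> \<longrightarrow>
       cone_dist \<delta> C (T ` V) (T ` W) \<le> ennreal \<eta> * cone_dist \<delta> C V W)"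

definition aperture_bounded :: "'p::finite itself \<Rightarrow> 'a::complex_banach set \<Rightarrow> real \<Rightarrow> bool"
  where "aperture_bounded _ C K \<longleftrightarrow>
    (\<exists>m :: 'a \<Rightarrow> complex ^ 'p. bounded_clinear (*s) m \<and> m \<noteq> (\<lambda>u. 0) \<and>
      (\<forall>u\<in>C. onorm m * norm u \<le> K * norm (m u)))"


section \<open>Exterior power\<close>

text \<open>The exterior power of order \<open>p = CARD('p)\<close> is the space of formal complex combinations of
  families \<open>x :: 'p \<Rightarrow> 'a\<close>, modulo the relations making \<open>x \<mapsto> x\<^sub>1 \<and> \<dots> \<and> x\<^sub>p\<close> multilinear and
  alternating. Families need no ordering of the index type. The generators below carry an arbitrary
  coefficient \<open>c\<close>, so that the generated subgroup is a complex subspace.\<close>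
inductive_set ext_relations :: "(('p::finite \<Rightarrow> 'a::complex_banach) \<Rightarrow>\<^sub>0 complex) set"
  where
    zero: "0 \<in> ext_relations"
  | diff: "f \<in> ext_relations \<Longrightarrow> g \<in> ext_relations \<Longrightarrow> f - g \<in> ext_relations"
  | additive: "Poly_Mapping.single (x(i := u + v)) c
      - Poly_Mapping.single (x(i := u)) c - Poly_Mapping.single (x(i := v)) c \<in> ext_relations"
  | homogeneous: "Poly_Mapping.single (x(i := k *\<^sub>C u)) c
      - Poly_Mapping.single (x(i := u)) (c * k) \<in> ext_relations"
  | alternating: "i \<noteq> j \<Longrightarrow> x i = x j \<Longrightarrow> Poly_Mapping.single x c \<in> ext_relations"

lemma ext_relations_uminus: "f \<in> ext_relations \<Longrightarrow> - f \<in> ext_relations"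
  using ext_relations.diff[OF ext_relations.zero] by fastforce

lemma ext_relations_add: "f \<in> ext_relations \<Longrightarrow> g \<in> ext_relations \<Longrightarrow> f + g \<in> ext_relations"
  using ext_relations.diff[of f "- g"] ext_relations_uminus[of g] by simp

quotient_type (overloaded) ('a, 'p) ext_power =
    "('p::finite \<Rightarrow> 'a::complex_banach) \<Rightarrow>\<^sub>0 complex" / "\<lambda>f g. f - g \<in> ext_relations"
proof (rule equivpI)
  show "reflp (\<lambda>f g :: ('p \<Rightarrow> 'a) \<Rightarrow>\<^sub>0 complex. f - g \<in> ext_relations)"
    by (simp add: reflp_def ext_relations.zero)
  show "symp (\<lambda>f g :: ('p \<Rightarrow> 'a) \<Rightarrow>\<^sub>0 complex. f - g \<in> ext_relations)"
    by (rule sympI, drule ext_relations_uminus) simp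
  show "transp (\<lambda>f g :: ('p \<Rightarrow> 'a) \<Rightarrow>\<^sub>0 complex. f - g \<in> ext_relations)"
  proof (rule transpI)
    fix f g h :: "('p \<Rightarrow> 'a) \<Rightarrow>\<^sub>0 complex"
    assume "f - g \<in> ext_relations" "g - h \<in> ext_relations"
    then have "(f - g) + (g - h) \<in> ext_relations" by (rule ext_relations_add)
    then show "f - h \<in> ext_relations" by simp
  qed
qed

instantiation ext_power :: (complex_banach, finite) ab_group_add
begin

lift_definition zero_ext_power :: "('a, 'b) ext_power" is 0 .

lift_definition plus_ext_power :: "('a, 'b) ext_power \<Rightarrow> ('a, 'b) ext_power \<Rightarrow> ('a, 'b) ext_power"
  is "(+)"
  by (subst add_diff_add) (rule ext_relations_add)

lift_definition uminus_ext_power :: "('a, 'b) ext_power \<Rightarrow> ('a, 'b) ext_power"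
  is uminus
  by (drule ext_relations_uminus) simp

lift_definition minus_ext_power :: "('a, 'b) ext_power \<Rightarrow> ('a, 'b) ext_power \<Rightarrow> ('a, 'b) ext_power"
  is "(-)"
  by (drule (1) ext_relations.diff) (simp add: algebra_simps)

instance
  by standard (transfer; simp add: algebra_simps ext_relations.zero)+

end

lift_definition wedge :: "('p::finite \<Rightarrow> 'a::complex_banach) \<Rightarrow> ('a, 'p) ext_power"
  is "\<lambda>x. Poly_Mapping.single x 1" .

definition formal_pairing ::
    "('p::finite \<Rightarrow> 'a::complex_banach \<Rightarrow> complex) \<Rightarrow> (('p \<Rightarrow> 'a) \<Rightarrow>\<^sub>0 complex) \<Rightarrow> complex"
  where "formal_pairing l f =
    (\<Sum>x\<in>Poly_Mapping.keys f. Poly_Mapping.lookup f x * det (\<chi> i j. l i (x j)))"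

text \<open>The value \<open>\<langle>l\<^sub>1 \<and> \<dots> \<and> l\<^sub>p, X\<rangle>\<close>; for linear \<open>l i\<close> it does not depend on the representative
  of \<open>X\<close> (lemma \<open>ext_pairing_abs\<close> below).\<close>
definition ext_pairing ::
    "('p::finite \<Rightarrow> 'a::complex_banach \<Rightarrow> complex) \<Rightarrow> ('a, 'p) ext_power \<Rightarrow> complex"
  where "ext_pairing l X = formal_pairing l (rep_ext_power X)"

lemma formal_pairing_superset:
  assumes "finite S" "Poly_Mapping.keys f \<subseteq> S"
  shows "formal_pairing l f = (\<Sum>x\<in>S. Poly_Mapping.lookup f x * det (\<chi> i j. l i (x j)))"
  unfolding formal_pairing_def
  by (rule sum.mono_neutral_left) (use assms in \<open>auto simp: in_keys_iff\<close>)

lemma formal_pairing_diff: "formal_pairing l (f - g) = formal_pairing l f - formal_pairing l g"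
proof -
  let ?S = "Poly_Mapping.keys f \<union> Poly_Mapping.keys g"
  have "Poly_Mapping.keys (f - g) \<subseteq> ?S"
    by (auto simp: in_keys_iff lookup_minus)
  then show ?thesis
    by (simp add: formal_pairing_superset[of ?S] lookup_minus left_diff_distrib sum_subtractf)
qed

lemma formal_pairing_single:
  "formal_pairing l (Poly_Mapping.single x c) = c * det (\<chi> i j. l i (x j))"
  by (cases "c = 0") (auto simp: formal_pairing_def)

lemma det_pairing_transpose:
  fixes l :: "'p::finite \<Rightarrow> 'a \<Rightarrow> complex"
  shows "det (\<chi> i j. l i (x j)) = det (\<chi> j i. l i (x j))"
  by (subst det_transpose[symmetric]) (simp add: transpose_def)

lemma formal_pairing_relations:
  fixes l :: "'p::finite \<Rightarrow> 'a::complex_banach \<Rightarrow> complex"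
  assumes l: "\<And>i. Vector_Spaces.linear scaleC (*) (l i)"
    and f: "f \<in> ext_relations"
  shows "formal_pairing l f = 0"
  using f
proof induction
  case zero
  then show ?case by (simp add: formal_pairing_def)
next
  case (diff f g)
  then show ?case by (simp add: formal_pairing_diff)
next
  case (additive x i u v c)
  have row: "(\<chi> j k. l k ((x(i := w)) j)) = (\<chi> j. if j = i then (\<chi> k. l k w) else (\<chi> k. l k (x j)))" for w
    by (simp add: vec_eq_iff)
  have sum: "(\<chi> k. l k (u + v)) = (\<chi> k. l k u) + (\<chi> k. l k v)"
    by (simp add: vec_eq_iff module_hom.add[OF Vector_Spaces.linear.axioms(3)[OF l]])
  have "det (\<chi> j k. l k ((x(i := u + v)) j))
      = det (\<chi> j k. l k ((x(i := u)) j)) + det (\<chi> j k. l k ((x(i := v)) j))"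
    unfolding row sum by (rule det_row_add)
  then show ?case
    by (simp only: formal_pairing_diff formal_pairing_single det_pairing_transpose) (simp add: algebra_simps)
next
  case (homogeneous x i k u c)
  have row: "(\<chi> j k. l k ((x(i := w)) j)) = (\<chi> j. if j = i then (\<chi> k. l k w) else (\<chi> k. l k (x j)))" for w
    by (simp add: vec_eq_iff)
  have scale: "(\<chi> j. l j (k *\<^sub>C u)) = k *s (\<chi> j. l j u)"
    by (simp add: vec_eq_iff module_hom.scale[OF Vector_Spaces.linear.axioms(3)[OF l]])
  have "det (\<chi> j m. l m ((x(i := k *\<^sub>C u)) j)) = k * det (\<chi> j m. l m ((x(i := u)) j))"
    unfolding row scale by (rule det_row_mul)
  then show ?case
    by (simp only: formal_pairing_diff formal_pairing_single det_pairing_transpose) simp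
next
  case (alternating i j x c)
  then have "det (\<chi> j k. l k (x j)) = 0"
    by (intro det_identical_rows[of i j]) (auto simp: row_def vec_eq_iff)
  then show ?case
    by (simp only: formal_pairing_single det_pairing_transpose) simp
qed

lemma ext_pairing_abs:
  fixes l :: "'p::finite \<Rightarrow> 'a::complex_banach \<Rightarrow> complex"
  assumes "\<And>i. Vector_Spaces.linear scaleC (*) (l i)"
  shows "ext_pairing l (abs_ext_power f) = formal_pairing l f"
proof -
  have "rep_ext_power (abs_ext_power f) - f \<in> ext_relations"
    by (rule Quotient3_rep_abs[OF Quotient3_ext_power]) (simp add: ext_relations.zero)
  from formal_pairing_relations[of l, OF assms this] show ?thesis
    by (simp add: ext_pairing_def formal_pairing_diff)
qed

lemma ext_pairing_wedge:
  fixes l :: "'p::finite \<Rightarrow> 'a::complex_banach \<Rightarrow> complex"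
  assumes "\<And>i. Vector_Spaces.linear scaleC (*) (l i)"
  shows "ext_pairing l (wedge x) = det (\<chi> i j. l i (x j))"
  unfolding wedge.abs_eq by (simp add: ext_pairing_abs[of l, OF assms] formal_pairing_single)

definition ext_norm1 :: "('a::complex_banach, 'p::finite) ext_power \<Rightarrow> real"
  where "ext_norm1 X =
    Sup {cmod (ext_pairing l X) | l. \<forall>i. bounded_clinear (*) (l i) \<and> onorm (l i) = 1}"

definition ext_norm2 :: "('a::complex_banach, 'p::finite) ext_power \<Rightarrow> real"
  where "ext_norm2 X =
    Inf {(\<Sum>x\<leftarrow>xs. \<Prod>i\<in>UNIV. norm (x i)) | xs. X = (\<Sum>x\<leftarrow>xs. wedge x)}"

definition p_reproducing ::
    "(('a, 'p::finite) ext_power \<Rightarrow> real) \<Rightarrow> 'a::complex_banach set \<Rightarrow> bool"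
  where "p_reproducing nrm C \<longleftrightarrow>
    (\<exists>k\<ge>1. \<exists>A>0. \<forall>x :: 'p \<Rightarrow> 'a. \<exists>y :: nat \<Rightarrow> 'p \<Rightarrow> 'a.
      (\<forall>i<k. cspan (range (y i)) \<subseteq> C) \<and>
      wedge x = (\<Sum>i<k. wedge (y i)) \<and>
      (\<Sum>i<k. nrm (wedge (y i))) \<le> A * nrm (wedge x))"

end

(*
  The aperture map m : E -> C^p sends every p-dimensional subspace of C isomorphically onto C^p, so
  these subspaces are the ranges of the linear sections s of m with values in C, and T acts on
  sections. Two points of C with the same image under m are at distance at most a constant times
  their gauge. The contraction hypothesis therefore makes two orbits of sections approach each other
  at the rate q^n for every q > eta, and there is a section sigma with T-invariant range; let M be
  the matrix of T on V = range sigma.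

  For p-tuples x spanning a subspace of C, the normalised determinant det (m T^n x_j) / (det M)^n
  is bounded and converges at the rate q^n. Since C is p-reproducing, the rate carries over to all
  tuples. For the tuple (sigma e_1, .., x, .., sigma e_p) this determinant is a coordinate of
  M^-n m T^n x, whose limit omega x satisfies omega T = M omega and omega sigma = id; put
  W = ker omega. The same argument applied to the alternating E-valued map given by Cramer's rule for
  the solution of m u = b, with b an eigenvector of M for the eigenvalue mu, shows that T^n decays
  on W like (q |mu|)^n. Hence |nu| <= q |mu| for all nu in the spectrum of T on W and all such mu;
  finally let q tend to eta.
*)
theory Submission
  imports Defs "HOL-Complex_Analysis.Complex_Analysis"
begin

section \<open>The gauges dominate the distance between points with the same projection\<close>

text \<open>The reproducing hypothesis concerns decomposable p-vectors, not vectors: the entries of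
  the pieces are not controlled one by one, only their wedge. So estimates leave the cone only for
  quantities that are alternating in a p-tuple and that, on tuples spanning a subspace of C, are
  bounded by a multiple of the determinant of the images under m. On the range of a section both
  quantities used are this determinant times a factor depending on the section alone. Cramer's rule
  is applied without its division, which keeps it multilinear.

  Why b is an eigenvector: with x in slot i, the vector T^n x - sigma m T^n x is multiplied by det
  M^n times the i-th coordinate of M^-n b. If M b = mu b, this is (det M)^n b_i / mu^n, so a bound
  of order |det M|^n q^n becomes one of order (q |mu|)^n. Since mu is arbitrary, the smallest
  eigenvalue is covered.

  The rate q exceeds eta because eta may be 0 and the estimates divide by the rate. V and W are
  defined without reference to q, so they stay the same as q tends to eta.\<close>

lemma Schwarz_Pick:
  assumes f: "f holomorphic_on ball 0 1" and no: "\<And>z. cmod z < 1 \<Longrightarrow> cmod (f z) < 1"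
    and z: "cmod z < 1" and w: "cmod w < 1"
  shows "cmod (f z - f w) / cmod (1 - cnj (f z) * f w) \<le> cmod (z - w) / cmod (1 - cnj z * w)"
proof -
  \<comment> \<open>Conjugation by Moebius maps moves \<open>z\<close> and \<open>f z\<close> to 0,
    which reduces the claim to Schwarz's lemma for \<open>g\<close>.\<close>
  define g where "g = Moebius_function 0 (f z) \<circ> (f \<circ> Moebius_function 0 (- z))"
  have fz: "cmod (f z) < 1" using no z by blast
  have sub: "Moebius_function 0 (- z) ` ball 0 1 \<subseteq> ball 0 1" "f ` ball 0 1 \<subseteq> ball 0 1"
    using Moebius_function_norm_lt_1[of "- z"] z no by (auto simp: dist_norm)
  have "(f \<circ> Moebius_function 0 (- z)) holomorphic_on ball 0 1"
    by (rule holomorphic_on_compose_gen[OF Moebius_function_holomorphic f]) (use z sub in auto)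
  then have "g holomorphic_on ball 0 1" unfolding g_def
    by (rule holomorphic_on_compose_gen[OF _ Moebius_function_holomorphic[OF fz]]) (use sub in \<open>auto simp: image_subset_iff\<close>)
  moreover have "g 0 = 0"
    by (simp add: g_def Moebius_function_of_zero Moebius_function_eq_zero)
  moreover have "cmod (g x) < 1" if "cmod x < 1" for x
    using that z fz by (auto simp: g_def intro!: Moebius_function_norm_lt_1 no)
  moreover have "cmod (Moebius_function 0 z w) < 1"
    using z w by (rule Moebius_function_norm_lt_1)
  ultimately have "cmod (g (Moebius_function 0 z w)) \<le> cmod (Moebius_function 0 z w)"
    by (rule Schwarz_Lemma(1))
  moreover have "g (Moebius_function 0 z w) = Moebius_function 0 (f z) (f w)"
    using Moebius_function_compose[of "- z" z w] z w by (simp add: g_def)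
  ultimately show ?thesis
    by (simp add: Moebius_function_simple norm_divide norm_minus_commute[of w z] norm_minus_commute[of "f w" "f z"])
qed

text \<open>The chart at infinity is used only where \<open>f\<close> misses
  \<open>Finite 0\<close>; on \<open>S\<close> it misses \<open>Infinity\<close> too, so inverting
  that chart returns to the plane chart. The neighbourhood \<open>N\<close> may leave
  \<open>S\<close>, hence the intersection.\<close>

lemma chart_zero_holomorphic:
  assumes h: "holomorphic_to_sphere f S" and S: "open S" and fin: "\<And>z. z \<in> S \<Longrightarrow> f z \<noteq> Infinity"
  shows "(chart_zero \<circ> f) holomorphic_on S"
proof (rule analytic_imp_holomorphic)
  show "(chart_zero \<circ> f) analytic_on S"
    unfolding analytic_on_def
  proof
    fix z assume z: "z \<in> S"
    obtain N where N: "open N" "z \<in> N"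
        and d: "Infinity \<notin> f ` N \<and> (chart_zero \<circ> f) holomorphic_on N \<or>
           Finite 0 \<notin> f ` N \<and> (chart_infinity \<circ> f) holomorphic_on N"
      using h z unfolding holomorphic_to_sphere_def by blast
    have "(chart_zero \<circ> f) holomorphic_on N \<inter> S"
      using d
    proof
      assume "Finite 0 \<notin> f ` N \<and> (chart_infinity \<circ> f) holomorphic_on N"
      then have n: "Finite 0 \<notin> f ` N" and hol: "(chart_infinity \<circ> f) holomorphic_on N \<inter> S"
        using holomorphic_on_subset[of "chart_infinity \<circ> f" N "N \<inter> S"] by blast+
      have e: "(chart_zero \<circ> f) x = inverse ((chart_infinity \<circ> f) x) \<and> (chart_infinity \<circ> f) x \<noteq> 0"
        if "x \<in> N \<inter> S" for x
      proof -
        have "f x \<noteq> Finite 0" "f x \<noteq> Infinity" using that n fin by (metis IntE image_eqI)+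
        then show ?thesis by (cases "f x") auto
      qed
      have "(\<lambda>x. inverse ((chart_infinity \<circ> f) x)) holomorphic_on N \<inter> S"
        by (rule holomorphic_on_inverse[OF hol]) (use e in blast)
      then show ?thesis
        by (rule holomorphic_transform) (use e in auto)
    qed (meson Int_lower1 holomorphic_on_subset)
    moreover obtain e where "e > 0" "ball z e \<subseteq> N \<inter> S"
      using N S z by (meson IntI open_Int open_contains_ball)
    ultimately show "\<exists>e>0. (chart_zero \<circ> f) holomorphic_on ball z e"
      by (meson holomorphic_on_subset)
  qed
qed

text \<open>A covering of \<open>U\<close> by the disc, divided by \<open>R\<close>, is a self-map
  of the disc. Schwarz-Pick then bounds the pseudo-hyperbolic distance of preimages of
  \<open>a\<close> and \<open>b\<close> from below by that of \<open>a / R\<close> and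
  \<open>b / R\<close>, which is at least \<open>cmod (a - b) / (2 * R)\<close>. If there is no
  covering, the infimum is infinite and \<open>le\<close> fails.\<close>

lemma hyperbolic_dist_ge:
  assumes U: "\<And>u. u \<in> U \<Longrightarrow> \<exists>c. u = Finite c \<and> cmod c < R"
    and le: "hyperbolic_dist U (Finite a) (Finite b) \<le> ennreal d" and d: "d \<ge> 0"
  shows "cmod (a - b) \<le> 2 * d * R"
proof (rule field_le_epsilon)
  fix e :: real assume e: "e > 0"
  \<comment> \<open>The infimum need not be attained, hence the slack; the absolute value of
    \<open>R\<close> occurs because \<open>R > 0\<close> is known only once a point of
    \<open>U\<close> is at hand.\<close>
  define e' where "e' = e / (2 * (\<bar>R\<bar> + 1))"
  have "e' > 0" using e by (simp add: e'_def)
  then have "hyperbolic_dist U (Finite a) (Finite b) < ennreal (d + e')"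
    using d by (intro le_less_trans[OF le] ennreal_lessI) auto
  then obtain v where v: "v < ennreal (d + e')" "v \<in> {ennreal (disc_dist z w) | z w \<pi>.
      holomorphic_to_sphere \<pi> (ball 0 1) \<and> covering_space (ball 0 1) \<pi> U \<and>
      z \<in> ball 0 1 \<and> w \<in> ball 0 1 \<and> \<pi> z = Finite a \<and> \<pi> w = Finite b}"
    unfolding hyperbolic_dist_def Inf_less_iff by blast
  then obtain z w \<pi> where vzw: "v = ennreal (disc_dist z w)" and zw: "z \<in> ball 0 1" "w \<in> ball 0 1"
      and \<pi>: "holomorphic_to_sphere \<pi> (ball 0 1)" "covering_space (ball 0 1) \<pi> U"
      and ab: "\<pi> z = Finite a" "\<pi> w = Finite b"
    by blast
  have dist: "disc_dist z w < d + e'"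
  proof (rule ccontr)
    assume "\<not> disc_dist z w < d + e'"
    then have "ennreal (d + e') \<le> v" by (simp add: vzw ennreal_leI)
    with v(1) show False by simp
  qed
  have im: "\<pi> ` ball 0 1 = U" using \<pi>(2) by (simp add: covering_space_def)
  have "\<pi> z \<in> U" using im zw by blast
  then obtain c where "cmod c < R" using U by blast
  then have R: "R > 0" using norm_ge_zero[of c] by linarith
  have "(chart_zero \<circ> \<pi>) holomorphic_on ball 0 1"
  proof (rule chart_zero_holomorphic[OF \<pi>(1)])
    show "\<pi> x \<noteq> Infinity" if "x \<in> ball 0 1" for x
    proof -
      have "\<pi> x \<in> U" using im that by blast
      then show ?thesis using U by (metis riemann_sphere.distinct(1))
    qed
  qed simp
  then have hol: "(\<lambda>x. (chart_zero \<circ> \<pi>) x / of_real R) holomorphic_on ball 0 1"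
    using R by (intro holomorphic_on_divide holomorphic_on_const) (auto simp: comp_def)
  have lt: "cmod ((chart_zero \<circ> \<pi>) x / of_real R) < 1" if "cmod x < 1" for x
  proof -
    have "x \<in> ball 0 1" using that by simp
    then have "\<pi> x \<in> U" using im by blast
    then obtain c where "\<pi> x = Finite c" "cmod c < R" using U by blast
    then show ?thesis using R by (simp add: norm_divide)
  qed
  define t where "t = cmod (z - w) / cmod (1 - cnj z * w)"
  let ?a = "a / of_real R" and ?b = "b / of_real R"
  have cl: "cmod ?a < 1" "cmod ?b < 1" using lt[of z] lt[of w] zw ab by auto
  have sp: "cmod (?a - ?b) / cmod (1 - cnj ?a * ?b) \<le> t"
    using Schwarz_Pick[OF hol lt, of z w] zw ab by (simp add: t_def)
  have "cmod (Moebius_function 0 z w) < 1"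
    using zw by (intro Moebius_function_norm_lt_1) auto
  then have t: "0 \<le> t" "t < 1"
    by (auto simp: t_def Moebius_function_simple norm_divide norm_minus_commute[of w z])
  have "0 \<le> ln (1 + t)" "ln (1 - t) \<le> - t" using t ln_add_one_self_le_self2[of "- t"] by auto
  moreover have "2 * artanh t = ln (1 + t) - ln (1 - t)" using t by (simp add: artanh_def ln_div)
  ultimately have "t \<le> 2 * artanh t" by linarith
  moreover have "disc_dist z w = 2 * artanh t" by (simp only: disc_dist_def t_def)
  ultimately have t_le: "t \<le> d + e'" using dist by linarith
  have "cmod (1 - cnj ?a * ?b) \<le> 1 + cmod ?a * cmod ?b"
    using norm_triangle_ineq4[of 1 "cnj ?a * ?b"] by (simp only: norm_mult complex_mod_cnj norm_one)
  also have "\<dots> \<le> 2" using mult_le_one[of "cmod ?a" "cmod ?b"] cl by simp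
  finally have le2: "cmod (1 - cnj ?a * ?b) \<le> 2" .
  \<comment> \<open>A zero denominator would make the quotient in \<open>sp\<close> equal to 0 and
    the bound empty.\<close>
  have "cnj ?a * ?b \<noteq> 1"
  proof
    assume "cnj ?a * ?b = 1"
    then have "cmod ?a * cmod ?b = 1" by (metis complex_mod_cnj norm_mult norm_one)
    moreover have "cmod ?a * cmod ?b < 1 * 1" using cl by (intro mult_strict_mono') auto
    ultimately show False by linarith
  qed
  then have "cmod (?a - ?b) \<le> t * cmod (1 - cnj ?a * ?b)"
    using sp by (simp add: divide_le_eq)
  also have "\<dots> \<le> (d + e') * 2" using t_le t le2 by (intro mult_mono) auto
  finally have "cmod (a - b) / R \<le> (d + e') * 2" using R
    by (simp add: norm_divide flip: diff_divide_distrib)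
  then have "cmod (a - b) \<le> 2 * d * R + 2 * e' * R" using R by (simp add: field_simps)
  also have "2 * e' * R \<le> e" using R e by (simp add: e'_def field_simps)
  finally show "cmod (a - b) \<le> 2 * d * R + e" by simp
qed

lemma norm_vec_scale: "norm (c *s v :: complex ^ 'n::finite) = cmod c * norm v"
  by (simp add: norm_vec_def norm_mult L2_set_right_distrib)

text \<open>As \<open>m x = m y\<close>, every point
  \<open>(1 + c) *\<^sub>C x + (1 - c) *\<^sub>C y\<close> projects to \<open>2 *s m x\<close>; if
  it lies in \<open>C\<close>, the aperture bounds it and hence \<open>c\<close>. Infinity is
  excluded because \<open>x - y\<close> projects to 0. So the gauge domain lies in a disc whose
  radius is inversely proportional to \<open>norm (x - y)\<close>, and a small hyperbolic distance
  between -1 and 1 forces that radius to be large.\<close>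

lemma hyperbolic_gauge_separates:
  fixes m :: "'a::complex_banach \<Rightarrow> complex ^ 'p::finite"
  assumes m: "Vector_Spaces.linear scaleC (*s) m"
    and k: "\<And>u. u \<in> C \<Longrightarrow> norm u \<le> k * norm (m u)"
    and C: "x \<in> C" "y \<in> C" and mxy: "m x = m y" and ne: "x \<noteq> y"
    and le: "hyperbolic_gauge (C \<inter> cspan {x, y}) x y \<le> ennreal d" and d: "d \<ge> 0"
    and indep: "\<not> ccolinear x y"
  shows "norm (x - y) \<le> 4 * k * norm (m x) * d"
proof -
  interpret m: Vector_Spaces.linear scaleC "(*s)" m by (rule m)
  define G where "G = gauge_domain (C \<inter> cspan {x, y}) x y"
  define U where "U = connected_component_set (interior G) (Finite (- 1))"
  have conn: "connected_component (interior G) (Finite (- 1)) (Finite 1)"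
    and le': "hyperbolic_dist U (Finite (- 1)) (Finite 1) \<le> ennreal d"
    using le indep by (auto simp: hyperbolic_gauge_def G_def U_def Let_def top_unique split: if_splits)
  have UG: "U \<subseteq> G" unfolding U_def
    using connected_component_subset interior_subset by blast
  have kx: "norm x \<le> k * norm (m x)" "norm y \<le> k * norm (m x)" using k C mxy by metis+
  \<comment> \<open>The 4 adds \<open>2 * k * norm (m x)\<close> from the point of \<open>C\<close>
    and as much again from \<open>x + y\<close>.\<close>
  define r where "r = 4 * k * norm (m x) / norm (x - y)"
  have G: "\<exists>c. u = Finite c \<and> cmod c \<le> r" if "u \<in> G" for u
  proof (cases u)
    case Infinity
    then have "x - y \<in> C" using that by (auto simp: G_def gauge_domain_def)
    then have "norm (x - y) \<le> 0" using k[of "x - y"] by (simp add: m.diff mxy)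
    then show ?thesis using ne by simp
  next
    case (Finite c)
    let ?v = "(1 + c) *\<^sub>C x + (1 - c) *\<^sub>C y"
    have "?v \<in> C" using that Finite by (auto simp: G_def gauge_domain_def)
    moreover have "m ?v = (1 + c) *s m x + (1 - c) *s m x"
      by (simp only: m.add m.scale mxy)
    then have "m ?v = 2 *s m x" by (simp add: vec_eq_iff algebra_simps)
    ultimately have "norm ?v \<le> 2 * (k * norm (m x))"
      using k[of ?v] by (simp add: norm_vec_scale)
    moreover have "c *\<^sub>C (x - y) = ?v - (x + y)"
      by (simp add: scaleC_add_left complex_vector.scale_left_diff_distrib complex_vector.scale_right_diff_distrib)
    then have "cmod c * norm (x - y) \<le> norm ?v + norm (x + y)"
      by (metis norm_scaleC norm_triangle_ineq4)
    moreover have "norm (x + y) \<le> norm x + norm y" by (rule norm_triangle_ineq)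
    ultimately have "cmod c * norm (x - y) \<le> 4 * k * norm (m x)" using kx by linarith
    then show ?thesis using ne Finite by (simp add: r_def field_simps)
  qed
  have "2 \<le> 2 * d * r"
  proof (rule field_le_epsilon)
    fix e :: real assume e: "e > 0"
    \<comment> \<open>The disc has to contain the domain with a strict inequality; the excess of
      \<open>r'\<close> over \<open>r\<close> costs at most \<open>e\<close> after multiplication by
      \<open>2 * d\<close>.\<close>
    define r' where "r' = r + e / (2 * (d + 1))"
    have "cmod (- 1 - 1) \<le> 2 * d * r'"
    proof (rule hyperbolic_dist_ge[OF _ le' d])
      fix u assume "u \<in> U"
      then obtain c where "u = Finite c" "cmod c \<le> r" using UG G by blast
      moreover have "e / (2 * (d + 1)) > 0" using e d by simp
      ultimately show "\<exists>c. u = Finite c \<and> cmod c < r'"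
        by (intro exI[of _ c]) (simp add: r'_def)
    qed
    also have "\<dots> = 2 * d * r + e * (d / (d + 1))" using d by (simp add: r'_def field_simps)
    also have "e * (d / (d + 1)) \<le> e * 1" using d e by (intro mult_left_mono) auto
    finally show "2 \<le> 2 * d * r + e" by simp
  qed
  then have "norm (x - y) * 1 \<le> norm (x - y) * (d * r)" by (intro mult_left_mono) auto
  then show ?thesis using ne by (simp add: r_def field_simps)
qed

text \<open>If \<open>z *\<^sub>C x - y\<close> lies in \<open>C\<close>, its norm is controlled by
  its projection \<open>(z - 1) *s m x\<close>, which is small for \<open>z\<close> near 1, and then
  so is \<open>x - y\<close>. Hence \<open>E\<close> contains a disc around 1 of radius
  \<open>r\<close> proportional to \<open>norm (x - y)\<close>; the infimum is at most 1, the
  supremum at least \<open>1 + r\<close>, and the gauge at least \<open>ln (1 + r)\<close>.\<close>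

lemma log_gauge_separates:
  fixes m :: "'a::complex_banach \<Rightarrow> complex ^ 'p::finite"
  assumes m: "Vector_Spaces.linear scaleC (*s) m"
    and k: "\<And>u. u \<in> C \<Longrightarrow> norm u \<le> k * norm (m u)"
    and C: "x \<in> C" "y \<in> C" and mxy: "m x = m y" and ne: "x \<noteq> y" and x0: "x \<noteq> 0"
    and le: "log_gauge (C \<inter> cspan {x, y}) x y \<le> ennreal d" and d: "d \<ge> 0"
    and indep: "\<not> ccolinear x y"
  shows "norm (x - y) \<le> 2 * k * norm (m x) * (exp d - 1)"
proof -
  interpret m: Vector_Spaces.linear scaleC "(*s)" m by (rule m)
  define E where "E = {z. z *\<^sub>C x - y \<notin> C \<inter> cspan {x, y}}"
  define a where "a = (INF z\<in>E. ennreal (cmod z))"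
  define b where "b = (SUP z\<in>E. ennreal (cmod z))"
  have ab: "a \<noteq> 0" "b \<noteq> \<infinity>" and ln_le: "ennreal (ln (enn2real b / enn2real a)) \<le> ennreal d"
    using le indep by (auto simp: log_gauge_def E_def a_def b_def Let_def top_unique split: if_splits)
  have kx: "norm x \<le> k * norm (m x)" using k C by metis
  then have kmx: "k * norm (m x) > 0" using x0 by (metis norm_le_zero_iff not_le order_trans)
  have memE: "z \<in> E" if "2 * k * norm (m x) * cmod (z - 1) < norm (x - y)" for z
  proof (rule ccontr)
    assume "z \<notin> E"
    then have "z *\<^sub>C x - y \<in> C" by (simp add: E_def)
    moreover have "m (z *\<^sub>C x - y) = (z - 1) *s m x"
      by (simp add: m.diff m.scale mxy vec.scale_left_diff_distrib)
    ultimately have "norm (z *\<^sub>C x - y) \<le> k * norm (m x) * cmod (z - 1)"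
      using k by (metis mult.commute mult.left_commute norm_vec_scale)
    moreover have "x - y = (z *\<^sub>C x - y) - (z - 1) *\<^sub>C x"
      by (simp add: complex_vector.scale_left_diff_distrib)
    then have "norm (x - y) \<le> norm (z *\<^sub>C x - y) + cmod (z - 1) * norm x"
      by (metis norm_scaleC norm_triangle_ineq4)
    moreover have "cmod (z - 1) * norm x \<le> cmod (z - 1) * (k * norm (m x))"
      using kx by (intro mult_left_mono) auto
    ultimately show False using that by (simp add: algebra_simps)
  qed
  define r where "r = norm (x - y) / (2 * k * norm (m x))"
  have r: "r > 0" using ne kmx by (simp add: r_def)
  have "1 \<in> E" using memE[of 1] ne by simp
  then have "a \<le> ennreal (cmod 1)" unfolding a_def by (rule INF_lower)
  then have a1: "a \<le> 1" by simp
  then have "a < \<infinity>" by (rule le_less_trans) simp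
  then have a: "0 < enn2real a" "enn2real a \<le> 1"
    using ab(1) a1 by (auto simp: enn2real_positive_iff zero_less_iff_neq_zero intro: enn2real_leI)
  have "1 + r \<le> enn2real b"
  proof (rule field_le_epsilon)
    fix e :: real assume e: "e > 0"
    define t where "t = max 0 (r - e)"
    have "2 * k * norm (m x) * t < norm (x - y)"
      using r e kmx ne by (auto simp: t_def r_def max_def field_simps)
    then have "complex_of_real (1 + t) \<in> E"
      by (intro memE) (simp add: t_def)
    then have "ennreal (cmod (complex_of_real (1 + t))) \<le> b"
      unfolding b_def by (rule SUP_upper)
    moreover have "cmod (complex_of_real (1 + t)) = 1 + t"
      by (simp only: norm_of_real) (simp add: t_def)
    moreover have "b = ennreal (enn2real b)" using ab by (metis ennreal_enn2real_if infinity_ennreal_def)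
    ultimately have "ennreal (1 + t) \<le> ennreal (enn2real b)" by simp
    then have "1 + t \<le> enn2real b" by (subst (asm) ennreal_le_iff) auto
    then show "1 + r \<le> enn2real b + e" by (simp add: t_def)
  qed
  also have "\<dots> \<le> enn2real b / enn2real a"
    using a mult_left_mono[OF a(2), of "enn2real b"] by (simp add: pos_le_divide_eq)
  finally have ba: "1 + r \<le> enn2real b / enn2real a" .
  then have "ln (1 + r) \<le> ln (enn2real b / enn2real a)" using r by simp
  also have "\<dots> \<le> d" using ln_le d by (simp add: ennreal_le_iff)
  finally have "exp (ln (1 + r)) \<le> exp d" by (simp only: exp_le_cancel_iff)
  then have "r \<le> exp d - 1" using r by simp
  moreover have "norm (x - y) = 2 * k * norm (m x) * r" using kmx by (auto simp: r_def)
  ultimately show ?thesis using kmx by (simp add: mult_left_mono)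
qed

text \<open>The two conventions that set the distance to 0 do no harm: a span inside
  \<open>C\<close> would contain \<open>x - y\<close>, which the aperture forbids for
  \<open>x \<noteq> y\<close>, and colinear vectors with the same nonzero projection are equal. The
  factor \<open>d * exp d\<close> dominates both \<open>d\<close> and
  \<open>exp d - 1\<close>.\<close>

lemma vec_dist_separates:
  fixes m :: "'a::complex_banach \<Rightarrow> complex ^ 'p::finite"
  assumes \<delta>: "\<delta> = hyperbolic_gauge \<or> \<delta> = log_gauge"
    and m: "Vector_Spaces.linear scaleC (*s) m"
    and k: "\<And>u. u \<in> C \<Longrightarrow> norm u \<le> k * norm (m u)" "k \<ge> 0"
    and C: "x \<in> C" "y \<in> C" and mxy: "m x = m y" and mx: "m x \<noteq> 0"
    and le: "vec_dist \<delta> C x y \<le> ennreal d" and d: "d \<ge> 0"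
  shows "norm (x - y) \<le> 4 * k * d * exp d * norm (m x)"
proof (cases "x = y")
  case True
  then show ?thesis using k d by simp
next
  case ne: False
  interpret m: Vector_Spaces.linear scaleC "(*s)" m by (rule m)
  have nsub: "\<not> cspan {x, y} \<subseteq> C"
  proof
    assume "cspan {x, y} \<subseteq> C"
    moreover have "x - y \<in> cspan {x, y}"
      by (simp add: complex_vector.span_base complex_vector.span_diff)
    ultimately have "norm (x - y) \<le> k * norm (m (x - y))" using k by blast
    then show False using ne by (simp add: m.diff mxy)
  qed
  have indep: "\<not> ccolinear x y"
  proof
    assume "ccolinear x y"
    then obtain c where "x = c *\<^sub>C y \<or> y = c *\<^sub>C x" by (auto simp: ccolinear_def)
    moreover from this have "m x = c *s m x" using mxy by (metis m.scale)
    then have "c = 1" using mx by (metis vec.scale_cancel_right vec.scale_one)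
    ultimately show False using ne by simp
  qed
  have le': "\<delta> (C \<inter> cspan {x, y}) x y \<le> ennreal d"
    using le nsub by (simp add: vec_dist_def)
  have e: "exp d - 1 \<le> d * exp d"
    using exp_ge_add_one_self[of "- d"] by (simp add: exp_minus field_simps)
  from \<delta> show ?thesis
  proof
    assume "\<delta> = hyperbolic_gauge"
    then have "norm (x - y) \<le> 4 * k * norm (m x) * d"
      using hyperbolic_gauge_separates[OF m k(1) C mxy ne _ d indep] le' by blast
    also have "\<dots> \<le> 4 * k * norm (m x) * (d * exp d)"
      using k d by (intro mult_left_mono) (auto simp: mult_le_cancel_left1)
    finally show ?thesis by (simp add: mult_ac)
  next
    assume "\<delta> = log_gauge"
    moreover have "x \<noteq> 0" using mx by auto
    ultimately have "norm (x - y) \<le> 2 * k * norm (m x) * (exp d - 1)"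
      using log_gauge_separates[OF m k(1) C mxy ne _ _ d indep] le' by blast
    also have "\<dots> \<le> 4 * k * norm (m x) * (d * exp d)"
      using k e d by (intro mult_mono) auto
    finally show ?thesis by (simp add: mult_ac)
  qed
qed

section \<open>Alternating multilinear maps and the exterior power\<close>

text \<open>Values in an arbitrary \<open>complex_banach\<close> cover determinants and the E-valued
  maps given by Cramer's rule alike.\<close>

definition alternating_multilinear :: "(('p::finite \<Rightarrow> 'a::complex_banach) \<Rightarrow> 'b::complex_banach) \<Rightarrow> bool"
  where "alternating_multilinear \<Phi> \<longleftrightarrow>
    (\<forall>x i u v. \<Phi> (x(i := u + v)) = \<Phi> (x(i := u)) + \<Phi> (x(i := v))) \<and>
    (\<forall>x i c u. \<Phi> (x(i := c *\<^sub>C u)) = c *\<^sub>C \<Phi> (x(i := u))) \<and>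
    (\<forall>x i j. i \<noteq> j \<longrightarrow> x i = x j \<longrightarrow> \<Phi> x = 0)"

definition formal_extension ::
    "(('p::finite \<Rightarrow> 'a::complex_banach) \<Rightarrow> 'b::complex_banach) \<Rightarrow> (('p \<Rightarrow> 'a) \<Rightarrow>\<^sub>0 complex) \<Rightarrow> 'b"
  where "formal_extension \<Phi> f = (\<Sum>x\<in>Poly_Mapping.keys f. Poly_Mapping.lookup f x *\<^sub>C \<Phi> x)"

lemma formal_extension_superset:
  assumes "finite S" "Poly_Mapping.keys f \<subseteq> S"
  shows "formal_extension \<Phi> f = (\<Sum>x\<in>S. Poly_Mapping.lookup f x *\<^sub>C \<Phi> x)"
  unfolding formal_extension_def
  by (rule sum.mono_neutral_left) (use assms in \<open>auto simp: in_keys_iff\<close>)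

lemma formal_extension_diff:
  "formal_extension \<Phi> (f - g) = formal_extension \<Phi> f - formal_extension \<Phi> g"
proof -
  let ?S = "Poly_Mapping.keys f \<union> Poly_Mapping.keys g"
  have "Poly_Mapping.keys (f - g) \<subseteq> ?S"
    by (auto simp: in_keys_iff lookup_minus)
  then show ?thesis
    by (simp add: formal_extension_superset[of ?S] lookup_minus
        complex_vector.scale_left_diff_distrib sum_subtractf)
qed

lemma formal_extension_add:
  "formal_extension \<Phi> (f + g) = formal_extension \<Phi> f + formal_extension \<Phi> g"
  using formal_extension_diff[of \<Phi> "f + g" g] by simp

lemma formal_extension_single: "formal_extension \<Phi> (Poly_Mapping.single x c) = c *\<^sub>C \<Phi> x"
  by (cases "c = 0") (auto simp: formal_extension_def)

text \<open>The universal property of the exterior power: by this, the linear extension of an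
  alternating map descends to the quotient.\<close>

lemma formal_extension_relations:
  assumes \<Phi>: "alternating_multilinear \<Phi>" and f: "f \<in> ext_relations"
  shows "formal_extension \<Phi> f = 0"
  using f
proof induction
  case zero
  then show ?case by (simp add: formal_extension_def)
next
  case (diff f g)
  then show ?case by (simp add: formal_extension_diff)
next
  case (additive x i u v c)
  have "\<Phi> (x(i := u + v)) = \<Phi> (x(i := u)) + \<Phi> (x(i := v))"
    using \<Phi> unfolding alternating_multilinear_def by blast
  then show ?case
    by (simp add: formal_extension_diff formal_extension_single scaleC_add_right)
next
  case (homogeneous x i k u c)
  have "\<Phi> (x(i := k *\<^sub>C u)) = k *\<^sub>C \<Phi> (x(i := u))"
    using \<Phi> unfolding alternating_multilinear_def by blast
  then show ?case
    by (simp add: formal_extension_diff formal_extension_single scaleC_scaleC)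
next
  case (alternating i j x c)
  then have "\<Phi> x = 0"
    using \<Phi> unfolding alternating_multilinear_def by blast
  then show ?case by (simp add: formal_extension_single)
qed

lemma formal_extension_rep_abs:
  assumes "alternating_multilinear \<Phi>"
  shows "formal_extension \<Phi> (rep_ext_power (abs_ext_power f)) = formal_extension \<Phi> f"
proof -
  have "rep_ext_power (abs_ext_power f) - f \<in> ext_relations"
    by (rule Quotient3_rep_abs[OF Quotient3_ext_power]) (simp add: ext_relations.zero)
  from formal_extension_relations[OF assms this] show ?thesis
    by (simp add: formal_extension_diff)
qed

lemma formal_extension_rep_sum_list:
  fixes zs :: "('p::finite \<Rightarrow> 'a::complex_banach) list"
  assumes \<Phi>: "alternating_multilinear \<Phi>"
  shows "formal_extension \<Phi> (rep_ext_power (\<Sum>z\<leftarrow>zs. wedge z)) = (\<Sum>z\<leftarrow>zs. \<Phi> z)"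
proof -
  have "(\<Sum>z\<leftarrow>zs. wedge z) = abs_ext_power (\<Sum>z\<leftarrow>zs. Poly_Mapping.single z 1)"
    by (induction zs) (simp_all add: zero_ext_power.abs_eq wedge.abs_eq plus_ext_power.abs_eq)
  moreover have "formal_extension \<Phi> (\<Sum>z\<leftarrow>zs. Poly_Mapping.single z 1) = (\<Sum>z\<leftarrow>zs. \<Phi> z)"
    by (induction zs) (simp_all add: formal_extension_add formal_extension_single, simp add: formal_extension_def)
  ultimately show ?thesis by (simp add: formal_extension_rep_abs[OF \<Phi>])
qed

text \<open>Through this an identity between p-vectors becomes one between the values of any
  alternating map, although the entries of the families are unrelated.\<close>

lemma alternating_wedge_sum_list:
  assumes \<Phi>: "alternating_multilinear \<Phi>" and x: "wedge x = (\<Sum>z\<leftarrow>zs. wedge z)"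
  shows "\<Phi> x = (\<Sum>z\<leftarrow>zs. \<Phi> z)"
  using formal_extension_rep_sum_list[OF \<Phi>, of "[x]"] formal_extension_rep_sum_list[OF \<Phi>, of zs] x
  by simp

lemma alternating_wedge_sum:
  fixes y :: "nat \<Rightarrow> 'p::finite \<Rightarrow> 'a::complex_banach"
  assumes "alternating_multilinear \<Phi>" and "wedge x = (\<Sum>i<k. wedge (y i))"
  shows "\<Phi> x = (\<Sum>i<k. \<Phi> (y i))"
  using alternating_wedge_sum_list[OF assms(1), of x "map y [0..<k]"] assms(2)
  by (simp add: interv_sum_list_conv_sum_set_nat atLeast0LessThan comp_def)

lemma det_rows_update_add:
  fixes v :: "'p::finite \<Rightarrow> complex ^ 'p"
  shows "det (\<chi> j. (v(i := a + b)) j) = det (\<chi> j. (v(i := a)) j) + det (\<chi> j. (v(i := b)) j)"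
  using det_row_add[of i "\<lambda>_. a" "\<lambda>_. b" v] by (simp add: fun_upd_def)

lemma det_rows_update_scale:
  fixes v :: "'p::finite \<Rightarrow> complex ^ 'p"
  shows "det (\<chi> j. (v(i := c *s a)) j) = c * det (\<chi> j. (v(i := a)) j)"
  using det_row_mul[of i c "\<lambda>_. a" v] by (simp add: fun_upd_def)

lemma det_rows_eq:
  fixes v :: "'p::finite \<Rightarrow> complex ^ 'p"
  assumes "i \<noteq> j" "v i = v j"
  shows "det (\<chi> j. v j) = 0"
  using assms by (intro det_identical_rows[of i j]) (auto simp: row_def vec_eq_iff)

section \<open>Determinant estimates and the two norms on the exterior power\<close>

lemma cmod_det_le:
  fixes A :: "complex ^ 'p ^ 'p::finite"
  assumes "\<And>i j. cmod (A $ i $ j) \<le> r i"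
  shows "cmod (det A) \<le> fact CARD('p) * (\<Prod>i\<in>UNIV. r i)"
proof -
  have "cmod (det A) \<le> (\<Sum>p | p permutes (UNIV :: 'p set). \<Prod>i\<in>UNIV. r i)"
    unfolding det_def
  proof (rule sum_norm_le)
    fix p :: "'p \<Rightarrow> 'p"
    have "cmod (of_int (sign p) * (\<Prod>i\<in>UNIV. A $ i $ p i)) = (\<Prod>i\<in>UNIV. cmod (A $ i $ p i))"
      by (simp add: norm_mult prod_norm sign_def)
    also have "\<dots> \<le> (\<Prod>i\<in>UNIV. r i)" using assms by (intro prod_mono) auto
    finally show "cmod (of_int (sign p) * (\<Prod>i\<in>UNIV. A $ i $ p i)) \<le> (\<Prod>i\<in>UNIV. r i)" .
  qed
  then show ?thesis by (simp add: card_permutations)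
qed

lemma alternating_det:
  fixes m :: "'a::complex_banach \<Rightarrow> complex ^ 'p::finite"
  assumes "Vector_Spaces.linear scaleC (*s) m"
  shows "alternating_multilinear (\<lambda>x. det (\<chi> j. m (x j)))"
proof -
  interpret m: Vector_Spaces.linear scaleC "(*s)" m by (rule assms)
  have upd: "(\<chi> j. m ((x(i := u)) j)) = (\<chi> j. ((\<lambda>j. m (x j))(i := m u)) j)" for x i u
    by (simp add: vec_eq_iff)
  show ?thesis
    unfolding alternating_multilinear_def
  proof (intro conjI allI impI)
    show "det (\<chi> j. m (x j)) = 0" if "i \<noteq> j" "x i = x j" for x i j
      using that by (intro det_rows_eq[of i j]) auto
  qed (simp_all only: upd m.add m.scale det_rows_update_add det_rows_update_scale scaleC_complex_def)
qed

text \<open>\<open>ext_norm1\<close> tests only functionals of norm exactly 1, so the coordinates of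
  \<open>m\<close> have to be normalised, which is possible for a coordinate that does not vanish
  identically.\<close>

lemma coordinate_functional:
  fixes m :: "'a::complex_banach \<Rightarrow> complex ^ 'p::finite"
  assumes m: "bounded_clinear (*s) m" and ne: "m u $ i \<noteq> 0"
  obtains l :: "'a \<Rightarrow> complex" and r :: real
  where "bounded_clinear (*) l" "onorm l = 1" "\<And>u. m u $ i = r * l u"
proof
  interpret m: Vector_Spaces.linear scaleC "(*s)" m using m by (simp add: bounded_clinear_def)
  let ?l = "\<lambda>u. m u $ i"
  define r where "r = onorm ?l"
  have bl: "bounded_linear ?l"
    using m bounded_linear_compose[OF bounded_linear_vec_nth] by (auto simp: bounded_clinear_def)
  have r: "r > 0"
    unfolding r_def using onorm_pos_lt[OF bl] ne by blast
  show "bounded_clinear (*) (\<lambda>u. (1 / r) *\<^sub>R ?l u)"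
    unfolding bounded_clinear_def
  proof
    show "bounded_linear (\<lambda>u. (1 / r) *\<^sub>R ?l u)"
      by (rule bounded_linear_compose[OF bounded_linear_scaleR_right bl])
    have "vector_space ((*) :: complex \<Rightarrow> complex \<Rightarrow> complex)"
      by unfold_locales (auto simp: algebra_simps)
    then show "Vector_Spaces.linear (*\<^sub>C) (*) (\<lambda>u. (1 / r) *\<^sub>R ?l u)"
      by (auto simp: Vector_Spaces.linear_iff m.add m.scale algebra_simps complex_vector.vector_space_axioms)
  qed
  show "onorm (\<lambda>u. (1 / r) *\<^sub>R ?l u) = 1"
    using onorm_scaleR[OF bl, of "1 / r"] r by (simp add: r_def)
  show "m u $ i = complex_of_real r * ((1 / r) *\<^sub>R ?l u)" for u
    using r by (simp add: scaleR_conv_of_real)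
qed

lemma ext_norm1_wedge_upper:
  fixes x :: "'p::finite \<Rightarrow> 'a::complex_banach"
  assumes l: "\<And>i. bounded_clinear (*) (l i)" "\<And>i. onorm (l i) = 1"
  shows "cmod (ext_pairing l (wedge x)) \<le> fact CARD('p) * (\<Prod>j\<in>UNIV. norm (x j))"
proof -
  have "cmod (l i (x j)) \<le> norm (x j)" for i j
    using onorm[of "l i" "x j"] l by (simp add: bounded_clinear_def)
  then have "cmod (det (\<chi> j i. l i (x j))) \<le> fact CARD('p) * (\<Prod>j\<in>UNIV. norm (x j))"
    by (intro cmod_det_le) simp
  then show ?thesis
    using l by (subst ext_pairing_wedge) (auto simp: bounded_clinear_def det_pairing_transpose)
qed

text \<open>These inequalities are all that is used of either norm. For \<open>ext_norm1\<close>,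
  the determinant is a multiple of the pairing with the normalised coordinates of \<open>m\<close>;
  for \<open>ext_norm2\<close>, it is additive over every decomposition of \<open>wedge x\<close>
  and bounded on each term.\<close>

lemma exterior_norm_bounds:
  fixes m :: "'a::complex_banach \<Rightarrow> complex ^ 'p::finite"
    and nrm :: "('a, 'p) ext_power \<Rightarrow> real"
  assumes nrm: "nrm = ext_norm1 \<or> nrm = ext_norm2"
    and m: "bounded_clinear (*s) m" and ne: "\<And>i. \<exists>u. m u $ i \<noteq> 0"
  obtains c where "c \<ge> 0" "\<And>x. cmod (det (\<chi> j. m (x j))) \<le> c * nrm (wedge x)"
    "\<And>x. nrm (wedge x) \<le> fact CARD('p) * (\<Prod>j\<in>UNIV. norm (x j))"
  using nrm
proof
  assume nrm: "nrm = ext_norm1"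
  have "\<forall>i. \<exists>l r. bounded_clinear (*) l \<and> onorm l = 1 \<and> (\<forall>u. m u $ i = complex_of_real r * l u)"
  proof
    fix i
    obtain u where "m u $ i \<noteq> 0" using ne by blast
    then show "\<exists>l r. bounded_clinear (*) l \<and> onorm l = 1 \<and> (\<forall>u. m u $ i = complex_of_real r * l u)"
      by (rule coordinate_functional[OF m]) blast
  qed
  then obtain l r where l: "\<And>i. bounded_clinear (*) (l i)" "\<And>i. onorm (l i) = 1"
      and lr: "\<And>i u. m u $ i = complex_of_real (r i) * l i u"
    by metis
  let ?S = "\<lambda>x. {cmod (ext_pairing l (wedge x)) | l. \<forall>i. bounded_clinear (*) (l i) \<and> onorm (l i) = 1}"
  \<comment> \<open>The real supremum in \<open>ext_norm1\<close> is meaningful only for a bounded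
    set.\<close>
  have bdd: "bdd_above (?S x)" for x :: "'p \<Rightarrow> 'a"
    using ext_norm1_wedge_upper by (intro bdd_aboveI) blast
  show ?thesis
  proof
    show "0 \<le> \<bar>\<Prod>i\<in>UNIV. r i\<bar>" by simp
    fix x :: "'p \<Rightarrow> 'a"
    have "det (\<chi> j. m (x j)) = det (\<chi> i. \<chi> j. m (x j) $ i)"
      using det_transpose[of "\<chi> j. m (x j)"] by (simp add: transpose_def)
    also have "(\<chi> i. \<chi> j. m (x j) $ i) = (\<chi> i. complex_of_real (r i) *s (\<chi> j. l i (x j)))"
      by (simp add: vec_eq_iff lr)
    also have "det \<dots> = (\<Prod>i\<in>UNIV. complex_of_real (r i)) * ext_pairing l (wedge x)"
      using l by (subst ext_pairing_wedge) (auto simp: bounded_clinear_def det_rows_mul)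
    finally have "cmod (det (\<chi> j. m (x j))) = \<bar>\<Prod>i\<in>UNIV. r i\<bar> * cmod (ext_pairing l (wedge x))"
      by (simp add: norm_mult flip: of_real_prod)
    also have "cmod (ext_pairing l (wedge x)) \<le> nrm (wedge x)"
      unfolding nrm ext_norm1_def using l by (intro cSup_upper bdd) blast
    finally show "cmod (det (\<chi> j. m (x j))) \<le> \<bar>\<Prod>i\<in>UNIV. r i\<bar> * nrm (wedge x)"
      by (simp add: mult_left_mono)
    show "nrm (wedge x) \<le> fact CARD('p) * (\<Prod>j\<in>UNIV. norm (x j))"
      unfolding nrm ext_norm1_def
    proof (rule cSup_least)
      show "?S x \<noteq> {}" using l by blast
    qed (use ext_norm1_wedge_upper in blast)
  qed
next
  assume nrm: "nrm = ext_norm2"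
  have bl: "bounded_linear m" and lin: "Vector_Spaces.linear scaleC (*s) m"
    using m by (simp_all add: bounded_clinear_def)
  let ?c = "fact CARD('p) * onorm m ^ CARD('p)"
  have det_le: "cmod (det (\<chi> j. m (x j))) \<le> ?c * (\<Prod>j\<in>UNIV. norm (x j))" for x
  proof -
    have "cmod (det (\<chi> j. m (x j))) \<le> fact CARD('p) * (\<Prod>j\<in>UNIV. onorm m * norm (x j))"
      using order_trans[OF Finite_Cartesian_Product.norm_nth_le onorm[OF bl]] by (intro cmod_det_le) simp
    then show ?thesis by (simp add: prod.distrib)
  qed
  let ?S = "\<lambda>X. {(\<Sum>x\<leftarrow>xs. \<Prod>i\<in>UNIV. norm (x i)) | xs. X = (\<Sum>x\<leftarrow>xs. wedge x)}"
  have c0: "?c \<ge> 0" using onorm_pos_le[OF bl] by simp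
  have mem: "(\<Prod>j\<in>UNIV. norm (x j)) \<in> ?S (wedge x)" for x :: "'p \<Rightarrow> 'a"
    by (intro CollectI exI[of _ "[x]"]) simp
  show ?thesis
  proof
    \<comment> \<open>The 1 makes the constant positive, so that it can be divided by.\<close>
    show "0 \<le> ?c + 1" using c0 by simp
    fix x :: "'p \<Rightarrow> 'a"
    have "cmod (det (\<chi> j. m (x j))) / (?c + 1) \<le> nrm (wedge x)"
      unfolding nrm ext_norm2_def
    proof (rule cInf_greatest)
      show "?S (wedge x) \<noteq> {}" using mem by blast
      fix t assume "t \<in> ?S (wedge x)"
      then obtain xs where t: "t = (\<Sum>x\<leftarrow>xs. \<Prod>i\<in>UNIV. norm (x i))" and xs: "wedge x = (\<Sum>x\<leftarrow>xs. wedge x)"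
        by blast
      have nn: "0 \<le> t" unfolding t by (intro sum_list_nonneg) (auto intro: prod_nonneg)
      have "cmod (\<Sum>x\<leftarrow>xs. det (\<chi> j. m (x j))) \<le> ?c * (\<Sum>x\<leftarrow>xs. \<Prod>i\<in>UNIV. norm (x i))"
      proof (induction xs)
        case (Cons z xs)
        then show ?case
          using det_le[of z] norm_triangle_le[of "det (\<chi> j. m (z j))" "\<Sum>x\<leftarrow>xs. det (\<chi> j. m (x j))"]
          by (simp add: distrib_left)
      qed simp
      then have "cmod (det (\<chi> j. m (x j))) \<le> ?c * t"
        using alternating_wedge_sum_list[OF alternating_det[OF lin] xs] by (simp add: t)
      also have "\<dots> \<le> (?c + 1) * t" using nn by (simp add: distrib_right)
      finally show "cmod (det (\<chi> j. m (x j))) / (?c + 1) \<le> t"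
        using c0 by (simp add: pos_divide_le_eq mult.commute)
    qed
    then show "cmod (det (\<chi> j. m (x j))) \<le> (?c + 1) * nrm (wedge x)"
      using c0 by (simp add: pos_divide_le_eq mult.commute)
    have "nrm (wedge x) \<le> (\<Prod>j\<in>UNIV. norm (x j))"
      unfolding nrm ext_norm2_def
    proof (rule cInf_lower[OF mem])
      show "bdd_below (?S (wedge x))"
        by (intro bdd_belowI[of _ 0]) (auto intro!: sum_list_nonneg prod_nonneg)
    qed
    also have "\<dots> \<le> fact CARD('p) * (\<Prod>j\<in>UNIV. norm (x j))"
      using mult_right_mono[OF fact_ge_1[of "CARD('p)", where 'a = real] prod_nonneg[of UNIV "\<lambda>j. norm (x j)"]] by simp
    finally show "nrm (wedge x) \<le> fact CARD('p) * (\<Prod>j\<in>UNIV. norm (x j))" .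
  qed
qed

text \<open>Measuring the pieces by the determinants of their projections removes the choice of the
  exterior norm from everything that follows.\<close>

lemma reproducing_decomposition:
  fixes m :: "'a::complex_banach \<Rightarrow> complex ^ 'p::finite"
    and nrm :: "('a, 'p) ext_power \<Rightarrow> real"
  assumes nrm: "nrm = ext_norm1 \<or> nrm = ext_norm2"
    and rep: "p_reproducing nrm C"
    and m: "bounded_clinear (*s) m" and ne: "\<And>i. \<exists>u. m u $ i \<noteq> 0"
  obtains A where "A \<ge> 0"
    "\<And>x :: 'p \<Rightarrow> 'a. \<exists>(k::nat) y. (\<forall>i<k. cspan (range (y i)) \<subseteq> C) \<and>
      wedge x = (\<Sum>i<k. wedge (y i)) \<and>
      (\<Sum>i<k. cmod (det (\<chi> j. m (y i j)))) \<le> A * (\<Prod>j\<in>UNIV. norm (x j))"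
proof -
  obtain c where c: "c \<ge> 0" "\<And>x. cmod (det (\<chi> j. m (x j))) \<le> c * nrm (wedge x)"
    "\<And>x. nrm (wedge x) \<le> fact CARD('p) * (\<Prod>j\<in>UNIV. norm (x j))"
    using exterior_norm_bounds[OF nrm m ne] by metis
  obtain k A where A: "A > 0" and y: "\<And>x :: 'p \<Rightarrow> 'a. \<exists>y :: nat \<Rightarrow> 'p \<Rightarrow> 'a.
      (\<forall>i<k. cspan (range (y i)) \<subseteq> C) \<and>
      wedge x = (\<Sum>i<k. wedge (y i)) \<and>
      (\<Sum>i<k. nrm (wedge (y i))) \<le> A * nrm (wedge x)"
    using rep unfolding p_reproducing_def by blast
  show ?thesis
  proof
    show "0 \<le> c * A * fact CARD('p)" using c(1) A by simp
    fix x :: "'p \<Rightarrow> 'a"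
    obtain y :: "nat \<Rightarrow> 'p \<Rightarrow> 'a" where "\<forall>i<k. cspan (range (y i)) \<subseteq> C"
      and "wedge x = (\<Sum>i<k. wedge (y i))"
      and le: "(\<Sum>i<k. nrm (wedge (y i))) \<le> A * nrm (wedge x)"
      using y by blast
    moreover have "(\<Sum>i<k. cmod (det (\<chi> j. m (y i j)))) \<le> c * (\<Sum>i<k. nrm (wedge (y i)))"
      unfolding sum_distrib_left by (intro sum_mono c)
    moreover have "\<dots> \<le> c * (A * (fact CARD('p) * (\<Prod>j\<in>UNIV. norm (x j))))"
      using c A le by (intro mult_left_mono order_trans[OF le]) auto
    ultimately have "(\<forall>i<k. cspan (range (y i)) \<subseteq> C) \<and>
      wedge x = (\<Sum>i<k. wedge (y i)) \<and>
      (\<Sum>i<k. cmod (det (\<chi> j. m (y i j)))) \<le> c * A * fact CARD('p) * (\<Prod>j\<in>UNIV. norm (x j))"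
      by (auto simp: mult.assoc)
    then show "\<exists>(k::nat) y. (\<forall>i<k. cspan (range (y i)) \<subseteq> C) \<and>
      wedge x = (\<Sum>i<k. wedge (y i)) \<and>
      (\<Sum>i<k. cmod (det (\<chi> j. m (y i j)))) \<le> c * A * fact CARD('p) * (\<Prod>j\<in>UNIV. norm (x j))"
      by blast
  qed
qed

section \<open>Determinants and linear endomorphisms of \<open>complex ^ 'p\<close>\<close>

text \<open>Dividing the entries by \<open>R\<close> brings them into the unit disc, where a
  difference of products is at most the sum of the differences of the factors; the Leibniz formula
  has \<open>fact CARD('p)\<close> such terms.\<close>

lemma cmod_det_diff_le:
  fixes X Y :: "complex ^ 'p ^ 'p::finite"
  assumes R: "R > 0" and X: "\<And>i j. cmod (X $ i $ j) \<le> R" and Y: "\<And>i j. cmod (Y $ i $ j) \<le> R"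
    and XY: "\<And>i j. cmod (X $ i $ j - Y $ i $ j) \<le> e"
  shows "cmod (det X - det Y) \<le> fact CARD('p) * (R ^ CARD('p) * (CARD('p) * (e / R)))"
proof -
  have "cmod (det X - det Y)
      \<le> (\<Sum>p | p permutes (UNIV :: 'p set). R ^ CARD('p) * (CARD('p) * (e / R)))"
    unfolding det_def sum_subtractf[symmetric]
  proof (rule sum_norm_le)
    fix p :: "'p \<Rightarrow> 'p"
    let ?x = "\<lambda>i. X $ i $ p i / of_real R" and ?y = "\<lambda>i. Y $ i $ p i / of_real R"
    have "cmod (of_int (sign p) * (\<Prod>i\<in>UNIV. X $ i $ p i) - of_int (sign p) * (\<Prod>i\<in>UNIV. Y $ i $ p i))
        = cmod ((\<Prod>i\<in>UNIV. X $ i $ p i) - (\<Prod>i\<in>UNIV. Y $ i $ p i))"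
      by (simp add: norm_mult sign_def norm_minus_commute)
    also have "(\<Prod>i\<in>UNIV. X $ i $ p i) - (\<Prod>i\<in>UNIV. Y $ i $ p i)
        = of_real R ^ CARD('p) * ((\<Prod>i\<in>UNIV. ?x i) - (\<Prod>i\<in>UNIV. ?y i))"
      using R by (simp add: prod_dividef field_simps)
    also have "cmod \<dots> = R ^ CARD('p) * cmod ((\<Prod>i\<in>UNIV. ?x i) - (\<Prod>i\<in>UNIV. ?y i))"
      using R by (simp add: norm_mult norm_power)
    also have "cmod ((\<Prod>i\<in>UNIV. ?x i) - (\<Prod>i\<in>UNIV. ?y i)) \<le> (\<Sum>i\<in>UNIV. cmod (?x i - ?y i))"
      using R X Y by (intro norm_prod_diff) (auto simp: norm_divide)
    also have "\<dots> \<le> (\<Sum>i\<in>(UNIV :: 'p set). e / R)"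
      using R XY by (intro sum_mono) (auto simp: norm_divide divide_right_mono simp flip: diff_divide_distrib)
    finally show "cmod (of_int (sign p) * (\<Prod>i\<in>UNIV. X $ i $ p i) - of_int (sign p) * (\<Prod>i\<in>UNIV. Y $ i $ p i))
        \<le> R ^ CARD('p) * (CARD('p) * (e / R))"
      using R by (simp add: mult_left_mono)
  qed
  then show ?thesis by (simp add: card_permutations)
qed

lemma norm_le_sum_components:
  fixes v :: "complex ^ 'p::finite"
  shows "norm v \<le> (\<Sum>i\<in>UNIV. cmod (v $ i))"
  unfolding norm_vec_def by (rule L2_set_le_sum) simp

text \<open>The images of the basis vectors are taken as rows, the convention used for determinants
  of families. The usual matrix is the transpose and has the same determinant.\<close>

definition endo_det :: "(complex ^ 'p::finite \<Rightarrow> complex ^ 'p) \<Rightarrow> complex"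
  where "endo_det A = det (\<chi> j. A (axis j 1))"

lemma det_endo_rows:
  fixes v :: "'p::finite \<Rightarrow> complex ^ 'p"
  assumes "Vector_Spaces.linear (*s) (*s) A"
  shows "det (\<chi> j. A (v j)) = det (\<chi> j. v j) * endo_det A"
proof -
  interpret A: Vector_Spaces.linear "(*s)" "(*s)" A by (rule assms)
  have "A (v j) = (\<Sum>k\<in>UNIV. v j $ k *s A (axis k 1))" for j
    using A.sum[of "\<lambda>k. v j $ k *s axis k 1" UNIV] by (simp add: basis_expansion A.scale)
  then have "(\<chi> j. A (v j)) = (\<chi> j. v j) ** (\<chi> j. A (axis j 1))"
    by (simp add: vec_eq_iff matrix_matrix_mult_def)
  then show ?thesis by (simp add: det_mul endo_det_def)
qed

lemma rows_axis: "(\<chi> j. axis j 1) = (mat 1 :: complex ^ 'p ^ 'p::finite)"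
  by (simp add: vec_eq_iff mat_def axis_def)

lemma endo_det_compose:
  assumes "Vector_Spaces.linear (*s) (*s) A"
  shows "endo_det (\<lambda>b. A (B b)) = endo_det A * endo_det B"
  using det_endo_rows[OF assms, of "\<lambda>j. B (axis j 1)"] by (simp only: endo_det_def mult.commute)

lemma endo_det_id: "endo_det (\<lambda>b :: complex ^ 'p::finite. b) = 1"
  by (simp add: endo_det_def rows_axis)

lemma endo_inverse:
  fixes A :: "complex ^ 'p::finite \<Rightarrow> complex ^ 'p"
  assumes A: "Vector_Spaces.linear (*s) (*s) A" and inj: "\<And>b. A b = 0 \<Longrightarrow> b = 0"
  obtains B where "Vector_Spaces.linear (*s) (*s) B" "\<And>b. A (B b) = b" "\<And>b. B (A b) = b"
proof -
  interpret A: Vector_Spaces.linear "(*s)" "(*s)" A by (rule A)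
  have "inj A"
  proof (rule injI)
    fix x y assume "A x = A y"
    then have "A (x - y) = 0" by (simp add: A.diff)
    then have "x - y = 0" by (rule inj)
    then show "x = y" by simp
  qed
  moreover from this have "surj A" using vec.linear_inj_imp_surj[OF A] by blast
  ultimately obtain B where "Vector_Spaces.linear (*s) (*s) B" "B \<circ> A = id"
    using vec.linear_injective_left_inverse[OF A] by blast
  moreover from this have "A (B b) = b" for b
    using \<open>surj A\<close> by (metis comp_apply id_apply surjD)
  ultimately show ?thesis by (intro that) (auto simp: fun_eq_iff)
qed

lemma endo_det_nonzero:
  fixes A :: "complex ^ 'p::finite \<Rightarrow> complex ^ 'p"
  assumes A: "Vector_Spaces.linear (*s) (*s) A" and inj: "\<And>b. A b = 0 \<Longrightarrow> b = 0"
  shows "endo_det A \<noteq> 0"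
proof -
  obtain B where "\<And>b. A (B b) = b" using endo_inverse[OF assms] by metis
  then show ?thesis using endo_det_compose[OF A, of B] endo_det_id[where 'p = 'p] by auto
qed

lemma det_rows_zero_dependent:
  fixes v :: "'p::finite \<Rightarrow> complex ^ 'p"
  assumes "det (\<chi> j. v j) = 0"
  obtains c l where "c l \<noteq> (0 :: complex)" "(\<Sum>j\<in>UNIV. c j *s v j) = 0"
proof -
  let ?A = "\<chi> j. v j"
  have "\<not> (\<exists>B. B ** transpose ?A = mat 1)"
    using assms det_mul[where 'a = complex and 'n = 'p] det_transpose[of ?A]
    by (metis det_I mult_zero_right zero_neq_one)
  then obtain x where x: "x \<noteq> 0" "transpose ?A *v x = 0"
    unfolding matrix_left_invertible_ker by blast
  then obtain l where "x $ l \<noteq> 0" by (auto simp: vec_eq_iff)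
  moreover have "(\<Sum>j\<in>UNIV. x $ j *s v j) = 0"
    using x(2) by (simp add: matrix_mult_sum column_def transpose_def)
  ultimately show ?thesis by (rule that)
qed

text \<open>The characteristic polynomial is treated as an entire function: away from 0,
  \<open>f z = z ^ CARD('p) * h (inverse z)\<close> with \<open>h\<close> continuous and nonzero at
  0, so \<open>f\<close> tends to infinity and Liouville's theorem provides a zero.\<close>

lemma eigenvector_exists:
  fixes A :: "complex ^ 'p::finite \<Rightarrow> complex ^ 'p"
  assumes A: "Vector_Spaces.linear (*s) (*s) A"
  obtains \<mu> b where "b \<noteq> 0" "A b = \<mu> *s b"
proof -
  interpret A: Vector_Spaces.linear "(*s)" "(*s)" A by (rule A)
  define X where "X = (\<chi> j. A (axis j 1))"
  define f where "f = (\<lambda>z. det (X - mat z))"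
  define h where "h = (\<lambda>t. det (\<chi> i j. t * X $ i $ j - (if i = j then 1 else 0)))"
  have hol: "f holomorphic_on UNIV"
  proof -
    have "(\<lambda>z. if i = j then z else 0) holomorphic_on UNIV" for i j :: 'p
      by (cases "i = j") auto
    then show ?thesis
      unfolding f_def det_def mat_def by (auto intro!: holomorphic_intros)
  qed
  have f_h: "f z = z ^ CARD('p) * h (inverse z)" if "z \<noteq> 0" for z
  proof -
    have "X - mat z = (\<chi> i. z *s (\<chi> j. inverse z * X $ i $ j - (if i = j then 1 else 0)))"
      using that by (simp add: vec_eq_iff mat_def algebra_simps)
    then show ?thesis by (simp add: f_def h_def det_rows_mul)
  qed
  have "(\<chi> i j. 0 * X $ i $ j - (if i = j then 1 else 0)) = (\<chi> i. - 1 *s (mat 1 :: complex ^ 'p ^ 'p) $ i)"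
    by (simp add: vec_eq_iff mat_def)
  then have h0: "h 0 \<noteq> 0" by (simp only: h_def det_rows_mul vec_lambda_eta det_I) simp
  have "isCont h 0"
    unfolding isCont_def h_def det_def by (simp only: vec_lambda_beta) (intro tendsto_intros)
  then have "((\<lambda>z. h (inverse z)) \<longlongrightarrow> h 0) at_infinity"
    by (rule isCont_tendsto_compose[OF _ tendsto_inverse_0])
  then have h_ev: "\<forall>\<^sub>F z in at_infinity. cmod (h 0) / 2 < cmod (h (inverse z))"
    using h0 by (intro order_tendstoD(1)[OF tendsto_norm]) auto
  have "\<forall>\<^sub>F z in at_infinity. B \<le> cmod (f z)" for B
  proof -
    \<comment> \<open>The 1 ensures \<open>cmod z \<le> cmod z ^ CARD('p)\<close>; the other summand
      makes \<open>cmod z * (cmod (h 0) / 2)\<close> at least \<open>B\<close>.\<close>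
    have "\<forall>\<^sub>F z :: complex in at_infinity. 1 + 2 * \<bar>B\<bar> / cmod (h 0) \<le> cmod z"
      by (auto simp: eventually_at_infinity)
    with h_ev show ?thesis
    proof eventually_elim
      case (elim z)
      have z1: "cmod z \<ge> 1" and zB: "2 * \<bar>B\<bar> / cmod (h 0) \<le> cmod z"
        using elim(2) h0 by (smt (verit) divide_nonneg_pos zero_less_norm_iff)+
      have "B \<le> 2 * \<bar>B\<bar> / cmod (h 0) * (cmod (h 0) / 2)" using h0 by simp
      also have "\<dots> \<le> cmod z ^ CARD('p) * cmod (h (inverse z))"
        using elim zB self_le_power[OF z1, of "CARD('p)"] by (intro mult_mono) auto
      also have "\<dots> = cmod (f z)" using z1 by (subst f_h) (auto simp: norm_mult norm_power)
      finally show ?case .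
    qed
  qed
  then obtain z where z: "f z = 0" by (rule Liouville_weak_inverse[OF hol])
  have "endo_det (\<lambda>b. A b - z *s b) = f z"
    unfolding endo_det_def f_def X_def
    by (rule arg_cong[of _ _ det]) (simp add: vec_eq_iff mat_def axis_def)
  moreover have "Vector_Spaces.linear (*s) (*s) (\<lambda>b. A b - z *s b)"
    by (intro vec.linear_compose_sub A vec.linear_scale_self)
  ultimately have "\<exists>b. b \<noteq> 0 \<and> A b - z *s b = 0" using endo_det_nonzero[of "\<lambda>b. A b - z *s b"] z by auto
  then obtain b where "b \<noteq> 0" "A b - z *s b = 0" by blast
  then show ?thesis by (intro that[of b z]) auto
qed

section \<open>Linear sections\<close>

lemma alternating_eq:
  "alternating_multilinear \<Phi> \<Longrightarrow> i \<noteq> j \<Longrightarrow> x i = x j \<Longrightarrow> \<Phi> x = 0"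
  unfolding alternating_multilinear_def by blast

lemma alternating_add:
  "alternating_multilinear \<Phi> \<Longrightarrow> \<Phi> (x(i := u + v)) = \<Phi> (x(i := u)) + \<Phi> (x(i := v))"
  unfolding alternating_multilinear_def by blast

lemma alternating_scale:
  "alternating_multilinear \<Phi> \<Longrightarrow> \<Phi> (x(i := c *\<^sub>C u)) = c *\<^sub>C \<Phi> (x(i := u))"
  unfolding alternating_multilinear_def by blast

lemma alternating_update_sum:
  assumes \<Phi>: "alternating_multilinear \<Phi>" and "finite S"
  shows "\<Phi> (y(l := (\<Sum>j\<in>S. c j *\<^sub>C u j))) = (\<Sum>j\<in>S. c j *\<^sub>C \<Phi> (y(l := u j)))"
  using \<open>finite S\<close>
proof induction
  case empty
  have "\<Phi> (y(l := 0 *\<^sub>C 0)) = 0 *\<^sub>C \<Phi> (y(l := 0))"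
    using \<Phi> unfolding alternating_multilinear_def by blast
  then show ?case
    by (simp only: complex_vector.scale_zero_right complex_vector.scale_zero_left sum.empty)
next
  case (insert i S)
  then show ?case
    by (simp only: sum.insert alternating_add[OF \<Phi>] alternating_scale[OF \<Phi>] not_False_eq_True)
qed

text \<open>Putting the vanishing combination into slot \<open>l\<close> gives 0; when it is
  expanded there, every term except \<open>c l *\<^sub>C \<Phi> y\<close> has a repeated
  entry.\<close>

lemma alternating_dependent:
  fixes y :: "'p::finite \<Rightarrow> 'a::complex_banach"
  assumes \<Phi>: "alternating_multilinear \<Phi>"
    and cl: "c l \<noteq> 0" and dep: "(\<Sum>j\<in>UNIV. c j *\<^sub>C y j) = 0"
  shows "\<Phi> y = 0"
proof -
  have "(\<Sum>j\<in>UNIV. c j *\<^sub>C \<Phi> (y(l := y j))) = \<Phi> (y(l := 0))"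
    using alternating_update_sum[OF \<Phi> finite, of y l c y UNIV] dep by simp
  also have "\<dots> = 0"
    using alternating_update_sum[OF \<Phi> finite.emptyI, of y l] by simp
  finally have "(\<Sum>j\<in>UNIV. c j *\<^sub>C \<Phi> (y(l := y j))) = 0" .
  moreover have "\<Phi> (y(l := y j)) = 0" if "j \<noteq> l" for j
    by (rule alternating_eq[OF \<Phi>, of l j]) (use that in auto)
  then have "(\<Sum>j\<in>UNIV. c j *\<^sub>C \<Phi> (y(l := y j))) = (\<Sum>j\<in>{l}. c j *\<^sub>C \<Phi> (y(l := y j)))"
    by (intro sum.mono_neutral_right) auto
  ultimately have "c l *\<^sub>C \<Phi> y = 0" by simp
  then show ?thesis using cl by simp
qed

lemma linear_combination_linear:
  fixes B :: "complex ^ 'p::finite \<Rightarrow> complex ^ 'p" and y :: "'p \<Rightarrow> 'a::complex_banach"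
  assumes "Vector_Spaces.linear (*s) (*s) B"
  shows "Vector_Spaces.linear (*s) scaleC (\<lambda>b. \<Sum>j\<in>UNIV. B b $ j *\<^sub>C y j)"
proof -
  interpret B: Vector_Spaces.linear "(*s)" "(*s)" B by (rule assms)
  show ?thesis
    unfolding Vector_Spaces.linear_iff
    by (auto simp: B.add B.scale scaleC_add_left sum.distrib
        complex_vector.scale_sum_right complex_vector.vector_space_axioms vec.vector_space_axioms)
qed

text \<open>The section combines the \<open>y j\<close> with the coefficients of \<open>b\<close> in
  the basis \<open>m (y j)\<close>. The matrix is transposed because these vectors have to be its
  columns.\<close>

lemma section_of_family:
  fixes m :: "'a::complex_banach \<Rightarrow> complex ^ 'p::finite"
  assumes m: "Vector_Spaces.linear scaleC (*s) m" and y: "det (\<chi> j. m (y j)) \<noteq> 0"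
  obtains s where "Vector_Spaces.linear (*s) scaleC s" "\<And>b. m (s b) = b"
    "\<And>b. s b \<in> cspan (range y)" "\<And>j. s (m (y j)) = y j"
proof -
  interpret m: Vector_Spaces.linear scaleC "(*s)" m by (rule m)
  let ?A = "transpose (\<chi> j. m (y j))"
  have A: "?A *v c = (\<Sum>j\<in>UNIV. c $ j *s m (y j))" for c
    by (simp add: matrix_mult_sum column_def transpose_def)
  have "invertible ?A" using y by (simp only: invertible_det_nz det_transpose) simp
  then obtain B where B: "?A ** B = mat 1" "B ** ?A = mat 1" unfolding invertible_def by blast
  define s where "s = (\<lambda>b. \<Sum>j\<in>UNIV. (B *v b) $ j *\<^sub>C y j)"
  show ?thesis
  proof
    show "Vector_Spaces.linear (*s) (*\<^sub>C) s"
      unfolding s_def by (rule linear_combination_linear) simp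
    show "m (s b) = b" for b
    proof -
      have "m (s b) = ?A *v (B *v b)" by (simp only: s_def m.sum m.scale A)
      then show ?thesis by (simp add: matrix_vector_mul_assoc B)
    qed
    show "s b \<in> cspan (range y)" for b
      unfolding s_def
      by (intro complex_vector.span_sum complex_vector.span_scale complex_vector.span_base) simp
    show "s (m (y j)) = y j" for j
    proof -
      have "?A *v axis j 1 = m (y j)" 
      proof -
        have "?A *v axis j 1 = (\<Sum>i\<in>UNIV. if i = j then m (y i) else 0)"
          unfolding A by (intro sum.cong) (auto simp: axis_def)
        then show ?thesis by simp
      qed
      then have "B *v m (y j) = axis j 1"
        using B(2) by (metis matrix_vector_mul_assoc matrix_vector_mul_lid)
      then have "s (m (y j)) = (\<Sum>i\<in>UNIV. axis j 1 $ i *\<^sub>C y i)" by (simp add: s_def)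
      also have "\<dots> = (\<Sum>i\<in>UNIV. if i = j then y i else 0)"
        by (intro sum.cong) (auto simp: axis_def)
      finally show ?thesis by simp
    qed
  qed
qed

text \<open>Cramer's rule cleared of its denominator: when the \<open>m (x j)\<close> form a basis,
  this is their determinant times the solution \<open>u\<close> of \<open>m u = b\<close> in the
  span of the \<open>x j\<close>. Without the division it makes sense for all families.\<close>

definition cramer_combination ::
    "('a::complex_banach \<Rightarrow> complex ^ 'p::finite) \<Rightarrow> complex ^ 'p \<Rightarrow> ('p \<Rightarrow> 'a) \<Rightarrow> 'a"
  where "cramer_combination m b x = (\<Sum>j\<in>UNIV. det (\<chi> l. ((\<lambda>l. m (x l))(j := b)) l) *\<^sub>C x j)"

text \<open>In slot \<open>i\<close>, the coefficient of \<open>x i\<close> does not involve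
  \<open>x i\<close>, and every other coefficient is linear in it, so each term is linear. If two
  entries agree, the coefficients belonging to them cancel and the remaining determinants have two
  equal rows.\<close>

lemma alternating_cramer_combination:
  fixes m :: "'a::complex_banach \<Rightarrow> complex ^ 'p::finite"
  assumes m: "Vector_Spaces.linear scaleC (*s) m"
  shows "alternating_multilinear (cramer_combination m b)"
proof -
  interpret m: Vector_Spaces.linear scaleC "(*s)" m by (rule m)
  let ?D = "\<lambda>x j. det (\<chi> l. ((\<lambda>l. m (x l))(j := b)) l)"
  have upd: "(\<lambda>l. m ((x(i := u)) l)) = (\<lambda>l. m (x l))(i := m u)" for x i u by auto
  have same: "?D (x(i := u)) i = ?D x i" for x i u by (simp only: upd fun_upd_upd)
  have other: "?D (x(i := u)) j = det (\<chi> l. (((\<lambda>l. m (x l))(j := b))(i := m u)) l)" if "j \<noteq> i" for x i j u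
    using that by (simp only: upd fun_upd_twist[OF that[symmetric]])
  show ?thesis
    unfolding alternating_multilinear_def
  proof (intro conjI allI impI)
    fix x :: "'p \<Rightarrow> 'a" and i u v
    have "?D (x(i := u + v)) j *\<^sub>C (x(i := u + v)) j
        = ?D (x(i := u)) j *\<^sub>C (x(i := u)) j + ?D (x(i := v)) j *\<^sub>C (x(i := v)) j" for j
    proof (cases "j = i")
      case True
      then show ?thesis by (simp add: same scaleC_add_right del: fun_upd_apply) (simp add: scaleC_add_right)
    next
      case False
      then show ?thesis
        by (simp only: other[OF False] m.add det_rows_update_add) (simp add: scaleC_add_left)
    qed
    then show "cramer_combination m b (x(i := u + v))
        = cramer_combination m b (x(i := u)) + cramer_combination m b (x(i := v))"
      by (simp only: cramer_combination_def sum.distrib[symmetric])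
  next
    fix x :: "'p \<Rightarrow> 'a" and i c u
    have "?D (x(i := c *\<^sub>C u)) j *\<^sub>C (x(i := c *\<^sub>C u)) j = c *\<^sub>C (?D (x(i := u)) j *\<^sub>C (x(i := u)) j)" for j
    proof (cases "j = i")
      case True
      then show ?thesis by (simp only: same fun_upd_same) (simp add: scaleC_scaleC mult.commute)
    next
      case False
      then show ?thesis
        by (simp only: other[OF False] m.scale det_rows_update_scale) (simp add: scaleC_scaleC)
    qed
    then show "cramer_combination m b (x(i := c *\<^sub>C u)) = c *\<^sub>C cramer_combination m b (x(i := u))"
      by (simp only: cramer_combination_def complex_vector.scale_sum_right)
  next
    fix x :: "'p \<Rightarrow> 'a" and i k
    assume ik: "i \<noteq> k" "x i = x k"
    let ?v = "\<lambda>l. m (x l)"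
    have vi: "?v(i := m (x i)) = ?v" and vk: "?v(k := m (x i)) = ?v" using ik by auto
    have two: "sum g {i, k} = g i + g k" for g :: "'p \<Rightarrow> 'a" using ik(1) by simp
    have zero: "?D x j = 0" if "j \<noteq> i" "j \<noteq> k" for j
      by (rule det_rows_eq[OF ik(1)]) (use that ik in simp)
    \<comment> \<open>Antisymmetry by polarisation: expanding the rows \<open>m (x i) + b\<close> in
      both slots leaves only the two coefficients in question, whose sum is therefore 0.\<close>
    have "det (\<chi> l. (?v(i := m (x i) + b, k := m (x i) + b)) l) = 0"
      by (rule det_rows_eq[OF ik(1)]) (use ik in simp)
    moreover have "det (\<chi> l. (?v(i := m (x i), k := m (x i))) l) = 0"
      by (rule det_rows_eq[OF ik(1)]) (use ik in simp)
    moreover have "det (\<chi> l. (?v(i := b, k := b)) l) = 0"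
      by (rule det_rows_eq[OF ik(1)]) (use ik in simp)
    moreover have "det (\<chi> l. (?v(i := m (x i), k := b)) l) = ?D x k"
      by (simp only: vi)
    moreover have "det (\<chi> l. (?v(i := b, k := m (x i))) l) = ?D x i"
      by (simp only: fun_upd_twist[OF ik(1)] vk)
    moreover have "det (\<chi> l. (?v(i := m (x i) + b, k := u)) l)
        = det (\<chi> l. (?v(i := m (x i), k := u)) l) + det (\<chi> l. (?v(i := b, k := u)) l)" for u
      using ik det_rows_update_add[of "?v(k := u)" i "m (x i)" b] by (simp only: fun_upd_twist[OF ik(1)])
    ultimately have swap: "?D x i + ?D x k = 0"
      by (simp only: det_rows_update_add) simp
    have "cramer_combination m b x = (\<Sum>j\<in>{i, k}. ?D x j *\<^sub>C x j)"
      unfolding cramer_combination_def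
    proof (rule sum.mono_neutral_right)
      show "\<forall>j\<in>UNIV - {i, k}. ?D x j *\<^sub>C x j = 0"
      proof
        fix j assume "j \<in> UNIV - {i, k}"
        then have "?D x j = 0" by (intro zero) auto
        then show "?D x j *\<^sub>C x j = 0" by (simp only: complex_vector.scale_zero_left)
      qed
    qed auto
    also have "\<dots> = (?D x i + ?D x k) *\<^sub>C x k"
      by (simp only: two scaleC_add_left ik(2))
    finally show "cramer_combination m b x = 0" by (simp only: swap complex_vector.scale_zero_left)
  qed
qed

text \<open>The hypothesis places the family on the range of \<open>s\<close>. If the projections
  are dependent, linearity of \<open>s\<close> makes the family itself dependent and both sides
  vanish; otherwise this is Cramer's rule.\<close>

lemma cramer_combination_section:
  fixes m :: "'a::complex_banach \<Rightarrow> complex ^ 'p::finite"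
  assumes m: "Vector_Spaces.linear scaleC (*s) m"
    and s: "Vector_Spaces.linear (*s) scaleC s" and x: "\<And>j. x j = s (m (x j))"
  shows "cramer_combination m b x = det (\<chi> j. m (x j)) *\<^sub>C s b"
proof (cases "det (\<chi> j. m (x j)) = 0")
  case True
  interpret s: Vector_Spaces.linear "(*s)" scaleC s by (rule s)
  obtain c l where cl: "c l \<noteq> 0" "(\<Sum>j\<in>UNIV. c j *s m (x j)) = 0"
    using det_rows_zero_dependent[OF True] by blast
  have "(\<Sum>j\<in>UNIV. c j *\<^sub>C x j) = s (\<Sum>j\<in>UNIV. c j *s m (x j))"
    unfolding s.sum s.scale using x by simp
  then have "(\<Sum>j\<in>UNIV. c j *\<^sub>C x j) = 0" by (simp add: cl(2))
  then have "cramer_combination m b x = 0"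
    by (rule alternating_dependent[where c = c and l = l, OF alternating_cramer_combination[OF m] cl(1)])
  then show ?thesis by (simp add: True)
next
  case nz: False
  interpret s: Vector_Spaces.linear "(*s)" scaleC s by (rule s)
  let ?A = "\<chi> j. m (x j)"
  have row: "row i ?A = m (x i)" for i by (simp add: row_def vec_eq_iff)
  have "invertible (transpose ?A)" using nz by (simp only: invertible_det_nz det_transpose) simp
  then obtain c where "transpose ?A *v c = b"
    unfolding invertible_def by (metis matrix_vector_mul_assoc matrix_vector_mul_lid)
  then have b: "b = (\<Sum>i\<in>UNIV. c $ i *s m (x i))"
    by (simp add: matrix_mult_sum column_def transpose_def)
  have "det (\<chi> l. ((\<lambda>l. m (x l))(j := b)) l) = c $ j * det ?A" for j
    using cramer_lemma_transpose[of j c ?A] unfolding row b by (simp add: fun_upd_def)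
  then have "cramer_combination m b x = det ?A *\<^sub>C (\<Sum>j\<in>UNIV. c $ j *\<^sub>C x j)"
    by (simp add: cramer_combination_def complex_vector.scale_sum_right scaleC_scaleC mult.commute)
  also have "(\<Sum>j\<in>UNIV. c $ j *\<^sub>C x j) = s b"
    unfolding b s.sum s.scale using x by simp
  finally show ?thesis .
qed

section \<open>Graphs of sections over an invariant cone\<close>

locale invariant_cone =
  fixes C :: "'a::complex_banach set" and m :: "'a \<Rightarrow> complex ^ 'p::finite"
    and T :: "'a \<Rightarrow> 'a" and k :: real
  assumes closed_C: "closed C"
    and m: "bounded_clinear (*s) m" and T: "bounded_clinear scaleC T"
    and T_cone: "u \<in> C \<Longrightarrow> T u \<in> C" and T_zero: "u \<in> C \<Longrightarrow> T u = 0 \<Longrightarrow> u = 0"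
    and aperture: "u \<in> C \<Longrightarrow> norm u \<le> k * norm (m u)" and k_pos: "k > 0"
begin

sublocale m: Vector_Spaces.linear scaleC "(*s)" m
  using m by (simp add: bounded_clinear_def)

sublocale T: Vector_Spaces.linear scaleC scaleC T
  using T by (simp add: bounded_clinear_def)

lemma m_bounded: "bounded_linear m" and T_bounded: "bounded_linear T"
  using m T by (simp_all add: bounded_clinear_def)

definition is_section :: "(complex ^ 'p \<Rightarrow> 'a) \<Rightarrow> bool"
  where "is_section s \<longleftrightarrow> Vector_Spaces.linear (*s) scaleC s \<and> (\<forall>b. m (s b) = b) \<and> (\<forall>b. s b \<in> C)"

lemma section_linear: "is_section s \<Longrightarrow> Vector_Spaces.linear (*s) scaleC s"
  and m_section: "is_section s \<Longrightarrow> m (s b) = b"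
  and section_in_cone: "is_section s \<Longrightarrow> s b \<in> C"
  by (simp_all add: is_section_def)

lemma norm_section_le: "is_section s \<Longrightarrow> norm (s b) \<le> k * norm b"
  using aperture[of "s b"] by (simp add: m_section section_in_cone)

lemma section_zero: "is_section s \<Longrightarrow> s b = 0 \<Longrightarrow> b = 0"
  using m_section[of s b] by simp

definition push :: "(complex ^ 'p \<Rightarrow> 'a) \<Rightarrow> complex ^ 'p \<Rightarrow> complex ^ 'p"
  where "push s b = m (T (s b))"

lemma push_linear:
  assumes "is_section s"
  shows "Vector_Spaces.linear (*s) (*s) (push s)"
proof -
  interpret s: Vector_Spaces.linear "(*s)" scaleC s by (rule section_linear[OF assms])
  show ?thesis
    unfolding Vector_Spaces.linear_iff push_def
    by (auto simp: s.add s.scale T.add T.scale m.add m.scale vec.vector_space_axioms)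
qed

text \<open>The vector \<open>T (s b)\<close> stays in \<open>C\<close>, where the aperture rules
  out a zero projection of a nonzero vector. This is what makes \<open>inv (push s)\<close> a true
  inverse.\<close>

lemma push_zero:
  assumes "is_section s" "push s b = 0"
  shows "b = 0"
proof -
  have "T (s b) \<in> C" using assms by (intro T_cone section_in_cone)
  then have "T (s b) = 0" using aperture[of "T (s b)"] assms(2) by (simp add: push_def)
  then show ?thesis using assms(1) T_zero section_in_cone section_zero by blast
qed

text \<open>The graph transform: the range of \<open>s\<close> is mapped by \<open>T\<close>, and
  \<open>inv (push s)\<close> reparametrises the image so that it is again a section.\<close>

definition step :: "(complex ^ 'p \<Rightarrow> 'a) \<Rightarrow> complex ^ 'p \<Rightarrow> 'a"
  where "step s b = T (s (inv (push s) b))"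

lemma inv_push:
  assumes "is_section s"
  shows "Vector_Spaces.linear (*s) (*s) (inv (push s))" "push s (inv (push s) b) = b"
    "inv (push s) (push s b) = b"
proof -
  obtain B where B: "Vector_Spaces.linear (*s) (*s) B" "\<And>b. push s (B b) = b" "\<And>b. B (push s b) = b"
    using endo_inverse[OF push_linear[OF assms] push_zero[OF assms]] by metis
  have "inv (push s) = B" by (rule inv_equality) (use B in auto)
  then show "Vector_Spaces.linear (*s) (*s) (inv (push s))" "push s (inv (push s) b) = b"
    "inv (push s) (push s b) = b"
    using B by auto
qed

lemma step_push: "is_section s \<Longrightarrow> step s (push s b) = T (s b)"
  by (simp add: step_def inv_push)

lemma is_section_step:
  assumes "is_section s"
  shows "is_section (step s)"
proof -
  interpret s: Vector_Spaces.linear "(*s)" scaleC s by (rule section_linear[OF assms])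
  interpret B: Vector_Spaces.linear "(*s)" "(*s)" "inv (push s)" by (rule inv_push[OF assms])
  have "Vector_Spaces.linear (*s) scaleC (step s)"
    unfolding Vector_Spaces.linear_iff step_def
    by (auto simp: s.add s.scale T.add T.scale B.add B.scale vec.vector_space_axioms
        complex_vector.vector_space_axioms)
  moreover have "m (step s b) = b" for b
    using inv_push(2)[OF assms, of b] by (simp add: step_def push_def)
  moreover have "step s b \<in> C" for b
    unfolding step_def by (intro T_cone section_in_cone[OF assms])
  ultimately show ?thesis by (simp add: is_section_def)
qed

lemma is_section_iterate: "is_section s \<Longrightarrow> is_section ((step ^^ n) s)"
  by (induction n) (auto intro: is_section_step)

lemma range_step:
  assumes "is_section s"
  shows "range (step s) = T ` range s"
proof
  show "range (step s) \<subseteq> T ` range s" by (auto simp: step_def)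
  show "T ` range s \<subseteq> range (step s)"
  proof clarify
    fix b show "T (s b) \<in> range (step s)" unfolding step_push[OF assms, symmetric] by simp
  qed
qed

section \<open>Iterates of the graph transform and their contraction\<close>

definition transition :: "nat \<Rightarrow> (complex ^ 'p \<Rightarrow> 'a) \<Rightarrow> complex ^ 'p \<Rightarrow> complex ^ 'p"
  where "transition n s b = m ((T ^^ n) (s b))"

lemma iterate_transition:
  assumes "is_section s"
  shows "(step ^^ n) s (transition n s b) = (T ^^ n) (s b)"
proof (induction n)
  case 0
  then show ?case using assms by (simp add: transition_def m_section)
next
  case (Suc n)
  have "(T ^^ Suc n) (s b) = T ((step ^^ n) s (transition n s b))" by (simp add: Suc)
  also have "\<dots> = (step ^^ Suc n) s (push ((step ^^ n) s) (transition n s b))"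
    by (simp add: step_push is_section_iterate assms)
  finally have eq: "(T ^^ Suc n) (s b) = (step ^^ Suc n) s (push ((step ^^ n) s) (transition n s b))" .
  then have "transition (Suc n) s b = push ((step ^^ n) s) (transition n s b)"
    unfolding transition_def using m_section[OF is_section_iterate[OF assms]] by metis
  then show ?case using eq by simp
qed

lemma transition_Suc:
  assumes "is_section s"
  shows "transition (Suc n) s b = push ((step ^^ n) s) (transition n s b)"
  unfolding push_def iterate_transition[OF assms] by (simp add: transition_def)

lemma transition_zero: "is_section s \<Longrightarrow> transition 0 s b = b"
  by (simp add: transition_def m_section)

lemma subspace_of_dim_section:
  assumes s: "is_section s"
  shows "subspace_of_dim CARD('p) (range s)"
proof -
  interpret s: Vector_Spaces.linear "(*s)" scaleC s by (rule section_linear[OF s])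
  have inj: "inj s" using m_section[OF s] by (metis injI)
  have "\<not> cdependent (s ` cart_basis)"
    using s.independent_injective_image[OF vec.independent_Basis] inj
    by (simp add: cdependent_def inj_on_subset)
  moreover have "cspan (s ` cart_basis) = range s"
    using s.span_image[of cart_basis] by (simp add: cspan_def vec.span_Basis)
  moreover have "card (s ` cart_basis) = CARD('p)"
    using inj by (simp add: card_image inj_on_subset card_cart_basis)
  ultimately show ?thesis
    unfolding subspace_of_dim_def by (intro exI[of _ "s ` cart_basis"]) (auto simp: vec.finite_Basis)
qed

text \<open>The first step only brings both subspaces into the image of \<open>C\<close>, whose
  diameter bounds their distance; the later steps contract. Hence the exponent \<open>n\<close> at
  index \<open>Suc n\<close>.\<close>

lemma cone_dist_iterate_le:
  assumes \<eta>: "contraction_coefficient \<delta> CARD('p) C T \<eta>"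
    and diam: "cone_diam \<delta> CARD('p) C (T ` C) < \<infinity>"
    and s: "is_section s" and s': "is_section s'"
  shows "cone_dist \<delta> C (range ((step ^^ Suc n) s)) (range ((step ^^ Suc n) s'))
    \<le> ennreal \<eta> ^ n * cone_diam \<delta> CARD('p) C (T ` C)"
proof (induction n)
  case 0
  have "range (step t) \<subseteq> T ` C" if "is_section t" for t
    using that section_in_cone by (auto simp: range_step)
  then show ?case
    using s s' unfolding cone_diam_def
    by (simp, intro Sup_upper) (blast intro: subspace_of_dim_section is_section_step)
next
  case (Suc n)
  let ?V = "range ((step ^^ Suc n) s)" and ?W = "range ((step ^^ Suc n) s')"
  let ?D = "cone_diam \<delta> CARD('p) C (T ` C)"
  have sec: "is_section ((step ^^ Suc n) s)" "is_section ((step ^^ Suc n) s')"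
    using s s' is_section_iterate by blast+
  \<comment> \<open>The coefficient contracts finite distances only, so finiteness has to be
    re-established at each step.\<close>
  have "ennreal \<eta> ^ n * ?D < \<infinity>" using diam by (simp add: ennreal_mult_less_top power_less_top_ennreal)
  then have "cone_dist \<delta> C ?V ?W \<noteq> \<infinity>" using Suc by auto
  moreover have "subspace_of_dim CARD('p) ?V" "subspace_of_dim CARD('p) ?W" "?V \<subseteq> C" "?W \<subseteq> C"
    using sec subspace_of_dim_section section_in_cone by blast+
  ultimately have "cone_dist \<delta> C (T ` ?V) (T ` ?W) \<le> ennreal \<eta> * cone_dist \<delta> C ?V ?W"
    using \<eta> unfolding contraction_coefficient_def by blast
  also have "\<dots> \<le> ennreal \<eta> * (ennreal \<eta> ^ n * ?D)"
    by (intro mult_left_mono Suc) simp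
  finally show ?case
    unfolding range_step[OF sec(1), symmetric] range_step[OF sec(2), symmetric]
    by (simp add: mult.assoc)
qed

text \<open>Two sections evaluated at the same \<open>b\<close> have the same projection, so the
  cone distance of their ranges bounds the norm of the difference of their values.\<close>

lemma iterate_contraction:
  assumes \<delta>: "\<delta> = hyperbolic_gauge \<or> \<delta> = log_gauge"
    and \<eta>: "contraction_coefficient \<delta> CARD('p) C T \<eta>"
    and diam: "cone_diam \<delta> CARD('p) C (T ` C) < \<infinity>"
    and q: "0 < q" "\<eta> \<le> q"
  obtains c where "c \<ge> 0"
    "\<And>s s' n b. is_section s \<Longrightarrow> is_section s' \<Longrightarrow>
      norm ((step ^^ n) s b - (step ^^ n) s' b) \<le> c * q ^ n * norm b"
proof -
  define D where "D = enn2real (cone_diam \<delta> CARD('p) C (T ` C))"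
  have D: "cone_diam \<delta> CARD('p) C (T ` C) = ennreal D" "D \<ge> 0"
    using diam by (auto simp: D_def)
  have \<eta>01: "0 \<le> \<eta>" "\<eta> < 1" using \<eta> by (auto simp: contraction_coefficient_def)
  \<comment> \<open>The summand \<open>2 * k\<close> serves \<open>n = 0\<close>, before any
    contraction; the division by \<open>q\<close> makes up for the first step, which only enters the
    image of the cone.\<close>
  define c where "c = 2 * k + 4 * k * D * exp D / q"
  show ?thesis
  proof
    show "c \<ge> 0" using k_pos D q by (simp add: c_def)
    fix s s' n b
    assume s: "is_section s" and s': "is_section s'"
    show "norm ((step ^^ n) s b - (step ^^ n) s' b) \<le> c * q ^ n * norm b"
    proof (cases n)
      case 0
      have "norm (s b - s' b) \<le> 2 * k * norm b"
        using norm_triangle_ineq4[of "s b" "s' b"] norm_section_le[OF s, of b] norm_section_le[OF s', of b] by simp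
      also have "\<dots> \<le> c * norm b" using k_pos D q by (intro mult_right_mono) (auto simp: c_def)
      finally show ?thesis by (simp add: 0)
    next
      case (Suc l)
      let ?t = "(step ^^ n) s" and ?t' = "(step ^^ n) s'"
      have t: "is_section ?t" "is_section ?t'" using s s' is_section_iterate by blast+
      show ?thesis
      proof (cases "b = 0")
        case True
        then show ?thesis using norm_section_le[OF t(1), of 0] norm_section_le[OF t(2), of 0] by simp
      next
        case False
        define d where "d = \<eta> ^ l * D"
        have d: "0 \<le> d" "d \<le> D" using D \<eta>01 by (auto simp: d_def mult_left_le_one_le power_le_one)
        have "vec_dist \<delta> C (?t b) (?t' b) \<le> cone_dist \<delta> C (range ?t) (range ?t')"
          unfolding cone_dist_def
          by (rule Sup_upper) (use section_zero[OF t(1), of b] section_zero[OF t(2), of b] False in blast)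
        also have "\<dots> \<le> ennreal d"
          using cone_dist_iterate_le[OF \<eta> diam s s', of l] \<eta>01 D
          by (simp only: Suc D d_def ennreal_power ennreal_mult zero_le_power)
        finally have "norm (?t b - ?t' b) \<le> 4 * k * d * exp d * norm (m (?t b))"
          using t False d k_pos
          by (intro vec_dist_separates[OF \<delta> m.linear_axioms aperture]) (auto simp: m_section section_in_cone)
        also have "\<dots> \<le> 4 * k * (q ^ l * D) * exp D * norm b"
          using d k_pos D q \<eta>01 unfolding m_section[OF t(1)] d_def
          by (intro mult_right_mono mult_mono mult_left_mono power_mono) auto
        also have "\<dots> = (4 * k * D * exp D / q) * q ^ n * norm b" using q by (simp add: Suc)
        also have "\<dots> \<le> c * q ^ n * norm b"
          using k_pos q by (intro mult_right_mono) (auto simp: c_def)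
        finally show ?thesis .
      qed
    qed
  qed
qed

end

section \<open>The invariant section and growth of determinants\<close>

lemma geometric_increments_converge:
  fixes f :: "nat \<Rightarrow> 'b::banach"
  assumes q: "0 < q" "q < 1" and c: "c \<ge> 0"
    and inc: "\<And>n. norm (f (Suc n) - f n) \<le> c * q ^ n"
  obtains L where "f \<longlonglongrightarrow> L" "\<And>n. norm (f n - L) \<le> c / (1 - q) * q ^ n"
proof -
  \<comment> \<open>The factor \<open>1 - q ^ j\<close> gives the exact partial geometric sum, which
    lets the induction close.\<close>
  have le: "norm (f (n + j) - f n) \<le> c / (1 - q) * q ^ n * (1 - q ^ j)" for n j
  proof (induction j)
    case (Suc j)
    have "norm (f (n + Suc j) - f n) \<le> norm (f (Suc (n + j)) - f (n + j)) + norm (f (n + j) - f n)"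
      by (metis add_Suc_right norm_diff_triangle_ineq norm_triangle_ineq diff_add_cancel add_diff_eq)
    also have "\<dots> \<le> c * q ^ (n + j) + c / (1 - q) * q ^ n * (1 - q ^ j)"
      by (intro add_mono inc Suc)
    also have "\<dots> = c / (1 - q) * q ^ n * (1 - q ^ Suc j)"
      using q by (simp add: field_simps power_add)
    finally show ?case .
  qed simp
  have le': "norm (f (n + j) - f n) \<le> c / (1 - q) * q ^ n" for n j
  proof -
    have "c / (1 - q) * q ^ n * (1 - q ^ j) \<le> c / (1 - q) * q ^ n * 1"
      using q c by (intro mult_left_mono) auto
    then show ?thesis using le[of n j] by simp
  qed
  have lim: "(\<lambda>n. c / (1 - q) * q ^ n) \<longlonglongrightarrow> c / (1 - q) * 0"
    using q by (intro tendsto_intros LIMSEQ_realpow_zero) auto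
  have "Cauchy f"
  proof (rule metric_CauchyI)
    fix e :: real assume e: "e > 0"
    then have "\<forall>\<^sub>F n in sequentially. c / (1 - q) * q ^ n < e / 2"
      using order_tendstoD(2)[OF lim, of "e / 2"] by simp
    then obtain N where N: "c / (1 - q) * q ^ N < e / 2" by (auto simp: eventually_sequentially)
    have "dist (f n) (f N) < e / 2" if "n \<ge> N" for n
    proof -
      have "norm (f n - f N) \<le> c / (1 - q) * q ^ N" using le'[of N "n - N"] that by simp
      then show ?thesis unfolding dist_norm using N by linarith
    qed
    then show "\<exists>N. \<forall>i\<ge>N. \<forall>n\<ge>N. dist (f i) (f n) < e"
      using dist_triangle_half_r[of "f N" _ e] by (metis dist_commute)
  qed
  then obtain L where L: "f \<longlonglongrightarrow> L" using Cauchy_convergent_iff convergent_def by blast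
  show ?thesis
  proof
    fix n
    have "(\<lambda>j. norm (f n - f (j + n))) \<longlonglongrightarrow> norm (f n - L)"
      by (intro tendsto_intros LIMSEQ_ignore_initial_segment L)
    then show "norm (f n - L) \<le> c / (1 - q) * q ^ n"
      by (rule LIMSEQ_le_const2) (use le'[of n] in \<open>auto simp: norm_minus_commute add.commute\<close>)
  qed (rule L)
qed

lemma scaleC_bounded: "bounded_linear (\<lambda>x :: 'a::complex_banach. r *\<^sub>C x)"
  by (rule bounded_linear_intro[of _ "cmod r"])
    (simp_all add: scaleC_add_right norm_scaleC scaleC_scaleC mult.commute flip: scaleC_of_real)

lemma alternating_compose:
  assumes "alternating_multilinear \<Phi>" and "Vector_Spaces.linear scaleC scaleC S"
  shows "alternating_multilinear (\<lambda>x. \<Phi> (\<lambda>j. S (x j)))"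
proof -
  interpret S: Vector_Spaces.linear scaleC scaleC S by (rule assms)
  have upd: "(\<lambda>j. S ((x(i := u)) j)) = (\<lambda>j. S (x j))(i := S u)" for x i u by auto
  show ?thesis
    using assms(1) unfolding alternating_multilinear_def upd S.add S.scale by simp
qed

text \<open>The gauge enters only through \<open>contraction\<close>, the exterior norm only through
  \<open>decomposition\<close>. The rate \<open>q\<close> is a parameter because the final limit
  needs a whole range of rates.\<close>

locale contracting_cone = invariant_cone C m T k
  for C :: "'a::complex_banach set" and m :: "'a \<Rightarrow> complex ^ 'p::finite" and T k +
  fixes q c A :: real and s0 :: "complex ^ 'p \<Rightarrow> 'a"
  assumes q: "0 < q" "q < 1" and c: "c \<ge> 0" and A: "A \<ge> 0"
    and contraction: "is_section s \<Longrightarrow> is_section s' \<Longrightarrow>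
      norm ((step ^^ n) s b - (step ^^ n) s' b) \<le> c * q ^ n * norm b"
    and s0: "is_section s0"
    and decomposition: "\<exists>(l::nat) y. (\<forall>i<l. cspan (range (y i)) \<subseteq> C) \<and>
      wedge x = (\<Sum>i<l. wedge (y i)) \<and>
      (\<Sum>i<l. cmod (det (\<chi> j. m (y i j)))) \<le> A * (\<Prod>j\<in>UNIV. norm (x j))"
begin

text \<open>Applying the contraction to \<open>step s0\<close> and \<open>s0\<close> makes the
  increments of the orbit of \<open>s0\<close> geometric. The pointwise limit is linear, and it
  takes values in \<open>C\<close> because \<open>C\<close> is closed.\<close>

lemma fixed_section_exists: "\<exists>\<sigma>. is_section \<sigma> \<and> step \<sigma> = \<sigma>"
proof -
  let ?s = "\<lambda>n. (step ^^ n) s0"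
  have sec: "is_section (?s n)" for n by (rule is_section_iterate[OF s0])
  have "\<exists>L. (\<lambda>n. ?s n b) \<longlonglongrightarrow> L" for b
  proof -
    have "norm (?s (Suc n) b - ?s n b) \<le> (c * norm b) * q ^ n" for n
      using contraction[OF is_section_step[OF s0] s0, of n b]
      by (simp add: funpow_Suc_right mult_ac del: funpow.simps)
    then show ?thesis
      using geometric_increments_converge[OF q, of "c * norm b" "\<lambda>n. ?s n b"] c by (metis mult_nonneg_nonneg norm_ge_zero)
  qed
  then obtain \<sigma> where \<sigma>: "\<And>b. (\<lambda>n. ?s n b) \<longlonglongrightarrow> \<sigma> b" by metis
  have lin_n: "?s n (a + b) = ?s n a + ?s n b" "?s n (r *s b) = r *\<^sub>C ?s n b" for n a b r
    using section_linear[OF sec] by (auto simp: Vector_Spaces.linear_iff)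
  have "\<sigma> (a + b) = \<sigma> a + \<sigma> b" for a b
    using LIMSEQ_unique[OF \<sigma>[of "a + b"]] tendsto_add[OF \<sigma>[of a] \<sigma>[of b]] by (simp add: lin_n)
  moreover have "\<sigma> (r *s b) = r *\<^sub>C \<sigma> b" for r b
    using LIMSEQ_unique[OF \<sigma>[of "r *s b"]] bounded_linear.tendsto[OF scaleC_bounded \<sigma>[of b], of r] by (simp add: lin_n)
  ultimately have "Vector_Spaces.linear (*s) scaleC \<sigma>"
    by (auto simp: Vector_Spaces.linear_iff vec.vector_space_axioms complex_vector.vector_space_axioms)
  moreover have m_lim: "(\<lambda>n. m (?s n b)) \<longlonglongrightarrow> m (\<sigma> b)" for b
    by (rule bounded_linear.tendsto[OF m_bounded \<sigma>])
  then have "m (\<sigma> b) = b" for b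
    using LIMSEQ_unique[OF m_lim[of b]] by (simp add: m_section[OF sec])
  moreover have "\<sigma> b \<in> C" for b
    by (rule closed_sequentially[OF closed_C _ \<sigma>]) (rule section_in_cone[OF sec])
  ultimately have sec\<sigma>: "is_section \<sigma>" by (simp add: is_section_def)
  \<comment> \<open>The image of the n-th section at \<open>b\<close> is the next section at
    \<open>push (?s n) b\<close>, so section and argument both vary. The bound \<open>k\<close>,
    common to all sections, lets the two limits be taken separately.\<close>
  have T\<sigma>: "T (\<sigma> b) = \<sigma> (push \<sigma> b)" for b
  proof -
    let ?a = "\<lambda>n. push (?s n) b"
    have "?a \<longlonglongrightarrow> push \<sigma> b"
      unfolding push_def
      by (intro bounded_linear.tendsto[OF m_bounded] bounded_linear.tendsto[OF T_bounded] \<sigma>)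
    then have "(\<lambda>n. k * norm (?a n - push \<sigma> b)) \<longlonglongrightarrow> k * norm (push \<sigma> b - push \<sigma> b)"
      by (intro tendsto_intros)
    then have "(\<lambda>n. k * norm (?a n - push \<sigma> b)) \<longlonglongrightarrow> 0" by simp
    then have "(\<lambda>n. ?s (Suc n) (?a n - push \<sigma> b)) \<longlonglongrightarrow> 0"
      by (rule Lim_null_comparison[rotated]) (intro always_eventually allI norm_section_le[OF sec])
    then have "(\<lambda>n. ?s (Suc n) (?a n - push \<sigma> b) + ?s (Suc n) (push \<sigma> b)) \<longlonglongrightarrow> 0 + \<sigma> (push \<sigma> b)"
      by (intro tendsto_add LIMSEQ_Suc \<sigma>)
    moreover have "?s (Suc n) (?a n - push \<sigma> b) + ?s (Suc n) (push \<sigma> b) = T (?s n b)" for n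
      using lin_n(1)[of "Suc n" "?a n - push \<sigma> b" "push \<sigma> b"] step_push[OF sec, of n b] by simp
    moreover have "(\<lambda>n. T (?s n b)) \<longlonglongrightarrow> T (\<sigma> b)"
      by (rule bounded_linear.tendsto[OF T_bounded \<sigma>])
    ultimately show ?thesis using LIMSEQ_unique by force
  qed
  have "step \<sigma> b = \<sigma> b" for b
    unfolding step_def T\<sigma> inv_push(2)[OF sec\<sigma>] ..
  then show ?thesis using sec\<sigma> by blast
qed

text \<open>The choice involves \<open>C\<close>, \<open>m\<close> and \<open>T\<close> but not the
  rate \<open>q\<close>, so one and the same subspace serves for all rates.\<close>

definition \<sigma> :: "complex ^ 'p \<Rightarrow> 'a"
  where "\<sigma> = (SOME s. is_section s \<and> step s = s)"

lemma is_section_\<sigma>: "is_section \<sigma>" and step_\<sigma>: "step \<sigma> = \<sigma>"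
  using someI_ex[OF fixed_section_exists] by (simp_all add: \<sigma>_def)

lemma iterate_\<sigma>: "(step ^^ n) \<sigma> = \<sigma>"
  by (induction n) (simp_all add: step_\<sigma>)

abbreviation M :: "complex ^ 'p \<Rightarrow> complex ^ 'p"
  where "M \<equiv> push \<sigma>"

definition \<Lambda> :: complex
  where "\<Lambda> = endo_det M"

lemma T_\<sigma>: "T (\<sigma> b) = \<sigma> (M b)"
  using step_push[OF is_section_\<sigma>] by (simp add: step_\<sigma>)

lemma \<Lambda>_nonzero: "\<Lambda> \<noteq> 0"
  unfolding \<Lambda>_def by (rule endo_det_nonzero[OF push_linear push_zero]) (rule is_section_\<sigma>)+

lemma norm_axis_le: "norm (axis j 1 :: complex ^ 'p) \<le> 1"
proof -
  have "norm (axis j 1 :: complex ^ 'p) \<le> (\<Sum>i\<in>UNIV. if i = j then 1 else 0)"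
    by (rule order_trans[OF norm_le_sum_components]) (intro sum_mono, auto simp: axis_def)
  then show ?thesis by simp
qed

text \<open>The matrices of \<open>push\<close> have entries bounded uniformly over all sections and
  approach that of \<open>M\<close> at the rate \<open>q ^ n\<close>; determinants are Lipschitz on
  bounded sets of matrices.\<close>

lemma endo_det_push:
  obtains c1 where "c1 \<ge> 0" "\<And>s n. is_section s \<Longrightarrow> cmod (endo_det (push ((step ^^ n) s)) - \<Lambda>) \<le> c1 * q ^ n"
proof -
  define g where "g = onorm m * onorm T"
  have g: "g \<ge> 0" using m_bounded T_bounded by (simp add: g_def onorm_pos_le)
  have gle: "norm (m (T u)) \<le> g * norm u" for u
  proof -
    have "norm (m (T u)) \<le> onorm m * norm (T u)" by (rule onorm[OF m_bounded])
    also have "\<dots> \<le> onorm m * (onorm T * norm u)"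
      by (intro mult_left_mono onorm[OF T_bounded] onorm_pos_le[OF m_bounded])
    finally show ?thesis by (simp add: g_def mult.assoc)
  qed
  \<comment> \<open>The 1 keeps \<open>R\<close> positive even if \<open>g = 0\<close>.\<close>
  define R where "R = g * k + 1"
  have R: "R > 0" using g k_pos by (simp add: R_def add_nonneg_pos)
  have entry: "cmod (push s (axis i 1) $ j) \<le> R" if "is_section s" for s i j
  proof -
    have "cmod (push s (axis i 1) $ j) \<le> g * norm (s (axis i 1))"
      unfolding push_def by (rule order_trans[OF Finite_Cartesian_Product.norm_nth_le gle])
    also have "\<dots> \<le> g * (k * 1)"
      using order_trans[OF norm_section_le[OF that, of "axis i 1"]] k_pos norm_axis_le[of i]
      by (intro mult_left_mono g) simp
    finally show ?thesis by (simp add: R_def)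
  qed
  have diff: "cmod (push ((step ^^ n) s) (axis i 1) $ j - M (axis i 1) $ j) \<le> g * c * q ^ n"
    if "is_section s" for s n i j
  proof -
    let ?u = "(step ^^ n) s (axis i 1) - \<sigma> (axis i 1)"
    have "cmod (push ((step ^^ n) s) (axis i 1) $ j - M (axis i 1) $ j) = cmod (m (T ?u) $ j)"
      by (simp add: push_def T.diff m.diff)
    also have "\<dots> \<le> g * norm ?u" by (rule order_trans[OF Finite_Cartesian_Product.norm_nth_le gle])
    also have "norm ?u \<le> c * q ^ n * norm (axis i 1 :: complex ^ 'p)"
      using contraction[OF that is_section_\<sigma>, of n "axis i 1"] by (simp add: iterate_\<sigma>)
    also have "\<dots> \<le> c * q ^ n * 1" using c q by (intro mult_left_mono norm_axis_le) simp
    finally show ?thesis using g by (simp add: mult_left_mono mult.assoc)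
  qed
  show ?thesis
  proof
    let ?c = "fact CARD('p) * (R ^ CARD('p) * (CARD('p) * (g * c / R)))"
    show "?c \<ge> 0" using R g c by simp
    fix s n assume s: "is_section s"
    have "cmod (endo_det (push ((step ^^ n) s)) - \<Lambda>)
        \<le> fact CARD('p) * (R ^ CARD('p) * (CARD('p) * (g * c * q ^ n / R)))"
      unfolding endo_det_def \<Lambda>_def
      by (rule cmod_det_diff_le[OF R])
        (use entry[OF is_section_iterate[OF s]] entry[OF is_section_\<sigma>] diff[OF s] in auto)
    then show "cmod (endo_det (push ((step ^^ n) s)) - \<Lambda>) \<le> ?c * q ^ n"
      by (simp add: mult_ac)
  qed
qed

section \<open>Normalised volumes of transported families\<close>

definition growth :: "nat \<Rightarrow> (complex ^ 'p \<Rightarrow> 'a) \<Rightarrow> complex"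
  where "growth n s = endo_det (transition n s) / \<Lambda> ^ n"

text \<open>Each value is the previous one times
  \<open>endo_det (push ((step ^^ n) s)) / \<Lambda>\<close>, which is 1 up to a term of order
  \<open>q ^ n\<close>. The product of the factors \<open>1 + d * q ^ i\<close> is at most
  \<open>exp (d / (1 - q))\<close>, uniformly in \<open>s\<close>.\<close>

lemma growth_bounds:
  obtains U c2 where "U \<ge> 0" "c2 \<ge> 0" "\<And>s n. is_section s \<Longrightarrow> cmod (growth n s) \<le> U"
    "\<And>s n. is_section s \<Longrightarrow> cmod (growth (Suc n) s - growth n s) \<le> c2 * q ^ n"
proof -
  obtain c1 where c1: "c1 \<ge> 0"
    and push_le: "\<And>s n. is_section s \<Longrightarrow> cmod (endo_det (push ((step ^^ n) s)) - \<Lambda>) \<le> c1 * q ^ n"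
    using endo_det_push by blast
  define d where "d = c1 / cmod \<Lambda>"
  have d: "d \<ge> 0" using c1 by (simp add: d_def)
  have inc: "cmod (growth (Suc n) s - growth n s) \<le> d * q ^ n * cmod (growth n s)" if s: "is_section s" for s n
  proof -
    have "endo_det (transition (Suc n) s) = endo_det (push ((step ^^ n) s)) * endo_det (transition n s)"
      unfolding transition_Suc[OF s, abs_def]
      by (rule endo_det_compose[OF push_linear[OF is_section_iterate[OF s]]])
    then have "growth (Suc n) s - growth n s = (endo_det (push ((step ^^ n) s)) - \<Lambda>) / \<Lambda> * growth n s"
      using \<Lambda>_nonzero by (simp add: growth_def field_simps)
    then have "cmod (growth (Suc n) s - growth n s)
        = cmod (endo_det (push ((step ^^ n) s)) - \<Lambda>) / cmod \<Lambda> * cmod (growth n s)"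
      by (simp add: norm_mult norm_divide)
    also have "\<dots> \<le> c1 * q ^ n / cmod \<Lambda> * cmod (growth n s)"
      by (intro mult_right_mono divide_right_mono push_le s) auto
    finally show ?thesis by (simp add: d_def)
  qed
  have bound: "cmod (growth n s) \<le> exp (d / (1 - q))" if s: "is_section s" for s n
  proof -
    have "cmod (growth n s) \<le> exp (d * (\<Sum>i<n. q ^ i))"
    proof (induction n)
      case 0
      then show ?case by (simp add: growth_def transition_zero[OF s, abs_def] endo_det_id)
    next
      case (Suc n)
      have "cmod (growth (Suc n) s) \<le> (1 + d * q ^ n) * cmod (growth n s)"
        using inc[OF s, of n] norm_triangle_sub[of "growth (Suc n) s" "growth n s"]
        by (simp add: algebra_simps)
      also have "\<dots> \<le> exp (d * q ^ n) * exp (d * (\<Sum>i<n. q ^ i))"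
        using d q by (intro mult_mono Suc exp_ge_add_one_self) auto
      finally show ?case by (simp add: exp_add[symmetric] algebra_simps)
    qed
    also have "(\<Sum>i<n. q ^ i) \<le> 1 / (1 - q)"
      using q sum_le_suminf[OF summable_geometric[of q], of "{..<n}"] by (simp add: suminf_geometric)
    then have "exp (d * (\<Sum>i<n. q ^ i)) \<le> exp (d / (1 - q))"
      using mult_left_mono[OF _ d] by fastforce
    finally show ?thesis .
  qed
  show ?thesis
  proof
    show "0 \<le> exp (d / (1 - q))" "0 \<le> d * exp (d / (1 - q))" using d by auto
    fix s n assume s: "is_section s"
    show "cmod (growth n s) \<le> exp (d / (1 - q))" by (rule bound[OF s])
    have "d * q ^ n * cmod (growth n s) \<le> d * q ^ n * exp (d / (1 - q))"
      using d q by (intro mult_left_mono bound[OF s]) auto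
    then show "cmod (growth (Suc n) s - growth n s) \<le> d * exp (d / (1 - q)) * q ^ n"
      using inc[OF s, of n] by (simp add: mult_ac)
  qed
qed

lemma T_iterate_linear: "Vector_Spaces.linear scaleC scaleC (T ^^ n)"
  unfolding Vector_Spaces.linear_iff
  by (induction n) (auto simp: T.add T.scale complex_vector.vector_space_axioms)

definition rel_volume :: "nat \<Rightarrow> ('p \<Rightarrow> 'a) \<Rightarrow> complex"
  where "rel_volume n x = det (\<chi> j. m ((T ^^ n) (x j))) / \<Lambda> ^ n"

text \<open>If \<open>x\<close> lies on the range of a section, this is the determinant of the
  projections after \<open>n\<close> steps times the difference at \<open>b\<close> between the
  transported section and \<open>\<sigma>\<close>. The determinant as a weight keeps it alternating
  in \<open>x\<close>.\<close>

definition defect :: "nat \<Rightarrow> complex ^ 'p \<Rightarrow> ('p \<Rightarrow> 'a) \<Rightarrow> 'a"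
  where "defect n b x = cramer_combination m b (\<lambda>j. (T ^^ n) (x j))
    - det (\<chi> j. m ((T ^^ n) (x j))) *\<^sub>C \<sigma> b"

lemma alternating_det_iterate: "alternating_multilinear (\<lambda>x. det (\<chi> j. m ((T ^^ n) (x j))))"
  using alternating_compose[OF alternating_det[OF m.linear_axioms] T_iterate_linear] .

lemma alternating_cramer_iterate:
  "alternating_multilinear (\<lambda>x. cramer_combination m b (\<lambda>j. (T ^^ n) (x j)))"
  using alternating_compose[OF alternating_cramer_combination[OF m.linear_axioms] T_iterate_linear] .

text \<open>A relation among the projections yields a vector of the span with projection 0; by the
  aperture this vector is 0, so the family itself is dependent.\<close>

lemma alternating_vanishes:
  assumes \<Phi>: "alternating_multilinear \<Phi>" and y: "cspan (range y) \<subseteq> C" and d: "det (\<chi> j. m (y j)) = 0"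
  shows "\<Phi> y = 0"
proof -
  obtain e l where el: "e l \<noteq> 0" "(\<Sum>j\<in>UNIV. e j *s m (y j)) = 0"
    using det_rows_zero_dependent[OF d] by blast
  let ?u = "\<Sum>j\<in>UNIV. e j *\<^sub>C y j"
  have "?u \<in> cspan (range y)"
    by (intro complex_vector.span_sum complex_vector.span_scale complex_vector.span_base) simp
  moreover have "m ?u = 0" by (simp add: m.sum m.scale el(2))
  ultimately have "?u = 0" using y aperture[of ?u] by auto
  then show ?thesis by (rule alternating_dependent[where c = e and l = l, OF \<Phi> el(1)])
qed

lemma family_section:
  assumes y: "cspan (range y) \<subseteq> C" and d: "det (\<chi> j. m (y j)) \<noteq> 0"
  obtains s where "is_section s" "\<And>j. s (m (y j)) = y j"
  using section_of_family[OF m.linear_axioms d] y by (metis is_section_def subsetD)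

text \<open>On the range of a section, the projection of \<open>T ^^ n\<close> is one endomorphism
  of the coordinates, so its determinant splits off.\<close>

lemma family_volume:
  assumes s: "is_section s" and y: "\<And>j. s (m (y j)) = y j"
  shows "rel_volume n y = det (\<chi> j. m (y j)) * growth n s"
proof -
  interpret s: Vector_Spaces.linear "(*s)" scaleC s by (rule section_linear[OF s])
  interpret Tn: Vector_Spaces.linear scaleC scaleC "T ^^ n" by (rule T_iterate_linear)
  have lin: "Vector_Spaces.linear (*s) (*s) (transition n s)"
    unfolding Vector_Spaces.linear_iff transition_def
    by (auto simp: s.add s.scale Tn.add Tn.scale m.add m.scale vec.vector_space_axioms)
  have "m ((T ^^ n) (y j)) = transition n s (m (y j))" for j
    by (simp add: transition_def y)
  then have "det (\<chi> j. m ((T ^^ n) (y j))) = det (\<chi> j. m (y j)) * endo_det (transition n s)"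
    by (simp only: det_endo_rows[OF lin])
  then show ?thesis by (simp add: rel_volume_def growth_def)
qed

text \<open>After \<open>n\<close> steps the family lies on the range of
  \<open>(step ^^ n) s\<close>, where Cramer's rule returns that section. As \<open>step\<close>
  fixes \<open>\<sigma>\<close>, the contraction compares the two.\<close>

lemma family_defect:
  assumes s: "is_section s" and y: "\<And>j. s (m (y j)) = y j"
  shows "norm (defect n b y) \<le> cmod (rel_volume n y) * cmod \<Lambda> ^ n * (c * q ^ n * norm b)"
proof -
  let ?t = "(step ^^ n) s" and ?z = "\<lambda>j. (T ^^ n) (y j)"
  have t: "is_section ?t" by (rule is_section_iterate[OF s])
  have "?z j = ?t (transition n s (m (y j)))" for j
    by (simp add: iterate_transition[OF s] y)
  then have "?z j = ?t (m (?z j))" for j using m_section[OF t] by metis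
  then have "cramer_combination m b ?z = det (\<chi> j. m (?z j)) *\<^sub>C ?t b"
    by (rule cramer_combination_section[OF m.linear_axioms section_linear[OF t]])
  then have "defect n b y = (rel_volume n y * \<Lambda> ^ n) *\<^sub>C (?t b - \<sigma> b)"
    using \<Lambda>_nonzero by (simp add: defect_def rel_volume_def complex_vector.scale_right_diff_distrib)
  then have "norm (defect n b y) = cmod (rel_volume n y) * cmod \<Lambda> ^ n * norm (?t b - \<sigma> b)"
    by (simp add: norm_scaleC norm_mult norm_power)
  also have "norm (?t b - \<sigma> b) \<le> c * q ^ n * norm b"
    using contraction[OF s is_section_\<sigma>, of n b] by (simp add: iterate_\<sigma>)
  finally show ?thesis by (simp add: mult_left_mono)
qed

text \<open>The factor \<open>cmod (det (\<chi> j. m (y j)))\<close> is there because the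
  decomposition controls the sum of exactly these numbers. A family with zero determinant determines
  no section, but both quantities vanish on it.\<close>

lemma cone_family_bounds:
  obtains c3 c4 where "c3 \<ge> 0" "c4 \<ge> 0"
    "\<And>y n. cspan (range y) \<subseteq> C \<Longrightarrow>
      cmod (rel_volume (Suc n) y - rel_volume n y) \<le> c3 * q ^ n * cmod (det (\<chi> j. m (y j)))"
    "\<And>y n b. cspan (range y) \<subseteq> C \<Longrightarrow>
      norm (defect n b y) \<le> c4 * cmod \<Lambda> ^ n * q ^ n * norm b * cmod (det (\<chi> j. m (y j)))"
proof -
  obtain U c2 where U: "U \<ge> 0" "c2 \<ge> 0" "\<And>s n. is_section s \<Longrightarrow> cmod (growth n s) \<le> U"
    "\<And>s n. is_section s \<Longrightarrow> cmod (growth (Suc n) s - growth n s) \<le> c2 * q ^ n"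
    using growth_bounds by blast
  show ?thesis
  proof
    show "c2 \<ge> 0" "U * c \<ge> 0" using U c by auto
    fix y :: "'p \<Rightarrow> 'a" and n b
    assume y: "cspan (range y) \<subseteq> C"
    let ?d = "det (\<chi> j. m (y j))"
    have "cmod (rel_volume (Suc n) y - rel_volume n y) \<le> c2 * q ^ n * cmod ?d \<and>
      norm (defect n b y) \<le> U * c * cmod \<Lambda> ^ n * q ^ n * norm b * cmod ?d"
    proof (cases "?d = 0")
      case True
      have "det (\<chi> j. m ((T ^^ n) (y j))) = 0" for n
        by (rule alternating_vanishes[OF alternating_det_iterate y True])
      moreover have "cramer_combination m b (\<lambda>j. (T ^^ n) (y j)) = 0"
        by (rule alternating_vanishes[OF alternating_cramer_iterate y True])
      ultimately show ?thesis using U c q by (simp add: rel_volume_def defect_def del: funpow.simps)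
    next
      case False
      then obtain s where s: "is_section s" "\<And>j. s (m (y j)) = y j"
        using family_section[OF y] by metis
      have "cmod (rel_volume (Suc n) y - rel_volume n y) = cmod ?d * cmod (growth (Suc n) s - growth n s)"
        by (simp add: family_volume[OF s] norm_mult flip: right_diff_distrib)
      also have "\<dots> \<le> cmod ?d * (c2 * q ^ n)" by (intro mult_left_mono U s) auto
      finally have 1: "cmod (rel_volume (Suc n) y - rel_volume n y) \<le> c2 * q ^ n * cmod ?d"
        by (simp add: mult_ac)
      have "cmod (rel_volume n y) \<le> cmod ?d * U"
        unfolding family_volume[OF s] norm_mult by (intro mult_left_mono U s) auto
      then have "cmod (rel_volume n y) * cmod \<Lambda> ^ n * (c * q ^ n * norm b)
          \<le> cmod ?d * U * cmod \<Lambda> ^ n * (c * q ^ n * norm b)"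
        using c q by (intro mult_right_mono) auto
      then have "norm (defect n b y) \<le> U * c * cmod \<Lambda> ^ n * q ^ n * norm b * cmod ?d"
        using family_defect[where y = y, OF s, of n b] by (simp add: mult_ac)
      with 1 show ?thesis by blast
    qed
    then show "cmod (rel_volume (Suc n) y - rel_volume n y) \<le> c2 * q ^ n * cmod ?d"
      "norm (defect n b y) \<le> U * c * cmod \<Lambda> ^ n * q ^ n * norm b * cmod ?d"
      by blast+
  qed
qed

text \<open>Both quantities are alternating in the family, hence sums over the pieces of a
  decomposition. Here the estimates leave the cone.\<close>

lemma rel_volume_defect_bounds:
  obtains c5 where "c5 \<ge> 0"
    "\<And>x n. cmod (rel_volume (Suc n) x - rel_volume n x) \<le> c5 * q ^ n * (\<Prod>j\<in>UNIV. norm (x j))"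
    "\<And>x n b. norm (defect n b x) \<le> c5 * cmod \<Lambda> ^ n * q ^ n * norm b * (\<Prod>j\<in>UNIV. norm (x j))"
proof -
  obtain c3 c4 where c34: "c3 \<ge> 0" "c4 \<ge> 0"
    "\<And>y n. cspan (range y) \<subseteq> C \<Longrightarrow>
      cmod (rel_volume (Suc n) y - rel_volume n y) \<le> c3 * q ^ n * cmod (det (\<chi> j. m (y j)))"
    "\<And>y n b. cspan (range y) \<subseteq> C \<Longrightarrow>
      norm (defect n b y) \<le> c4 * cmod \<Lambda> ^ n * q ^ n * norm b * cmod (det (\<chi> j. m (y j)))"
    using cone_family_bounds by blast
  define c5 where "c5 = (c3 + c4) * A"
  show ?thesis
  proof
    show "c5 \<ge> 0" using c34 A by (simp add: c5_def)
    fix x :: "'p \<Rightarrow> 'a" and n b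
    obtain l :: nat and y where y: "\<And>i. i < l \<Longrightarrow> cspan (range (y i)) \<subseteq> C"
      and w: "wedge x = (\<Sum>i<l. wedge (y i))"
      and le: "(\<Sum>i<l. cmod (det (\<chi> j. m (y i j)))) \<le> A * (\<Prod>j\<in>UNIV. norm (x j))"
      using decomposition[of x] by blast
    let ?S = "\<Sum>i<l. cmod (det (\<chi> j. m (y i j)))" and ?N = "\<Prod>j\<in>UNIV. norm (x j)"
    have N: "?N \<ge> 0" by (intro prod_nonneg) auto
    have vol: "rel_volume n x = (\<Sum>i<l. rel_volume n (y i))" for n
      using alternating_wedge_sum[OF alternating_det_iterate w, of n] by (simp add: rel_volume_def sum_divide_distrib)
    have def: "defect n b x = (\<Sum>i<l. defect n b (y i))"
      using alternating_wedge_sum[OF alternating_det_iterate w, of n]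
        alternating_wedge_sum[OF alternating_cramer_iterate w, of b n]
      by (simp add: defect_def complex_vector.scale_sum_left sum_subtractf)
    have "cmod (rel_volume (Suc n) x - rel_volume n x) \<le> (\<Sum>i<l. c3 * q ^ n * cmod (det (\<chi> j. m (y i j))))"
      unfolding vol sum_subtractf[symmetric] by (rule sum_norm_le) (use c34 y in auto)
    also have "\<dots> = c3 * q ^ n * ?S" by (simp add: sum_distrib_left)
    also have "\<dots> \<le> (c3 + c4) * q ^ n * (A * ?N)"
      using le c34 q by (intro mult_mono) (auto intro: sum_nonneg)
    finally show "cmod (rel_volume (Suc n) x - rel_volume n x) \<le> c5 * q ^ n * ?N"
      by (simp add: c5_def mult_ac)
    have "norm (defect n b x) \<le> (\<Sum>i<l. c4 * cmod \<Lambda> ^ n * q ^ n * norm b * cmod (det (\<chi> j. m (y i j))))"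
      unfolding def by (rule sum_norm_le) (use c34 y in auto)
    also have "\<dots> = c4 * (cmod \<Lambda> ^ n * q ^ n * norm b) * ?S" by (simp add: sum_distrib_left mult_ac)
    also have "\<dots> \<le> (c3 + c4) * (cmod \<Lambda> ^ n * q ^ n * norm b) * (A * ?N)"
      using le c34 q by (intro mult_mono) (auto intro: sum_nonneg)
    finally show "norm (defect n b x) \<le> c5 * cmod \<Lambda> ^ n * q ^ n * norm b * ?N"
      by (simp add: c5_def mult_ac)
  qed
qed

end

section \<open>The invariant complement\<close>

lemma det_axis_update:
  fixes u :: "complex ^ 'p::finite"
  shows "det (\<chi> j. ((\<lambda>j. axis j 1)(i := u)) j) = u $ i"
proof -
  have "row j (mat 1 :: complex ^ 'p ^ 'p) = axis j 1" for j
    by (simp add: row_def mat_def axis_def vec_eq_iff)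
  then show ?thesis
    using cramer_lemma_transpose[of i u "mat 1"]
    by (simp add: basis_expansion fun_upd_def cong: if_cong)
qed

lemma scaleR_vec: "r *\<^sub>R v = complex_of_real r *s (v :: complex ^ 'p::finite)"
  by (simp only: vec_eq_iff vector_scaleR_component vector_smult_component) (simp add: scaleR_conv_of_real)

lemma funpow_left_inverse:
  fixes f g :: "'b \<Rightarrow> 'b"
  assumes "\<And>b. f (g b) = b"
  shows "(f ^^ n) ((g ^^ n) b) = b"
proof (induction n)
  case (Suc n)
  show ?case by (simp add: funpow_swap1[of f] assms Suc)
qed simp

context contracting_cone
begin

lemma M_linear: "Vector_Spaces.linear (*s) (*s) M"
  by (rule push_linear[OF is_section_\<sigma>])

lemma M_add: "M (a + b) = M a + M b" and M_scale: "M (r *s b) = r *s M b"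
  using M_linear by (simp_all add: Vector_Spaces.linear_iff)

lemma M_iterate_linear: "Vector_Spaces.linear (*s) (*s) (M ^^ n)"
  using M_linear unfolding Vector_Spaces.linear_iff by (induction n) auto

lemma endo_det_M_iterate: "endo_det (M ^^ n) = \<Lambda> ^ n"
proof (induction n)
  case 0
  then show ?case using endo_det_id by (simp add: id_def)
next
  case (Suc n)
  have "M ^^ Suc n = (\<lambda>b. M ((M ^^ n) b))" by auto
  then have "endo_det (M ^^ Suc n) = endo_det M * endo_det (M ^^ n)"
    using endo_det_compose[OF M_linear, of "M ^^ n"] by metis
  then show ?case by (simp only: Suc \<Lambda>_def power_Suc)
qed

lemma T_iterate_\<sigma>: "(T ^^ n) (\<sigma> b) = \<sigma> ((M ^^ n) b)"
  by (induction n) (simp_all add: T_\<sigma>)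

lemma inv_M: "M (inv M b) = b" "inv M (M b) = b"
  by (rule inv_push[OF is_section_\<sigma>])+

lemma inv_M_iterate: "(M ^^ n) ((inv M ^^ n) b) = b"
  by (rule funpow_left_inverse) (rule inv_M)

lemma iterate_inv_M: "(inv M ^^ n) ((M ^^ n) b) = b"
  by (rule funpow_left_inverse) (rule inv_M)

lemma inv_M_iterate_linear: "Vector_Spaces.linear (*s) (*s) (inv M ^^ n)"
  using inv_push(1)[OF is_section_\<sigma>] unfolding Vector_Spaces.linear_iff by (induction n) auto

section \<open>Coordinates along the invariant subspace and their limit\<close>

definition coord :: "nat \<Rightarrow> 'a \<Rightarrow> complex ^ 'p"
  where "coord n x = (inv M ^^ n) (m ((T ^^ n) x))"

lemma M_coord: "(M ^^ n) (coord n x) = m ((T ^^ n) x)"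
  by (simp add: coord_def inv_M_iterate)

lemma coord_add: "coord n (x + y) = coord n x + coord n y"
  and coord_scale: "coord n (r *\<^sub>C x) = r *s coord n x"
  and coord_\<sigma>: "coord n (\<sigma> b) = b"
proof -
  interpret Tn: Vector_Spaces.linear scaleC scaleC "T ^^ n" by (rule T_iterate_linear)
  interpret N: Vector_Spaces.linear "(*s)" "(*s)" "inv M ^^ n" by (rule inv_M_iterate_linear)
  show "coord n (x + y) = coord n x + coord n y" "coord n (r *\<^sub>C x) = r *s coord n x"
    by (simp_all add: coord_def Tn.add Tn.scale m.add m.scale N.add N.scale)
  show "coord n (\<sigma> b) = b"
    by (simp add: coord_def T_iterate_\<sigma> m_section[OF is_section_\<sigma>] iterate_inv_M)
qed

lemma coord_T: "coord n (T x) = M (coord (Suc n) x)"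
  by (simp add: coord_def inv_M funpow_swap1[of T])

definition test_family :: "'p \<Rightarrow> 'a \<Rightarrow> 'p \<Rightarrow> 'a"
  where "test_family i x = (\<lambda>j. \<sigma> (axis j 1))(i := x)"

text \<open>With every entry written as an image under \<open>M ^^ n\<close>, the determinant of
  \<open>M ^^ n\<close> factors out and leaves one coordinate of \<open>coord n x\<close>.\<close>

lemma m_test_family:
  "m ((T ^^ n) (test_family i x j)) = (M ^^ n) (((\<lambda>j. axis j 1)(i := coord n x)) j)"
  by (simp add: test_family_def T_iterate_\<sigma> m_section[OF is_section_\<sigma>] M_coord)

lemma det_test_family: "det (\<chi> j. m ((T ^^ n) (test_family i x j))) = coord n x $ i * \<Lambda> ^ n"
  by (simp only: m_test_family det_endo_rows[OF M_iterate_linear] det_axis_update endo_det_M_iterate)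

lemma rel_volume_test_family: "rel_volume n (test_family i x) = coord n x $ i"
  using \<Lambda>_nonzero by (simp add: rel_volume_def det_test_family)

lemma prod_test_family_le: "(\<Prod>j\<in>UNIV. norm (test_family i x j)) \<le> k ^ (CARD('p) - 1) * norm x"
proof -
  have "(\<Prod>j\<in>UNIV. norm (test_family i x j))
      = norm (test_family i x i) * (\<Prod>j\<in>UNIV - {i}. norm (test_family i x j))"
    by (rule prod.remove) auto
  also have "\<dots> = norm x * (\<Prod>j\<in>UNIV - {i}. norm (\<sigma> (axis j 1)))"
    by (simp add: test_family_def)
  also have "\<dots> \<le> norm x * (\<Prod>j\<in>UNIV - {i}. k)"
  proof (intro mult_left_mono prod_mono)
    fix j
    have "norm (\<sigma> (axis j 1)) \<le> k * norm (axis j 1 :: complex ^ 'p)"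
      by (rule norm_section_le[OF is_section_\<sigma>])
    also have "\<dots> \<le> k * 1" using k_pos by (intro mult_left_mono norm_axis_le) auto
    finally show "0 \<le> norm (\<sigma> (axis j 1)) \<and> norm (\<sigma> (axis j 1)) \<le> k" by simp
  qed simp
  finally show ?thesis by (simp add: mult.commute card_Diff_singleton)
qed

text \<open>The components of \<open>coord n x\<close> are normalised volumes of test families,
  whose increments are geometric.\<close>

lemma coord_converges:
  obtains c6 \<omega> where "c6 \<ge> 0" "\<And>x. (\<lambda>n. coord n x) \<longlonglongrightarrow> \<omega> x"
    "\<And>x n. norm (coord n x - \<omega> x) \<le> c6 * norm x"
proof -
  obtain c5 where c5: "c5 \<ge> 0"
    "\<And>x n. cmod (rel_volume (Suc n) x - rel_volume n x) \<le> c5 * q ^ n * (\<Prod>j\<in>UNIV. norm (x j))"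
    using rel_volume_defect_bounds by metis
  define e where "e = CARD('p) * (c5 * k ^ (CARD('p) - 1))"
  have e: "e \<ge> 0" using c5 k_pos by (simp add: e_def)
  have inc: "norm (coord (Suc n) x - coord n x) \<le> (e * norm x) * q ^ n" for n x
  proof -
    have "norm (coord (Suc n) x - coord n x) \<le> (\<Sum>i\<in>UNIV. cmod ((coord (Suc n) x - coord n x) $ i))"
      by (rule norm_le_sum_components)
    also have "\<dots> \<le> (\<Sum>i\<in>(UNIV :: 'p set). c5 * q ^ n * (k ^ (CARD('p) - 1) * norm x))"
    proof (rule sum_mono)
      fix i
      have "cmod ((coord (Suc n) x - coord n x) $ i)
          = cmod (rel_volume (Suc n) (test_family i x) - rel_volume n (test_family i x))"
        by (simp add: rel_volume_test_family)
      also have "\<dots> \<le> c5 * q ^ n * (\<Prod>j\<in>UNIV. norm (test_family i x j))" by (rule c5)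
      also have "\<dots> \<le> c5 * q ^ n * (k ^ (CARD('p) - 1) * norm x)"
        using c5 q by (intro mult_left_mono prod_test_family_le) auto
      finally show "cmod ((coord (Suc n) x - coord n x) $ i) \<le> c5 * q ^ n * (k ^ (CARD('p) - 1) * norm x)" .
    qed
    finally show ?thesis by (simp add: e_def mult_ac)
  qed
  have "\<exists>L. (\<lambda>n. coord n x) \<longlonglongrightarrow> L \<and> (\<forall>n. norm (coord n x - L) \<le> e * norm x / (1 - q) * q ^ n)" for x
    using geometric_increments_converge[OF q _ inc[of _ x]] e by (metis mult_nonneg_nonneg norm_ge_zero)
  then obtain \<omega> where \<omega>: "\<And>x. (\<lambda>n. coord n x) \<longlonglongrightarrow> \<omega> x"
    "\<And>x n. norm (coord n x - \<omega> x) \<le> e * norm x / (1 - q) * q ^ n" by metis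
  show ?thesis
  proof
    show "e / (1 - q) \<ge> 0" using e q by simp
    fix x :: 'a and n
    have "e * norm x / (1 - q) * q ^ n \<le> e * norm x / (1 - q) * 1"
      using e q by (intro mult_left_mono power_le_one) auto
    then show "norm (coord n x - \<omega> x) \<le> e / (1 - q) * norm x" using \<omega>(2)[of n x] by simp
  qed (rule \<omega>)
qed

definition \<omega> :: "'a \<Rightarrow> complex ^ 'p"
  where "\<omega> x = lim (\<lambda>n. coord n x)"

lemma coord_tendsto: "(\<lambda>n. coord n x) \<longlonglongrightarrow> \<omega> x"
  using coord_converges unfolding \<omega>_def by (metis limI)

text \<open>At \<open>n = 0\<close> the map \<open>coord\<close> is \<open>m\<close>, so
  \<open>\<omega>\<close> differs from a bounded map by a bounded amount.\<close>

lemma \<omega>_bounded: obtains c7 where "c7 \<ge> 0" "\<And>x. norm (\<omega> x) \<le> c7 * norm x"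
proof -
  obtain c6 L where c6: "c6 \<ge> 0" and L: "\<And>x. (\<lambda>n. coord n x) \<longlonglongrightarrow> L x"
    "\<And>x n. norm (coord n x - L x) \<le> c6 * norm x"
    using coord_converges by blast
  have "L x = \<omega> x" for x by (rule LIMSEQ_unique[OF L(1) coord_tendsto])
  then have le: "norm (m x - \<omega> x) \<le> c6 * norm x" for x using L(2)[of 0 x] by (simp add: coord_def)
  have "norm (\<omega> x) \<le> (onorm m + c6) * norm x" for x
  proof -
    have "norm (\<omega> x) \<le> norm (m x) + norm (m x - \<omega> x)"
      using norm_triangle_ineq4[of "m x" "m x - \<omega> x"] by simp
    then show ?thesis
      using onorm[OF m_bounded, of x] le[of x] unfolding distrib_right by linarith
  qed
  moreover have "onorm m + c6 \<ge> 0" using c6 onorm_pos_le[OF m_bounded] by simp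
  ultimately show ?thesis using that by blast
qed

lemma \<omega>_add: "\<omega> (x + y) = \<omega> x + \<omega> y"
  using LIMSEQ_unique[OF coord_tendsto[of "x + y"]] tendsto_add[OF coord_tendsto[of x] coord_tendsto[of y]]
  by (simp add: coord_add)

lemma vec_scale_bounded: "bounded_linear (\<lambda>v :: complex ^ 'p. r *s v)"
  by (rule bounded_linear_intro[of _ "cmod r"])
    (simp_all add: vec_eq_iff norm_vec_scale algebra_simps)

lemma \<omega>_scale: "\<omega> (r *\<^sub>C x) = r *s \<omega> x"
  using LIMSEQ_unique[OF coord_tendsto[of "r *\<^sub>C x"]]
    bounded_linear.tendsto[OF vec_scale_bounded coord_tendsto[of x], of r]
  by (simp add: coord_scale)

lemma \<omega>_\<sigma>: "\<omega> (\<sigma> b) = b"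
  using LIMSEQ_unique[OF coord_tendsto[of "\<sigma> b"]] by (simp add: coord_\<sigma>)

lemma M_bounded: "bounded_linear M"
proof (rule bounded_linear_intro)
  show "M (x + y) = M x + M y" for x y by (rule M_add)
  show "M (r *\<^sub>R x) = r *\<^sub>R M x" for r x
    by (simp only: scaleR_vec M_scale)
  fix x
  have "norm (M x) \<le> onorm m * norm (T (\<sigma> x))" unfolding push_def by (rule onorm[OF m_bounded])
  also have "\<dots> \<le> onorm m * (onorm T * norm (\<sigma> x))"
    by (intro mult_left_mono onorm[OF T_bounded] onorm_pos_le[OF m_bounded])
  also have "\<dots> \<le> onorm m * (onorm T * (k * norm x))"
    by (intro mult_left_mono norm_section_le[OF is_section_\<sigma>] onorm_pos_le m_bounded T_bounded)
  finally show "norm (M x) \<le> norm x * (onorm m * onorm T * k)" by (simp add: mult_ac)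
qed

lemma \<omega>_T: "\<omega> (T x) = M (\<omega> x)"
proof (rule LIMSEQ_unique[OF coord_tendsto])
  show "(\<lambda>n. coord n (T x)) \<longlonglongrightarrow> M (\<omega> x)"
    unfolding coord_T by (intro bounded_linear.tendsto[OF M_bounded] LIMSEQ_Suc coord_tendsto)
qed

lemma \<omega>_T_iterate: "\<omega> ((T ^^ n) x) = (M ^^ n) (\<omega> x)"
  by (induction n) (simp_all add: \<omega>_T)

lemma eigenvalue_nonzero: "b \<noteq> 0 \<Longrightarrow> M b = \<mu> *s b \<Longrightarrow> \<mu> \<noteq> 0"
  using push_zero[OF is_section_\<sigma>, of b] by auto

lemma iterate_eigenvector: "M b = \<mu> *s b \<Longrightarrow> (M ^^ n) b = \<mu> ^ n *s b"
proof (induction n)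
  case (Suc n)
  show ?case by (simp add: Suc.IH[OF Suc.prems] M_scale Suc.prems mult.commute)
qed simp

text \<open>All vectors of the family \<open>T\<^sup>n \<circ> test_family i x\<close> lie on the range of \<open>\<sigma>\<close>, except for the
  component \<open>r\<close> of the one at position \<open>i\<close>. By Cramer's rule only \<open>r\<close> contributes to the defect,
  with a coefficient that an eigenvector \<open>b\<close> of \<open>M\<close> makes explicit.\<close>
lemma defect_test_family:
  assumes \<mu>: "M b = \<mu> *s b" "\<mu> \<noteq> 0"
  shows "defect n b (test_family i x)
    = (b $ i * \<Lambda> ^ n / \<mu> ^ n) *\<^sub>C ((T ^^ n) x - \<sigma> (m ((T ^^ n) x)))"
proof -
  let ?z = "\<lambda>j. (T ^^ n) (test_family i x j)"
  let ?z' = "\<lambda>j. \<sigma> (m (?z j))"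
  let ?r = "(T ^^ n) x - \<sigma> (m ((T ^^ n) x))"
  let ?D = "\<lambda>j. det (\<chi> l. ((\<lambda>l. m (?z l))(j := b)) l)"
  interpret \<sigma>: Vector_Spaces.linear "(*s)" scaleC \<sigma> by (rule section_linear[OF is_section_\<sigma>])
  have z: "?z j = ?z' j + (if j = i then ?r else 0)" for j
    by (simp add: test_family_def T_iterate_\<sigma> m_section[OF is_section_\<sigma>])
  have mz': "m (?z' j) = m (?z j)" for j by (rule m_section[OF is_section_\<sigma>])
  have "cramer_combination m b ?z = (\<Sum>j\<in>UNIV. ?D j *\<^sub>C ?z j)"
    by (simp only: cramer_combination_def)
  also have "\<dots> = (\<Sum>j\<in>UNIV. ?D j *\<^sub>C ?z' j + (if j = i then ?D i *\<^sub>C ?r else 0))"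
  proof (rule sum.cong[OF refl])
    fix j
    have "?D j *\<^sub>C ?z j = ?D j *\<^sub>C (?z' j + (if j = i then ?r else 0))" using z by simp
    then show "?D j *\<^sub>C ?z j = ?D j *\<^sub>C ?z' j + (if j = i then ?D i *\<^sub>C ?r else 0)"
      by (auto simp: scaleC_add_right simp del: fun_upd_apply)
  qed
  also have "\<dots> = (\<Sum>j\<in>UNIV. ?D j *\<^sub>C ?z' j) + ?D i *\<^sub>C ?r"
    by (simp only: sum.distrib sum.delta finite_class.finite_UNIV UNIV_I if_True)
  also have "(\<Sum>j\<in>UNIV. ?D j *\<^sub>C ?z' j) = cramer_combination m b ?z'"
    by (simp only: cramer_combination_def mz')
  also have "\<dots> = det (\<chi> j. m (?z' j)) *\<^sub>C \<sigma> b"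
    by (rule cramer_combination_section[OF m.linear_axioms \<sigma>.linear_axioms]) (simp only: mz')
  finally have "defect n b (test_family i x) = ?D i *\<^sub>C ?r"
    by (simp only: defect_def mz') simp
  moreover have "?D i = b $ i * \<Lambda> ^ n / \<mu> ^ n"
  proof -
    let ?b = "inverse (\<mu> ^ n) *s b"
    interpret Mn: Vector_Spaces.linear "(*s)" "(*s)" "M ^^ n" by (rule M_iterate_linear)
    \<comment> \<open>This turns the replaced row into an image under \<open>M ^^ n\<close> like all
      the others, so that the determinant factors.\<close>
    have "b = (M ^^ n) ?b" using \<mu>(2) by (simp add: Mn.scale iterate_eigenvector[OF \<mu>(1)])
    then have "((\<lambda>l. m (?z l))(i := b)) j = (M ^^ n) (((\<lambda>j. axis j 1)(i := ?b)) j)" for j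
      by (cases "j = i") (simp_all add: m_test_family)
    then have "?D i = ?b $ i * \<Lambda> ^ n"
      by (simp only: det_endo_rows[OF M_iterate_linear] det_axis_update endo_det_M_iterate)
    then show ?thesis by (simp add: field_simps)
  qed
  ultimately show ?thesis by simp
qed

text \<open>The defect is at most of order \<open>cmod \<Lambda> ^ n * q ^ n\<close>, while the
  deviation of \<open>(T ^^ n) x\<close> from the range of \<open>\<sigma>\<close> enters it with a
  coefficient of order \<open>cmod \<Lambda> ^ n / cmod \<mu> ^ n\<close>; the quotient is the rate.
  On the kernel of \<open>\<omega>\<close> this deviation controls the whole vector, because
  \<open>m ((T ^^ n) x)\<close> is then minus its value under \<open>\<omega>\<close>.\<close>

lemma kernel_decay:
  assumes b: "b \<noteq> 0" and \<mu>: "M b = \<mu> *s b"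
  obtains c8 where "c8 \<ge> 0" "\<And>x n. \<omega> x = 0 \<Longrightarrow> norm ((T ^^ n) x) \<le> c8 * (q * cmod \<mu>) ^ n * norm x"
proof -
  \<comment> \<open>Inserting \<open>x\<close> in a slot where \<open>b\<close> has a nonzero
    component makes the coefficient of the deviation nonzero.\<close>
  obtain i where bi: "b $ i \<noteq> 0" using b by (auto simp: vec_eq_iff)
  have \<mu>0: "\<mu> \<noteq> 0" using eigenvalue_nonzero[OF b \<mu>] .
  obtain c5 where c5: "c5 \<ge> 0"
    "\<And>x n b. norm (defect n b x) \<le> c5 * cmod \<Lambda> ^ n * q ^ n * norm b * (\<Prod>j\<in>UNIV. norm (x j))"
    using rel_volume_defect_bounds by metis
  obtain c7 where c7: "c7 \<ge> 0" "\<And>x. norm (\<omega> x) \<le> c7 * norm x" using \<omega>_bounded by blast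
  define e where "e = c5 * norm b * k ^ (CARD('p) - 1) / cmod (b $ i)"
  have e: "e \<ge> 0" using c5 k_pos by (simp add: e_def)
  have r: "norm ((T ^^ n) x - \<sigma> (m ((T ^^ n) x))) \<le> e * (q * cmod \<mu>) ^ n * norm x" for n x
  proof -
    let ?r = "(T ^^ n) x - \<sigma> (m ((T ^^ n) x))"
    have "cmod (b $ i) * cmod \<Lambda> ^ n / cmod \<mu> ^ n * norm ?r = norm (defect n b (test_family i x))"
      unfolding defect_test_family[OF \<mu> \<mu>0] by (simp add: norm_scaleC norm_mult norm_divide norm_power)
    also have "\<dots> \<le> c5 * cmod \<Lambda> ^ n * q ^ n * norm b * (\<Prod>j\<in>UNIV. norm (test_family i x j))"
      by (rule c5)
    also have "\<dots> \<le> c5 * cmod \<Lambda> ^ n * q ^ n * norm b * (k ^ (CARD('p) - 1) * norm x)"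
      using c5 q by (intro mult_left_mono prod_test_family_le) auto
    finally show ?thesis
      using bi \<mu>0 \<Lambda>_nonzero by (simp add: e_def field_simps power_mult_distrib)
  qed
  show ?thesis
  proof
    show "(1 + k * c7) * e \<ge> 0" using e c7 k_pos by simp
    fix x n assume x: "\<omega> x = 0"
    let ?y = "(T ^^ n) x"
    let ?r = "?y - \<sigma> (m ?y)"
    have "?y = ?r + \<sigma> (m ?y)" by simp
    then have "\<omega> ?y = \<omega> ?r + m ?y" by (metis \<omega>_add \<omega>_\<sigma>)
    moreover have "\<omega> ?y = 0"
    proof -
      interpret Mn: Vector_Spaces.linear "(*s)" "(*s)" "M ^^ n" by (rule M_iterate_linear)
      show ?thesis by (simp add: \<omega>_T_iterate x)
    qed
    ultimately have "norm (m ?y) \<le> c7 * norm ?r"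
      using c7(2)[of ?r] by (metis add_eq_0_iff norm_minus_cancel)
    then have "norm (\<sigma> (m ?y)) \<le> k * (c7 * norm ?r)"
      using order_trans[OF norm_section_le[OF is_section_\<sigma>]] k_pos by (meson mult_left_mono less_imp_le)
    then have "norm ?y \<le> (1 + k * c7) * norm ?r"
      using norm_triangle_sub[of ?y "\<sigma> (m ?y)"] by (simp add: algebra_simps)
    also have "\<dots> \<le> (1 + k * c7) * (e * (q * cmod \<mu>) ^ n * norm x)"
      using k_pos c7 by (intro mult_left_mono r) auto
    finally show "norm ?y \<le> (1 + k * c7) * e * (q * cmod \<mu>) ^ n * norm x" by (simp add: mult_ac)
  qed
qed

end

section \<open>Spectra\<close>

lemma endo_bounded:
  fixes B :: "complex ^ 'p::finite \<Rightarrow> complex ^ 'p"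
  assumes "Vector_Spaces.linear (*s) (*s) B"
  obtains K where "K \<ge> 0" "\<And>u. norm (B u) \<le> K * norm u"
proof
  interpret B: Vector_Spaces.linear "(*s)" "(*s)" B by (rule assms)
  let ?K = "\<Sum>j\<in>UNIV. norm (B (axis j 1))"
  show "?K \<ge> 0" by (rule sum_nonneg) simp
  fix u :: "complex ^ 'p"
  have "B u = B (\<Sum>j\<in>UNIV. u $ j *s axis j 1)" by (simp only: basis_expansion)
  also have "\<dots> = (\<Sum>j\<in>UNIV. u $ j *s B (axis j 1))" by (simp only: B.sum B.scale)
  finally have "norm (B u) \<le> (\<Sum>j\<in>UNIV. norm (u $ j *s B (axis j 1)))" using norm_sum by metis
  also have "\<dots> \<le> (\<Sum>j\<in>UNIV. norm u * norm (B (axis j 1)))"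
    by (intro sum_mono) (simp add: norm_vec_scale Finite_Cartesian_Product.norm_nth_le mult_right_mono)
  finally show "norm (B u) \<le> ?K * norm u" by (simp add: sum_distrib_left mult.commute)
qed

context contracting_cone
begin

text \<open>If \<open>\<nu>\<close> is not an eigenvalue of \<open>M\<close>, then
  \<open>M - \<nu>\<close> is invertible by finite dimension, and its inverse carried over by
  \<open>\<sigma>\<close> and \<open>m\<close> is a bounded resolvent on the range of
  \<open>\<sigma>\<close>.\<close>

lemma spectrum_range_subset:
  assumes "\<nu> \<in> spectrum_on (range \<sigma>) T"
  obtains b where "b \<noteq> 0" "M b = \<nu> *s b"
proof (rule ccontr)
  note found = that
  assume no: "\<not> thesis"
  let ?A = "\<lambda>b. M b - \<nu> *s b"
  have "Vector_Spaces.linear (*s) (*s) ?A"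
    by (intro vec.linear_compose_sub M_linear vec.linear_scale_self)
  moreover have "b = 0" if "?A b = 0" for b using no found[of b] \<open>?A b = 0\<close> by auto
  ultimately obtain B where B: "Vector_Spaces.linear (*s) (*s) B" "\<And>b. ?A (B b) = b" "\<And>b. B (?A b) = b"
    by (rule endo_inverse) blast+
  obtain K where K: "K \<ge> 0" "\<And>u. norm (B u) \<le> K * norm u" using endo_bounded[OF B(1)] by blast
  interpret \<sigma>: Vector_Spaces.linear "(*s)" scaleC \<sigma> by (rule section_linear[OF is_section_\<sigma>])
  interpret B: Vector_Spaces.linear "(*s)" "(*s)" B by (rule B(1))
  let ?S = "\<lambda>v. \<sigma> (B (m v))"
  have shift: "T (\<sigma> a) - \<nu> *\<^sub>C \<sigma> a = \<sigma> (?A a)" for a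
    by (simp only: T_\<sigma> \<sigma>.diff \<sigma>.scale)
  have "bounded_operator_on (range \<sigma>) ?S"
    unfolding bounded_operator_on_def
  proof (intro conjI ballI allI)
    have "norm (?S v) \<le> k * (K * (onorm m * norm v))" for v
      using order_trans[OF norm_section_le[OF is_section_\<sigma>] mult_left_mono[OF
            order_trans[OF K(2) mult_left_mono[OF onorm[OF m_bounded] K(1)]]]] k_pos by simp
    then show "\<exists>L. \<forall>v\<in>range \<sigma>. norm (?S v) \<le> L * norm v"
      by (intro exI[of _ "k * K * onorm m"]) (simp add: mult.assoc)
  qed (auto simp: m.add m.scale B.add B.scale \<sigma>.add \<sigma>.scale)
  moreover have "?S (T v - \<nu> *\<^sub>C v) = v \<and> T (?S v) - \<nu> *\<^sub>C ?S v = v" if "v \<in> range \<sigma>" for v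
  proof -
    obtain a where v: "v = \<sigma> a" using \<open>v \<in> range \<sigma>\<close> by blast
    show ?thesis unfolding v shift m_section[OF is_section_\<sigma>] B by simp
  qed
  ultimately show False using assms unfolding spectrum_on_def by blast
qed

lemma eigenvalue_in_spectrum:
  assumes "b \<noteq> 0" "M b = \<mu> *s b"
  shows "\<mu> \<in> spectrum_on (range \<sigma>) T"
proof (rule ccontr)
  interpret \<sigma>: Vector_Spaces.linear "(*s)" scaleC \<sigma> by (rule section_linear[OF is_section_\<sigma>])
  assume "\<mu> \<notin> spectrum_on (range \<sigma>) T"
  then obtain S where S: "bounded_operator_on (range \<sigma>) S" "S (T (\<sigma> b) - \<mu> *\<^sub>C \<sigma> b) = \<sigma> b"
    unfolding spectrum_on_def by blast
  have "S (0 *\<^sub>C \<sigma> b) = 0 *\<^sub>C S (\<sigma> b)" using S(1) unfolding bounded_operator_on_def by blast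
  then have "S 0 = 0" by simp
  moreover have "T (\<sigma> b) - \<mu> *\<^sub>C \<sigma> b = 0" by (simp add: T_\<sigma> assms(2) \<sigma>.scale)
  ultimately have "\<sigma> b = 0" using S(2) by simp
  then show False using section_zero[OF is_section_\<sigma>] assms(1) by blast
qed

lemma \<omega>_bounded_linear: "bounded_linear \<omega>"
proof -
  obtain c7 where c7: "\<And>x. norm (\<omega> x) \<le> c7 * norm x" using \<omega>_bounded by blast
  have "\<omega> (r *\<^sub>R x) = r *\<^sub>R \<omega> x" for r x
    by (simp only: scaleR_vec \<omega>_scale flip: scaleC_of_real)
  then show ?thesis
    by (intro bounded_linear_intro[of _ c7] \<omega>_add) (use c7 in \<open>auto simp: mult.commute\<close>)
qed

lemma \<omega>_zero: "\<omega> 0 = 0"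
  using \<omega>_scale[of 0 0] by simp

lemma kernel_T: "\<omega> x = 0 \<Longrightarrow> \<omega> (T x) = 0"
  unfolding \<omega>_T using M_scale[of 0 0] by simp

lemma kernel_T_iterate: "\<omega> x = 0 \<Longrightarrow> \<omega> ((T ^^ n) x) = 0"
  by (induction n) (auto intro: kernel_T)

lemma kernel_closed: "closed {x. \<omega> x = 0}"
  using continuous_closed_preimage_constant[of UNIV \<omega> 0]
    linear_continuous_on[OF \<omega>_bounded_linear] by simp

text \<open>By \<open>kernel_decay\<close>, the Neumann series of the resolvent converges for \<open>\<bar>\<nu>\<bar> > q \<bar>\<mu>\<bar>\<close>.\<close>
lemma spectrum_kernel_le:
  assumes b: "b \<noteq> 0" and \<mu>: "M b = \<mu> *s b" and \<nu>: "\<nu> \<in> spectrum_on {x. \<omega> x = 0} T"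
  shows "cmod \<nu> \<le> q * cmod \<mu>"
proof (rule ccontr)
  assume "\<not> cmod \<nu> \<le> q * cmod \<mu>"
  then have gt: "q * cmod \<mu> < cmod \<nu>" by simp
  have \<nu>0: "\<nu> \<noteq> 0" using gt q by (auto simp: mult_less_0_iff)
  let ?W = "{x. \<omega> x = 0}"
  obtain c8 where c8: "c8 \<ge> 0" "\<And>x n. \<omega> x = 0 \<Longrightarrow> norm ((T ^^ n) x) \<le> c8 * (q * cmod \<mu>) ^ n * norm x"
    using kernel_decay[OF b \<mu>] by blast
  define r where "r = q * cmod \<mu> / cmod \<nu>"
  have r: "0 \<le> r" "r < 1" using gt q \<nu>0 by (auto simp: r_def)
  define t where "t = (\<lambda>n x. inverse \<nu> ^ Suc n *\<^sub>C (T ^^ n) x)"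
  interpret Tn: Vector_Spaces.linear scaleC scaleC "T ^^ n" for n by (rule T_iterate_linear)
  have t_le: "norm (t n x) \<le> c8 / cmod \<nu> * norm x * r ^ n" if "x \<in> ?W" for n x
  proof -
    have "norm (t n x) = inverse (cmod \<nu>) ^ Suc n * norm ((T ^^ n) x)"
      by (simp add: t_def norm_scaleC norm_power norm_inverse norm_mult)
    also have "\<dots> \<le> inverse (cmod \<nu>) ^ Suc n * (c8 * (q * cmod \<mu>) ^ n * norm x)"
      using that by (intro mult_left_mono c8) auto
    finally show ?thesis by (simp add: r_def field_simps power_divide)
  qed
  have geo: "summable (\<lambda>n. c8 / cmod \<nu> * norm x * r ^ n)" for x :: 'a
    using r by (intro summable_mult summable_geometric) simp
  have sum_t: "summable (\<lambda>n. t n x)" if "x \<in> ?W" for x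
    by (rule summable_comparison_test'[OF geo]) (use t_le[OF that] in auto)
  have T_t: "T (t n x) = \<nu> *\<^sub>C t (Suc n) x" "t n (T x) = \<nu> *\<^sub>C t (Suc n) x" for n x
    using \<nu>0 by (simp_all add: t_def T.scale funpow_swap1 scaleC_scaleC)
  have t0: "\<nu> *\<^sub>C t 0 x = x" for x using \<nu>0 by (simp add: t_def scaleC_scaleC)
  \<comment> \<open>The series itself inverts \<open>\<nu> - T\<close>; the sign adapts it to
    \<open>T - \<nu>\<close>.\<close>
  define S where "S = (\<lambda>x. - (suminf (\<lambda>n. t n x)))"
  \<comment> \<open>By \<open>T_t\<close>, both \<open>T\<close> applied to the series and the
    series at \<open>T x\<close> become this shifted series, so both resolvent identities follow
    from it.\<close>
  have tail: "suminf (\<lambda>n. \<nu> *\<^sub>C t (Suc n) x) = - (\<nu> *\<^sub>C S x) - x" if "x \<in> ?W" for x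
  proof -
    have st: "summable (\<lambda>n. t (Suc n) x)"
      using summable_Suc_iff[of "\<lambda>n. t n x"] sum_t[OF that] by blast
    have "suminf (\<lambda>n. \<nu> *\<^sub>C t (Suc n) x) = \<nu> *\<^sub>C (suminf (\<lambda>n. t (Suc n) x))"
      by (rule bounded_linear.suminf[OF scaleC_bounded st, symmetric])
    also have "suminf (\<lambda>n. t (Suc n) x) = suminf (\<lambda>n. t n x) - t 0 x"
      by (rule suminf_split_head[OF sum_t[OF that]])
    finally show ?thesis by (simp add: S_def complex_vector.scale_right_diff_distrib t0)
  qed
  have t_add: "t n (x + y) = t n x + t n y" and t_scale: "t n (a *\<^sub>C x) = a *\<^sub>C t n x" for n x y a
    by (simp_all add: t_def Tn.add Tn.scale scaleC_add_right scaleC_scaleC mult_ac)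
  have S_add: "S (x + y) = S x + S y" if "x \<in> ?W" "y \<in> ?W" for x y
    by (simp add: S_def t_add suminf_add[OF sum_t[OF that(1)] sum_t[OF that(2)], symmetric])
  have S_scale: "S (a *\<^sub>C x) = a *\<^sub>C S x" if "x \<in> ?W" for a x
    by (simp add: S_def t_scale bounded_linear.suminf[OF scaleC_bounded sum_t[OF that], symmetric])
  have TW: "T x \<in> ?W" if "x \<in> ?W" for x using that kernel_T by simp
  have scaleW: "a *\<^sub>C x \<in> ?W" if "x \<in> ?W" for a x using that by (simp add: \<omega>_scale)
  have "bounded_operator_on ?W S"
    unfolding bounded_operator_on_def
  proof (intro conjI ballI allI)
    show "S x \<in> ?W" if "x \<in> ?W" for x
    proof -
      have "\<omega> (t n x) = 0" for n using that by (simp add: t_def \<omega>_scale kernel_T_iterate)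
      then have "\<omega> (suminf (\<lambda>n. t n x)) = 0"
        using bounded_linear.suminf[OF \<omega>_bounded_linear sum_t[OF that]] by simp
      then show ?thesis using \<omega>_scale[of "-1" "suminf (\<lambda>n. t n x)"] by (simp add: S_def)
    qed
    have "norm (S x) \<le> c8 / cmod \<nu> / (1 - r) * norm x" if "x \<in> ?W" for x
    proof -
      have sn: "summable (\<lambda>n. norm (t n x))"
        by (rule summable_comparison_test'[OF geo]) (use t_le[OF that] in auto)
      have "norm (S x) \<le> suminf (\<lambda>n. norm (t n x))" unfolding S_def norm_minus_cancel by (rule summable_norm[OF sn])
      also have "\<dots> \<le> suminf (\<lambda>n. c8 / cmod \<nu> * norm x * r ^ n)" by (rule suminf_le[OF t_le[OF that] sn geo])
      also have "\<dots> = c8 / cmod \<nu> * norm x * (1 / (1 - r))"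
        using r by (subst suminf_mult) (auto simp: suminf_geometric summable_geometric)
      finally show ?thesis by (simp add: mult_ac)
    qed
    then show "\<exists>B. \<forall>x\<in>?W. norm (S x) \<le> B * norm x" by blast
  qed (use S_add S_scale in auto)
  moreover have "S (T x - \<nu> *\<^sub>C x) = x \<and> T (S x) - \<nu> *\<^sub>C S x = x" if x: "x \<in> ?W" for x
  proof
    have "S (T x - \<nu> *\<^sub>C x) = S (T x + (- \<nu>) *\<^sub>C x)" by simp
    also have "\<dots> = S (T x) + (- \<nu>) *\<^sub>C S x"
      by (simp only: S_add[OF TW[OF x] scaleW[OF x]] S_scale[OF x])
    also have "S (T x) = \<nu> *\<^sub>C S x + x" using tail[OF x] by (simp add: S_def T_t)
    finally show "S (T x - \<nu> *\<^sub>C x) = x" by simp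
    have "T (suminf (\<lambda>n. t n x)) = - (\<nu> *\<^sub>C S x) - x"
      using bounded_linear.suminf[OF T_bounded sum_t[OF x]] tail[OF x] by (simp add: T_t)
    moreover have "T (S x) = - T (suminf (\<lambda>n. t n x))" by (simp add: S_def T.neg)
    ultimately show "T (S x) - \<nu> *\<^sub>C S x = x" by simp
  qed
  ultimately show False using \<nu> unfolding spectrum_on_def by blast
qed

text \<open>Without a point in this spectrum \<open>spectral_gap\<close> would say nothing; it
  matters for \<eta> = 0, where the other spectrum must be shown to contain at most 0.\<close>

lemma spectrum_range_nonempty: "spectrum_on (range \<sigma>) T \<noteq> {}"
  using eigenvector_exists[OF M_linear] eigenvalue_in_spectrum by blast

lemma spectral_gap:
  "\<nu> \<in> spectrum_on {x. \<omega> x = 0} T \<Longrightarrow> \<mu> \<in> spectrum_on (range \<sigma>) T \<Longrightarrow> cmod \<nu> \<le> q * cmod \<mu>"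
  by (metis spectrum_range_subset spectrum_kernel_le)

lemma invariant_splitting:
  "subspace_of_dim CARD('p) (range \<sigma>)" "csubspace {x. \<omega> x = 0}" "closed {x. \<omega> x = 0}"
  "range \<sigma> \<inter> {x. \<omega> x = 0} = {0}" "\<forall>x. \<exists>v\<in>range \<sigma>. \<exists>w\<in>{x. \<omega> x = 0}. x = v + w"
  "T ` range \<sigma> \<subseteq> range \<sigma>" "T ` {x. \<omega> x = 0} \<subseteq> {x. \<omega> x = 0}"
proof -
  interpret \<sigma>: Vector_Spaces.linear "(*s)" scaleC \<sigma> by (rule section_linear[OF is_section_\<sigma>])
  show "subspace_of_dim CARD('p) (range \<sigma>)" by (rule subspace_of_dim_section[OF is_section_\<sigma>])
  show "csubspace {x. \<omega> x = 0}"
    by (rule complex_vector.subspaceI) (auto simp: \<omega>_zero \<omega>_add \<omega>_scale)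
  show "closed {x. \<omega> x = 0}" by (rule kernel_closed)
  have "0 \<in> range \<sigma>" using \<sigma>.zero by (metis rangeI)
  then show "range \<sigma> \<inter> {x. \<omega> x = 0} = {0}" by (auto simp: \<omega>_\<sigma> \<omega>_zero)
  show "\<forall>x. \<exists>v\<in>range \<sigma>. \<exists>w\<in>{x. \<omega> x = 0}. x = v + w"
  proof
    fix x
    have "\<omega> (x - \<sigma> (\<omega> x)) = 0"
      using \<omega>_add[of "x - \<sigma> (\<omega> x)" "\<sigma> (\<omega> x)"] by (simp add: \<omega>_\<sigma>)
    then show "\<exists>v\<in>range \<sigma>. \<exists>w\<in>{x. \<omega> x = 0}. x = v + w"
      by (intro bexI[of _ "\<sigma> (\<omega> x)"] bexI[of _ "x - \<sigma> (\<omega> x)"]) auto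
  qed
  show "T ` range \<sigma> \<subseteq> range \<sigma>" by (auto simp: T_\<sigma>)
  show "T ` {x. \<omega> x = 0} \<subseteq> {x. \<omega> x = 0}" by (auto intro: kernel_T)
qed

end

section \<open>From the cone hypotheses to the splitting\<close>

lemma (in invariant_cone) section_exists:
  assumes V: "subspace_of_dim CARD('p) V" "V \<subseteq> C"
  obtains s where "is_section s"
proof -
  obtain B where B: "finite B" "card B = CARD('p)" "\<not> cdependent B" "cspan B = V"
    using V(1) unfolding subspace_of_dim_def by blast
  obtain y :: "'p \<Rightarrow> 'a" where y: "bij_betw y UNIV B"
    using finite_same_card_bij[of "UNIV :: 'p set" B] B by auto
  have ran: "range y = B" using y by (simp add: bij_betw_def)
  \<comment> \<open>Independence of \<open>B\<close> passes to the projections, because the aperture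
    leaves \<open>m\<close> no kernel on subspaces of \<open>C\<close>.\<close>
  have "det (\<chi> j. m (y j)) \<noteq> 0"
  proof
    assume "det (\<chi> j. m (y j)) = 0"
    then obtain e l where el: "e l \<noteq> 0" "(\<Sum>j\<in>UNIV. e j *s m (y j)) = 0"
      by (rule det_rows_zero_dependent)
    let ?u = "\<Sum>j\<in>UNIV. e j *\<^sub>C y j"
    have "?u \<in> cspan (range y)"
      by (intro complex_vector.span_sum complex_vector.span_scale complex_vector.span_base) simp
    then have "?u \<in> C" using B V ran by auto
    moreover have "m ?u = 0" by (simp add: m.sum m.scale el(2))
    ultimately have u: "?u = 0" using aperture[of ?u] by auto
    let ?f = "\<lambda>v. e (inv y v)"
    have inv: "inv y (y j) = j" for j using y by (simp add: bij_betw_def)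
    have "(\<Sum>v\<in>B. ?f v *\<^sub>C v) = ?u"
      using sum.reindex_bij_betw[OF y, of "\<lambda>v. ?f v *\<^sub>C v"] by (simp add: inv)
    then have "cdependent B"
      unfolding complex_vector.dependent_finite[OF B(1)] using u el(1) ran inv
      by (intro exI[of _ ?f]) (auto intro!: bexI[of _ "y l"])
    then show False using B(3) by blast
  qed
  then obtain s where "Vector_Spaces.linear (*s) scaleC s" "\<And>b. m (s b) = b"
    "\<And>b. s b \<in> cspan (range y)"
    using section_of_family[OF m.linear_axioms] by metis
  then have "is_section s" using B V ran unfolding is_section_def by auto
  then show ?thesis by (rule that)
qed

theorem theorem5p7:
  fixes C :: "'a::complex_banach set"
    and T :: "'a \<Rightarrow> 'a"
    and \<delta> :: "'a set \<Rightarrow> 'a \<Rightarrow> 'a \<Rightarrow> ennreal"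
    and nrm :: "('a, 'p::finite) ext_power \<Rightarrow> real"
    and \<Delta> :: ennreal
    and K \<eta> :: real
  assumes gauge: "\<delta> = hyperbolic_gauge \<or> \<delta> = log_gauge"
    and nrm: "nrm = ext_norm1 \<or> nrm = ext_norm2"
    and cone: "p_cone CARD('p) C"
    and reproducing: "p_reproducing nrm C"
    and K: "K > 0"
    and aperture: "aperture_bounded TYPE('p) C K"
    and T: "bounded_clinear scaleC T"
    and T_cone: "T ` (C - {0}) \<subseteq> C - {0}"
    and diam: "cone_diam \<delta> CARD('p) C (T ` C) = \<Delta>"
    and diam_finite: "\<Delta> < \<infinity>"
    and \<eta>: "contraction_coefficient \<delta> CARD('p) C T \<eta>"
  shows "\<exists>V W. subspace_of_dim CARD('p) V \<and>
      csubspace W \<and> closed W \<and>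
      V \<inter> W = {0} \<and> (\<forall>x. \<exists>v\<in>V. \<exists>w\<in>W. x = v + w) \<and>
      T ` V \<subseteq> V \<and> T ` W \<subseteq> W \<and>
      (SUP \<mu>\<in>spectrum_on W T. ennreal (cmod \<mu>))
        \<le> ennreal \<eta> * (INF \<mu>\<in>spectrum_on V T. ennreal (cmod \<mu>))"
proof -
  have \<eta>01: "0 \<le> \<eta>" "\<eta> < 1" using \<eta> by (auto simp: contraction_coefficient_def)
  obtain m :: "'a \<Rightarrow> complex ^ 'p" where m: "bounded_clinear (*s) m" "m \<noteq> (\<lambda>u. 0)"
    and ap: "\<And>u. u \<in> C \<Longrightarrow> onorm m * norm u \<le> K * norm (m u)"
    using aperture unfolding aperture_bounded_def by blast
  have bm: "bounded_linear m" using m by (simp add: bounded_clinear_def)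
  have om: "onorm m > 0" using onorm_pos_lt[OF bm] m(2) by auto
  obtain V where V: "subspace_of_dim CARD('p) V" "V \<subseteq> C"
    using cone unfolding p_cone_def by blast
  have "0 \<in> V" using V(1) unfolding subspace_of_dim_def by (metis complex_vector.span_zero)
  then have C0: "0 \<in> C" using V by blast
  interpret T: Vector_Spaces.linear scaleC scaleC T using T by (simp add: bounded_clinear_def)
  interpret invariant_cone C m T "K / onorm m"
  proof
    show "closed C" using cone by (simp add: p_cone_def)
    show "T u \<in> C" if "u \<in> C" for u using T_cone C0 that by (cases "u = 0") auto
    show "u = 0" if "u \<in> C" "T u = 0" for u using T_cone that by blast
    show "norm u \<le> K / onorm m * norm (m u)" if "u \<in> C" for u
      using ap[OF that] om by (simp add: field_simps)
    show "0 < K / onorm m" using K om by simp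
  qed (use m T in auto)
  obtain s0 where s0: "is_section s0" using section_exists[OF V] .
  have ne: "\<exists>u. m u $ i \<noteq> 0" for i
    by (rule exI[of _ "s0 (axis i 1)"]) (simp add: m_section[OF s0])
  obtain A where A: "A \<ge> 0"
    "\<And>x :: 'p \<Rightarrow> 'a. \<exists>(l::nat) y. (\<forall>i<l. cspan (range (y i)) \<subseteq> C) \<and>
      wedge x = (\<Sum>i<l. wedge (y i)) \<and>
      (\<Sum>i<l. cmod (det (\<chi> j. m (y i j)))) \<le> A * (\<Prod>j\<in>UNIV. norm (x j))"
    using reproducing_decomposition[OF nrm reproducing m(1) ne] by metis
  have diam': "cone_diam \<delta> CARD('p) C (T ` C) < \<infinity>" using diam diam_finite by simp
  have contracting: "\<exists>c. contracting_cone C m T (K / onorm m) q c A s0" if q: "\<eta> < q" "q < 1" for q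
  proof -
    have "0 < q" "\<eta> \<le> q" using q \<eta>01 by auto
    then obtain c where "c \<ge> 0" "\<And>s s' n b. is_section s \<Longrightarrow> is_section s' \<Longrightarrow>
        norm ((step ^^ n) s b - (step ^^ n) s' b) \<le> c * q ^ n * norm b"
      using iterate_contraction[OF gauge \<eta> diam'] by metis
    then have "contracting_cone C m T (K / onorm m) q c A s0"
      using \<open>0 < q\<close> q A s0 by unfold_locales auto
    then show ?thesis by blast
  qed
  \<comment> \<open>The midpoint between \<eta> and 1 is one admissible rate; it serves to fix the
    two subspaces.\<close>
  obtain c1 where "contracting_cone C m T (K / onorm m) ((1 + \<eta>) / 2) c1 A s0"
    using contracting[of "(1 + \<eta>) / 2"] \<eta>01 by auto
  then interpret one: contracting_cone C m T "K / onorm m" "(1 + \<eta>) / 2" c1 A s0 .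
  let ?V = "range one.\<sigma>" and ?W = "{x. one.\<omega> x = 0}"
  have gap: "cmod \<nu> \<le> \<eta> * cmod \<mu>" if \<nu>: "\<nu> \<in> spectrum_on ?W T" and \<mu>: "\<mu> \<in> spectrum_on ?V T" for \<nu> \<mu>
  proof (rule field_le_epsilon)
    fix e :: real assume e: "e > 0"
    \<comment> \<open>The first bound keeps \<open>q\<close> below 1; the second makes the excess of
      \<open>q\<close> over \<eta>, multiplied by \<open>cmod \<mu>\<close>, at most
      \<open>e\<close>. The 1 avoids a zero denominator.\<close>
    define q where "q = min ((1 + \<eta>) / 2) (\<eta> + e / (cmod \<mu> + 1))"
    have "e / (cmod \<mu> + 1) > 0" using e by (simp add: add_nonneg_pos)
    then have "\<eta> < \<eta> + e / (cmod \<mu> + 1)" by simp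
    moreover have "\<eta> < (1 + \<eta>) / 2" using \<eta>01(2) by (simp add: less_divide_eq)
    ultimately have q: "\<eta> < q" by (simp add: q_def)
    have "q \<le> (1 + \<eta>) / 2" unfolding q_def by (rule min.cobounded1)
    then have "q < 1" using \<eta>01 by simp
    with q obtain c where "contracting_cone C m T (K / onorm m) q c A s0" using contracting by blast
    \<comment> \<open>As \<open>\<sigma>\<close> and \<open>\<omega>\<close> do not depend on the
      rate, the gap at rate \<open>q\<close> concerns the same two subspaces.\<close>
    then have "cmod \<nu> \<le> q * cmod \<mu>"
      using contracting_cone.spectral_gap \<nu> \<mu> by blast
    also have "\<dots> \<le> (\<eta> + e / (cmod \<mu> + 1)) * cmod \<mu>"
      unfolding q_def by (intro mult_right_mono min.cobounded2) simp
    also have "\<dots> = \<eta> * cmod \<mu> + e * (cmod \<mu> / (cmod \<mu> + 1))" by (simp add: algebra_simps)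
    also have "e * (cmod \<mu> / (cmod \<mu> + 1)) \<le> e * 1"
      using e by (intro mult_left_mono) (auto simp: divide_le_eq_1 add_nonneg_pos)
    finally show "cmod \<nu> \<le> \<eta> * cmod \<mu> + e" by simp
  qed
  have "(SUP \<nu>\<in>spectrum_on ?W T. ennreal (cmod \<nu>))
      \<le> ennreal \<eta> * (INF \<mu>\<in>spectrum_on ?V T. ennreal (cmod \<mu>))"
  proof (rule SUP_least)
    fix \<nu> assume \<nu>: "\<nu> \<in> spectrum_on ?W T"
    show "ennreal (cmod \<nu>) \<le> ennreal \<eta> * (INF \<mu>\<in>spectrum_on ?V T. ennreal (cmod \<mu>))"
    \<comment> \<open>For positive \<eta>, dividing by it turns the claim into a lower bound for the
      infimum. For \<eta> = 0 the right-hand side is 0, and any eigenvalue on the range of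
      \<open>\<sigma>\<close> forces \<nu> = 0.\<close>
    proof (cases "\<eta> = 0")
      case True
      then have "cmod \<nu> \<le> 0" using one.spectrum_range_nonempty gap[OF \<nu>] by auto
      then show ?thesis by simp
    next
      case False
      then have \<eta>0: "\<eta> > 0" using \<eta>01 by simp
      have "ennreal (cmod \<nu> / \<eta>) \<le> (INF \<mu>\<in>spectrum_on ?V T. ennreal (cmod \<mu>))"
        using gap[OF \<nu>] \<eta>0 by (intro INF_greatest ennreal_leI) (simp add: divide_le_eq mult.commute)
      then have "ennreal \<eta> * ennreal (cmod \<nu> / \<eta>) \<le> ennreal \<eta> * (INF \<mu>\<in>spectrum_on ?V T. ennreal (cmod \<mu>))"
        by (rule mult_left_mono) simp
      moreover have "ennreal \<eta> * ennreal (cmod \<nu> / \<eta>) = ennreal (cmod \<nu>)"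
        using \<eta>0 by (simp flip: ennreal_mult)
      ultimately show ?thesis by simp
    qed
  qed
  then show ?thesis
    using one.invariant_splitting by (intro exI[of _ ?V] exI[of _ ?W]) simp
qed

end
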